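(* Let $\Delta\in\mathbb Z$ be a non-square with $\Delta\equiv 0$ or $1\bmod 4$, let $K=\mathbb Q(\sqrt\Delta)$ with discriminant $\mathsf d_K$, and let $m\in\mathbb N$ with $\Delta=\mathsf d_Km^2$. Let $\mathfrak F_\Delta$ be the (additively written) composition class group of not negative definite primitive integral binary quadratic forms of discriminant $\Delta$, and let $R_m(\Delta)$, $R_m^\circ(\Delta)$, the classes $F_p\in\mathfrak F_\Delta$, and $\vartheta\colon R_m(\Delta)\to\mathcal F(\mathfrak F_\Delta)$, $\vartheta(n)=\prod_{p\in\mathbb P_m}F_p^{\mathsf v_p(n)/f_p}$, be as defined in the context. Then: 1. For every $n\in R_m(\Delta)$: $n\in R_m^\circ(\Delta)$ if and only if $\vartheta(n)\in\mathcal B_\pm(\mathfrak F_\Delta)$. 2. $\vartheta_0=\vartheta|_{R_m^\circ(\Delta)}\colon R_m^\circ(\Delta)\to\mathcal B_\pm(\mathfrak F_\Delta)$ is a transfer homomorphism satisfying $\mathsf c(R_m^\circ(\Delta),\vartheta_0)\le 2$.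
   Context: **Forms.** For $a,b,c\in\mathbb Z$ with $\gcd(a,b,c)=1$ and $\Delta=b^2-4ac$, the form $aX^2+bXY+cY^2$, if not negative definite, has a class $[\![a,b,c]\!]\in\mathfrak F_\Delta$ under proper equivalence; $\mathfrak F_\Delta$ is a finite abelian group under Gauss composition. Write $\Delta=4D+s$ with $D\in\mathbb Z$, $s\in\{0,1\}$. The zero element is the principal class $O=[\![1,s,-D]\!]$, and $-[\![a,b,c]\!]=[\![a,-b,c]\!]$. A class $F$ represents $n$ if some (equivalently every) form $f\in F$ satisfies $n=f(x,y)$ for some $x,y\in\mathbb Z$. $\mathbb P_m$ is the set of primes not dividing $m$ and $\mathbb N_m$ the set of positive integers coprime to $m$. $R_m(\Delta)$ is the set of $n\in\mathbb N_m$ represented by some class $F\in\mathfrak F_\Delta$, and $R_m^\circ(\Delta)$ the set of $n\in R_m(\Delta)$ represented by $O$. $R_m(\Delta)$ is the free abelian monoid with basis $\{p^{f_p}:p\in\mathbb P_m\}$, where $f_p$ is the inertia degree of $p$ in $K$, and $R_m^\circ(\Delta)$ is a submonoid. $\mathsf v_p$ is the $p$-adic exponent. **Ideal classes.** $\mathcal O_\Delta=\mathbb Z[\frac{s+\sqrt\Delta}{2}]$ is the order of discriminant $\Delta$ (with conductor $m\mathcal O_K$). $\mathcal C^+(\mathcal O_\Delta)$ is the narrow class group: invertible fractional ideals modulo principal fractional ideals $a\mathcal O_\Delta$ with $a\in K^\times$ totally positive (positive under all real embeddings); it is written additively and $[\mathfrak a]^+$ is the class of $\mathfrak a$. There is an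 isomorphism $\Phi_\Delta\colon\mathfrak F_\Delta\to\mathcal C^+(\mathcal O_\Delta)$ with $\Phi_\Delta([\![a,b,c]\!])=\bigl[\bigl(a,\tfrac{b+\sqrt\Delta}{2}\bigr)\bigr]^+$ for $a>0$. For every $p\in\mathbb P_m$ fix a prime ideal $\mathfrak p_p$ of $\mathcal O_\Delta$ lying above $p$ such that $\mathcal C^+(\mathcal O_\Delta)=\{[\mathfrak p_p]^+:p\in\mathbb P_m,\ f_p=1\}$ (possible, since each class contains infinitely many prime ideals of degree 1), and set $F_p=\Phi_\Delta^{-1}([\mathfrak p_p]^+)$. **Plus-minus weighted zero-sum sequences.** $\mathcal F(G)$ is the (multiplicative) free abelian monoid with basis $G$. For a finite abelian group $G$, $\mathcal B_\pm(G)=\{g_1\cdot\ldots\cdot g_\ell\in\mathcal F(G):\ \ell\ge0,\ \varepsilon_1g_1+\dots+\varepsilon_\ell g_\ell=0\text{ for some }\varepsilon_i\in\{1,-1\}\}$. **Transfer homomorphisms.** A monoid is a commutative cancellative semigroup with identity; $H^\times$ is its group of units, $H_{\rm red}=\{aH^\times:a\in H\}$, and $\mathcal A(H)$ its set of atoms. A monoid homomorphism $\theta\colon H\to B$ is a transfer homomorphism if (T1) $B=\theta(H)B^\times$ and $\theta^{-1}(B^\times)=H^\times$; (T2) if $u\in H$, $b,c\in B$ and $\theta(u)=bc$, then there are $v,w\in H$ with $u=vw$, $\theta(v)\in bB^\times$, $\theta(w)\in cB^\times$. **Catenary degree in the fibres.** $\mathsf Z(H)=\mathcal F(\mathcal A(H_{\rm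 red}))$, with the canonical homomorphism $\pi\colon\mathsf Z(H)\to H_{\rm red}$, and $\mathsf Z(a)=\pi^{-1}(aH^\times)$. The distance $\mathsf d(z,z')$ of $z,z'\in\mathsf Z(H)$ is $\max\{|z\gcd(z,z')^{-1}|,|z'\gcd(z,z')^{-1}|\}$, where $|\cdot|$ is length. For a transfer homomorphism $\theta\colon H\to B$ of atomic monoids, $\overline\theta\colon\mathsf Z(H)\to\mathsf Z(B)$ is the homomorphism with $\overline\theta(uH^\times)=\theta(u)B^\times$ for all $u\in\mathcal A(H)$. $\mathsf c(a,\theta)$ is the smallest $N\in\mathbb N_0\cup\{\infty\}$ such that whenever $z,z'\in\mathsf Z(a)$ with $\overline\theta(z)=\overline\theta(z')$, there are $z=z_0,\dots,z_k=z'$ in $\mathsf Z(a)$ with $\overline\theta(z_i)=\overline\theta(z)$ and $\mathsf d(z_{i-1},z_i)\le N$ for all $i\in[1,k]$. $\mathsf c(H,\theta)=\sup\{\mathsf c(a,\theta):a\in H\}$. *)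

theory Defs
  imports
    "HOL-Library.Extended_Nat"
    "HOL-Library.Multiset"
    "HOL-Computational_Algebra.Polynomial"
    "HOL-Computational_Algebra.Primes"
    "HOL-Algebra.Algebra"
begin

section \<open>Binary quadratic forms and Gauss composition\<close>

text \<open>The triple \<open>(a, b, c)\<close> stands for the form \<open>a X\<^sup>2 + b X Y + c Y\<^sup>2\<close>.\<close>

type_synonym bqf = "int \<times> int \<times> int"

fun bqf_eval :: "bqf \<Rightarrow> int \<Rightarrow> int \<Rightarrow> int" where
  "bqf_eval (a, b, c) x y = a * x^2 + b * x * y + c * y^2"

fun bqf_disc :: "bqf \<Rightarrow> int" where
  "bqf_disc (a, b, c) = b^2 - 4 * a * c"

fun bqf_primitive :: "bqf \<Rightarrow> bool" where
  "bqf_primitive (a, b, c) \<longleftrightarrow> gcd a (gcd b c) = 1"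

definition bqf_neg_def :: "bqf \<Rightarrow> bool" where
  "bqf_neg_def f \<longleftrightarrow> (\<forall>x y. (x, y) \<noteq> (0, 0) \<longrightarrow> bqf_eval f x y < 0)"

definition bqf_forms :: "int \<Rightarrow> bqf set" where
  "bqf_forms \<Delta> = {f. bqf_disc f = \<Delta> \<and> bqf_primitive f \<and> \<not> bqf_neg_def f}"

definition properly_equiv :: "bqf \<Rightarrow> bqf \<Rightarrow> bool" where
  "properly_equiv f g \<longleftrightarrow>
     (\<exists>\<alpha> \<beta> \<gamma> \<delta>. \<alpha> * \<delta> - \<beta> * \<gamma> = 1 \<and>
        (\<forall>x y. bqf_eval g x y = bqf_eval f (\<alpha> * x + \<beta> * y) (\<gamma> * x + \<delta> * y)))"

definition bqf_class :: "bqf \<Rightarrow> bqf set" where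
  "bqf_class f = {g. properly_equiv f g}"

text \<open>\<open>h\<close> is a direct composite of \<open>f\<close> and \<open>g\<close> in the sense of Gauss:
  \<open>f(x,y) g(z,w) = h(X,Y)\<close> for integral bilinear forms \<open>X\<close>, \<open>Y\<close>. The two determinant conditions
  fix the orientation with respect to \<open>f\<close> and \<open>g\<close>; without them, the composite would be determined
  only up to replacing the class of \<open>f\<close> or \<open>g\<close> by its inverse.\<close>

definition direct_composite :: "bqf \<Rightarrow> bqf \<Rightarrow> bqf \<Rightarrow> bool" where
  "direct_composite f g h \<longleftrightarrow>
     (\<exists>p1 p2 p3 p4 q1 q2 q3 q4.
        (\<forall>x y z w. bqf_eval f x y * bqf_eval g z w =
           bqf_eval h (p1 * x * z + p2 * x * w + p3 * y * z + p4 * y * w)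
                      (q1 * x * z + q2 * x * w + q3 * y * z + q4 * y * w)) \<and>
        p1 * q2 - p2 * q1 = bqf_eval f 1 0 \<and>
        p1 * q3 - p3 * q1 = bqf_eval g 1 0)"

text \<open>If \<open>\<Delta> = 4D + s\<close> with \<open>s \<in> {0, 1}\<close>, then \<open>s = \<Delta> mod 4\<close> and \<open>D = \<Delta> div 4\<close>.
  The group is written multiplicatively, as usual in HOL-Algebra.\<close>

definition form_class_group :: "int \<Rightarrow> bqf set monoid" where
  "form_class_group \<Delta> =
     \<lparr> carrier = bqf_class ` bqf_forms \<Delta>,
       mult = (\<lambda>A B. {h \<in> bqf_forms \<Delta>. \<exists>f\<in>A. \<exists>g\<in>B. direct_composite f g h}),
       one = bqf_class (1, \<Delta> mod 4, - (\<Delta> div 4)) \<rparr>"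

definition represents :: "bqf set \<Rightarrow> int \<Rightarrow> bool" where
  "represents F n \<longleftrightarrow> (\<exists>f\<in>F. \<exists>x y. n = bqf_eval f x y)"


section \<open>The quadratic field and its orders\<close>

definition ring_on :: "'a::comm_ring_1 set \<Rightarrow> 'a ring" where
  "ring_on S = \<lparr> carrier = S, mult = (*), one = 1, ring.zero = 0, add = (+) \<rparr>"

definition sqrtD :: "int \<Rightarrow> complex" where
  "sqrtD \<Delta> = csqrt (of_int \<Delta>)"

definition quad_field :: "int \<Rightarrow> complex set" where
  "quad_field \<Delta> = {of_rat x + of_rat y * sqrtD \<Delta> | x y. True}"

definition quad_conj :: "int \<Rightarrow> complex \<Rightarrow> complex" where
  "quad_conj \<Delta> u =
     (THE v. \<exists>x y. u = of_rat x + of_rat y * sqrtD \<Delta> \<and> v = of_rat x - of_rat y * sqrtD \<Delta>)"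

definition max_order :: "int \<Rightarrow> complex set" where
  "max_order \<Delta> = {x \<in> quad_field \<Delta>. algebraic_int x}"

definition is_integral_basis :: "int \<Rightarrow> complex \<Rightarrow> complex \<Rightarrow> bool" where
  "is_integral_basis \<Delta> w1 w2 \<longleftrightarrow>
     bij_betw (\<lambda>(u::int, v::int). of_int u * w1 + of_int v * w2) UNIV (max_order \<Delta>)"

text \<open>The discriminant of the field \<open>\<rat>(\<surd>\<Delta>)\<close>: the squared determinant of the matrix of the conjugates
  of an integral basis.\<close>

definition field_disc :: "int \<Rightarrow> int" where
  "field_disc \<Delta> =
     (THE d. \<exists>w1 w2. is_integral_basis \<Delta> w1 w2 \<and>
        of_int d = (w1 * quad_conj \<Delta> w2 - w2 * quad_conj \<Delta> w1)^2)"

definition quad_order :: "int \<Rightarrow> complex set" where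
  "quad_order \<Delta> =
     range (\<lambda>p :: int poly. poly (map_poly of_int p) ((of_int (\<Delta> mod 4) + sqrtD \<Delta>) / 2))"

definition lies_above :: "complex set \<Rightarrow> nat \<Rightarrow> bool" where
  "lies_above P p \<longleftrightarrow> P \<inter> \<int> = range (\<lambda>k::int. of_nat p * of_int k)"

text \<open>The inertia degree of \<open>p\<close>: the dimension of the residue field \<open>\<O>\<^sub>K/P\<close> over its prime field, for
  any prime ideal \<open>P\<close> above \<open>p\<close> (as \<open>K\<close> is Galois over \<open>\<rat>\<close>, all of them give the same value).\<close>

definition inertia_degree :: "int \<Rightarrow> nat \<Rightarrow> nat" where
  "inertia_degree \<Delta> p =
     (THE f. \<exists>P. let R = ring_on (max_order \<Delta>); k = R Quot P in
        primeideal P R \<and> lies_above P p \<and>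
        ring.dimension k f (range (\<lambda>n::int. P +>\<^bsub>R\<^esub> of_int n)) (carrier k))"


section \<open>The narrow class group of the order\<close>

definition totally_positive :: "int \<Rightarrow> complex \<Rightarrow> bool" where
  "totally_positive \<Delta> a \<longleftrightarrow>
     (\<forall>\<sigma> \<in> ring_hom (ring_on (quad_field \<Delta>)) (ring_on (UNIV :: real set)). \<sigma> a > 0)"

definition fractional_ideal :: "int \<Rightarrow> complex set \<Rightarrow> bool" where
  "fractional_ideal \<Delta> I \<longleftrightarrow>
     I \<subseteq> quad_field \<Delta> \<and> I \<noteq> {0} \<and> 0 \<in> I \<and>
     (\<forall>x\<in>I. \<forall>y\<in>I. x + y \<in> I) \<and> (\<forall>r\<in>quad_order \<Delta>. \<forall>x\<in>I. r * x \<in> I) \<and>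
     (\<exists>c\<in>quad_order \<Delta>. c \<noteq> 0 \<and> (\<forall>x\<in>I. c * x \<in> quad_order \<Delta>))"

definition invertible_ideals :: "int \<Rightarrow> complex set set" where
  "invertible_ideals \<Delta> =
     {I. fractional_ideal \<Delta> I \<and>
         (\<exists>J. fractional_ideal \<Delta> J \<and> ideal_prod (ring_on (quad_field \<Delta>)) I J = quad_order \<Delta>)}"

definition ideal_group :: "int \<Rightarrow> complex set monoid" where
  "ideal_group \<Delta> =
     \<lparr> carrier = invertible_ideals \<Delta>,
       mult = ideal_prod (ring_on (quad_field \<Delta>)),
       one = quad_order \<Delta> \<rparr>"

definition pos_principal_ideals :: "int \<Rightarrow> complex set set" where
  "pos_principal_ideals \<Delta> =
     {(*) a ` quad_order \<Delta> | a. a \<in> quad_field \<Delta> \<and> a \<noteq> 0 \<and> totally_positive \<Delta> a}"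

definition narrow_class_group :: "int \<Rightarrow> complex set set monoid" where
  "narrow_class_group \<Delta> = ideal_group \<Delta> Mod pos_principal_ideals \<Delta>"

definition narrow_class :: "int \<Rightarrow> complex set \<Rightarrow> complex set set" where
  "narrow_class \<Delta> I = pos_principal_ideals \<Delta> #>\<^bsub>ideal_group \<Delta>\<^esub> I"

text \<open>Every class of \<open>form_class_group \<Delta>\<close> contains forms \<open>(a, b, c)\<close> with \<open>a > 0\<close>; the narrow class
  below does not depend on the choice of such a form.\<close>

definition \<Phi> :: "int \<Rightarrow> bqf set \<Rightarrow> complex set set" where
  "\<Phi> \<Delta> F =
     (THE C. \<exists>a b c. (a, b, c) \<in> F \<and> a > 0 \<and>
        C = narrow_class \<Delta>
              (Idl\<^bsub>ring_on (quad_order \<Delta>)\<^esub> {of_int a, (of_int b + sqrtD \<Delta>) / 2}))"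


section \<open>The monoids of represented numbers\<close>

definition primes_not_dvd :: "nat \<Rightarrow> nat set" where
  "primes_not_dvd m = {p. Factorial_Ring.prime p \<and> \<not> p dvd m}"

definition nat_mult_monoid :: "nat set \<Rightarrow> nat monoid" where
  "nat_mult_monoid S = \<lparr> carrier = S, mult = (*), one = 1 \<rparr>"

definition R_set :: "nat \<Rightarrow> int \<Rightarrow> nat set" where
  "R_set m \<Delta> =
     {n. n > 0 \<and> coprime n m \<and> (\<exists>F \<in> carrier (form_class_group \<Delta>). represents F (int n))}"

definition R0_set :: "nat \<Rightarrow> int \<Rightarrow> nat set" where
  "R0_set m \<Delta> = {n \<in> R_set m \<Delta>. represents \<one>\<^bsub>form_class_group \<Delta>\<^esub> (int n)}"

definition R0_monoid :: "nat \<Rightarrow> int \<Rightarrow> nat monoid" where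
  "R0_monoid m \<Delta> = nat_mult_monoid (R0_set m \<Delta>)"

text \<open>\<open>\<pp> p\<close> is a prime ideal of the order above \<open>p\<close>, and these ideals are chosen such that those of
  degree one represent all narrow ideal classes.\<close>

definition prime_ideal_choice :: "nat \<Rightarrow> int \<Rightarrow> (nat \<Rightarrow> complex set) \<Rightarrow> bool" where
  "prime_ideal_choice m \<Delta> \<pp> \<longleftrightarrow>
     (\<forall>p \<in> primes_not_dvd m.
        primeideal (\<pp> p) (ring_on (quad_order \<Delta>)) \<and> lies_above (\<pp> p) p) \<and>
     carrier (narrow_class_group \<Delta>) =
       {narrow_class \<Delta> (\<pp> p) | p. p \<in> primes_not_dvd m \<and> inertia_degree \<Delta> p = 1}"

definition prime_form_class :: "int \<Rightarrow> (nat \<Rightarrow> complex set) \<Rightarrow> nat \<Rightarrow> bqf set" where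
  "prime_form_class \<Delta> \<pp> p =
     inv_into (carrier (form_class_group \<Delta>)) (\<Phi> \<Delta>) (narrow_class \<Delta> (\<pp> p))"

text \<open>Elements of the free abelian monoid with basis \<open>G\<close> are multisets over \<open>G\<close>. For \<open>n\<close> in
  \<open>R_set m \<Delta>\<close> the division by the inertia degree is exact; primes not dividing \<open>n\<close> contribute
  nothing, so they are left out to keep the index set finite.\<close>

definition vartheta :: "nat \<Rightarrow> int \<Rightarrow> (nat \<Rightarrow> complex set) \<Rightarrow> nat \<Rightarrow> bqf set multiset" where
  "vartheta m \<Delta> \<pp> n =
     (\<Sum>p \<in> {p \<in> primes_not_dvd m. p dvd n}.
        replicate_mset (multiplicity p n div inertia_degree \<Delta> p) (prime_form_class \<Delta> \<pp> p))"


section \<open>Plus-minus weighted zero-sum sequences\<close>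

definition pm_zero_sum_monoid :: "('a, 'b) monoid_scheme \<Rightarrow> 'a multiset monoid" where
  "pm_zero_sum_monoid G =
     \<lparr> carrier = {mset gs | gs. set gs \<subseteq> carrier G \<and>
         (\<exists>\<epsilon> :: nat \<Rightarrow> int. (\<forall>i < length gs. \<epsilon> i \<in> {1, -1}) \<and>
            (\<Otimes>\<^bsub>G\<^esub>i\<in>{..<length gs}. (gs ! i) [^]\<^bsub>G\<^esub> \<epsilon> i) = \<one>\<^bsub>G\<^esub>)},
       mult = (+),
       one = {#} \<rparr>"


section \<open>Transfer homomorphisms and the catenary degree in the fibres\<close>

text \<open>Monoids in the sense of factorization theory are those of the locale
  \<^locale>\<open>comm_monoid_cancel\<close>.\<close>

definition transfer_hom ::
  "('a, 'c) monoid_scheme \<Rightarrow> ('b, 'd) monoid_scheme \<Rightarrow> ('a \<Rightarrow> 'b) \<Rightarrow> bool" where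
  "transfer_hom H B \<theta> \<longleftrightarrow>
     comm_monoid_cancel H \<and> comm_monoid_cancel B \<and> \<theta> \<in> hom H B \<and> \<theta> \<one>\<^bsub>H\<^esub> = \<one>\<^bsub>B\<^esub> \<and>
     carrier B = (\<theta> ` carrier H) <#>\<^bsub>B\<^esub> Units B \<and>
     {u \<in> carrier H. \<theta> u \<in> Units B} = Units H \<and>
     (\<forall>u \<in> carrier H. \<forall>b \<in> carrier B. \<forall>c \<in> carrier B. \<theta> u = b \<otimes>\<^bsub>B\<^esub> c \<longrightarrow>
        (\<exists>v \<in> carrier H. \<exists>w \<in> carrier H. u = v \<otimes>\<^bsub>H\<^esub> w \<and>
           \<theta> v \<in> b <#\<^bsub>B\<^esub> Units B \<and> \<theta> w \<in> c <#\<^bsub>B\<^esub> Units B))"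

definition reduced_monoid :: "('a, 'c) monoid_scheme \<Rightarrow> 'a set monoid" where
  "reduced_monoid H =
     \<lparr> carrier = {a <#\<^bsub>H\<^esub> Units H | a. a \<in> carrier H}, mult = set_mult H, one = Units H \<rparr>"

definition atoms :: "('a, 'c) monoid_scheme \<Rightarrow> 'a set" where
  "atoms H = {u \<in> carrier H. Divisibility.irreducible H u}"

definition factorization_monoid :: "('a, 'c) monoid_scheme \<Rightarrow> 'a set multiset set" where
  "factorization_monoid H = {z. set_mset z \<subseteq> atoms (reduced_monoid H)}"

definition factorization_prod :: "('a, 'c) monoid_scheme \<Rightarrow> 'a set multiset \<Rightarrow> 'a set" where
  "factorization_prod H z =
     (\<Otimes>\<^bsub>reduced_monoid H\<^esub>U\<in>set_mset z. U [^]\<^bsub>reduced_monoid H\<^esub> count z U)"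

definition factorizations :: "('a, 'c) monoid_scheme \<Rightarrow> 'a \<Rightarrow> 'a set multiset set" where
  "factorizations H a =
     {z \<in> factorization_monoid H. factorization_prod H z = a <#\<^bsub>H\<^esub> Units H}"

definition fact_dist :: "'a multiset \<Rightarrow> 'a multiset \<Rightarrow> nat" where
  "fact_dist z z' = max (size (z - z \<inter># z')) (size (z' - z \<inter># z'))"

text \<open>For a homomorphism \<open>\<theta>\<close> the set \<open>\<theta>(u H\<^sup>\<times>) B\<^sup>\<times>\<close> is the coset \<open>\<theta>(u) B\<^sup>\<times>\<close>.\<close>

definition theta_bar ::
  "('b, 'd) monoid_scheme \<Rightarrow> ('a \<Rightarrow> 'b) \<Rightarrow> 'a set multiset \<Rightarrow> 'b set multiset" where
  "theta_bar B \<theta> z = image_mset (\<lambda>U. (\<theta> ` U) <#>\<^bsub>B\<^esub> Units B) z"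

definition cat_fibre_elem ::
  "('a, 'c) monoid_scheme \<Rightarrow> ('b, 'd) monoid_scheme \<Rightarrow> ('a \<Rightarrow> 'b) \<Rightarrow> 'a \<Rightarrow> enat" where
  "cat_fibre_elem H B \<theta> a =
     (LEAST N. \<forall>z \<in> factorizations H a. \<forall>z' \<in> factorizations H a.
        theta_bar B \<theta> z = theta_bar B \<theta> z' \<longrightarrow>
        (\<exists>k. \<exists>y :: nat \<Rightarrow> 'a set multiset. y 0 = z \<and> y k = z' \<and>
           (\<forall>i\<le>k. y i \<in> factorizations H a \<and> theta_bar B \<theta> (y i) = theta_bar B \<theta> z) \<and>
           (\<forall>i\<in>{1..k}. enat (fact_dist (y (i - 1)) (y i)) \<le> N)))"

definition cat_fibre ::
  "('a, 'c) monoid_scheme \<Rightarrow> ('b, 'd) monoid_scheme \<Rightarrow> ('a \<Rightarrow> 'b) \<Rightarrow> enat" where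
  "cat_fibre H B \<theta> = (SUP a\<in>carrier H. cat_fibre_elem H B \<theta> a)"

end

theory Submission
  imports Defs
begin

text \<open>
  Which classes represent a number is decided by two properties of composition. If \<open>F\<close> represents
  \<open>n\<close> and \<open>E\<close> represents \<open>k\<close>, the bilinear identity behind the product class \<open>F E\<close> shows that
  \<open>F E\<close> represents \<open>n k\<close>. Conversely, let \<open>p\<close> be a prime that does not divide \<open>m\<close> and let \<open>F\<close>
  represent \<open>p n\<close>. If \<open>p\<close> is not inert, there are two cases. Either \<open>F\<close> contains a form
  \<open>(p n\<^sub>1, b, c)\<close> with \<open>n = e\<^sup>2 n\<^sub>1\<close>, and this form is composed of \<open>(p, b, n\<^sub>1 c)\<close> and
  \<open>(n\<^sub>1, b, p c)\<close>; or \<open>p\<close> divides both arguments of the representation, and \<open>n\<close> is \<open>p\<close> times a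
  number represented by \<open>F\<close>. Forms with leading coefficient \<open>p\<close> lie in \<open>F\<^sub>p\<close> or its inverse, so
  \<open>n\<close> is represented by the product of \<open>F\<close> with one of these two classes. If \<open>p\<close> is inert, the arguments are always
  divisible by \<open>p\<close>, and \<open>p\<^sup>2\<close> splits off without changing the class. By induction, a product of
  basis elements \<open>p\<^bsup>f\<^esup>\<close> is represented exactly by the products of the \<open>F\<^sub>p\<^bsup>\<plusminus>1\<^esup>\<close>
  (\<open>represents_prime_product_iff\<close>). For the principal class this is the first claim.

  Unique factorization then turns \<open>R\<^sup>\<circ>\<close> into the monoid of those multisets of primes whose image
  under \<open>p \<mapsto> F\<^sub>p\<close> is a plus-minus weighted zero-sum sequence, and every class is some \<open>F\<^sub>p\<close>. For
  such a relabelling of letters the second claim is combinatorial: a decomposition of the image lifts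
  by splitting the multiset, and two factorizations with the same image are joined by exchanging two
  letters with the same label between two blocks (\<open>swap_connected\<close>). One exchange alters only two
  atoms, whence the bound 2.

  It remains to understand the group, the classes \<open>F\<^sub>p\<close> and the inertia degrees. The six minors of
  the bilinear substitution of a direct composite of \<open>f\<close> and \<open>g\<close> are functions of \<open>f\<close> and \<open>g\<close>
  (\<open>composition_minors\<close>); therefore the composite is unique up to proper equivalence. Forms with
  coprime leading coefficients can be given the same middle coefficient, and then the composite is
  explicit, which yields the group axioms. A form with \<open>a > 0\<close> corresponds to the lattice spanned by
  \<open>a\<close> and \<open>(b + \<surd>\<Delta>) / 2\<close>; two such lattices have the same narrow class if and only if the forms
  are properly equivalent. Hence \<open>\<Phi>\<close> is injective, and because a prime ideal above \<open>p\<close> is either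
  such a lattice with \<open>a = p\<close> or generated by \<open>p\<close>, the class \<open>F\<^sub>p\<close> contains a form with leading
  coefficient \<open>p\<close> or is principal. Finally, writing \<open>\<Delta> = n\<^sup>2 e\<close> with \<open>n\<close> maximal determines the
  maximal order, so that \<open>e\<close> is the discriminant of the field and \<open>n = m\<close>; thus \<open>\<Delta>\<close> is
  fundamental at the primes not dividing \<open>m\<close>, and such a prime has degree one if and only if \<open>\<Delta>\<close>
  is a square modulo \<open>4 p\<close>.
\<close>

section \<open>Forms and proper equivalence\<close>

fun bqf_subst :: "bqf \<Rightarrow> int \<Rightarrow> int \<Rightarrow> int \<Rightarrow> int \<Rightarrow> bqf" where
  "bqf_subst (a, b, c) \<alpha> \<beta> \<gamma> \<delta> =
     (a * \<alpha>^2 + b * \<alpha> * \<gamma> + c * \<gamma>^2,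
      2 * a * \<alpha> * \<beta> + b * (\<alpha> * \<delta> + \<beta> * \<gamma>) + 2 * c * \<gamma> * \<delta>,
      a * \<beta>^2 + b * \<beta> * \<delta> + c * \<delta>^2)"

lemma bqf_eval_subst:
  "bqf_eval (bqf_subst f \<alpha> \<beta> \<gamma> \<delta>) x y = bqf_eval f (\<alpha> * x + \<beta> * y) (\<gamma> * x + \<delta> * y)"
  by (cases f) (simp add: algebra_simps power2_eq_square)

lemma bqf_eqI:
  assumes "\<And>x y. bqf_eval f x y = bqf_eval g x y"
  shows "f = g"
proof -
  obtain a b c where f: "f = (a, b, c)" by (cases f)
  obtain a' b' c' where g: "g = (a', b', c')" by (cases g)
  show ?thesis
    using assms[of 1 0] assms[of 0 1] assms[of 1 1] by (simp add: f g)
qed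

lemma properly_equiv_iff_subst:
  "properly_equiv f g \<longleftrightarrow> (\<exists>\<alpha> \<beta> \<gamma> \<delta>. \<alpha> * \<delta> - \<beta> * \<gamma> = 1 \<and> g = bqf_subst f \<alpha> \<beta> \<gamma> \<delta>)"
  unfolding properly_equiv_def by (metis bqf_eval_subst bqf_eqI)

lemma bqf_subst_subst:
  "bqf_subst (bqf_subst f \<alpha> \<beta> \<gamma> \<delta>) \<alpha>' \<beta>' \<gamma>' \<delta>' =
   bqf_subst f (\<alpha> * \<alpha>' + \<beta> * \<gamma>') (\<alpha> * \<beta>' + \<beta> * \<delta>') (\<gamma> * \<alpha>' + \<delta> * \<gamma>') (\<gamma> * \<beta>' + \<delta> * \<delta>')"
  by (rule bqf_eqI) (simp add: bqf_eval_subst algebra_simps)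

lemma bqf_subst_id: "bqf_subst f 1 0 0 1 = f"
  by (rule bqf_eqI) (simp add: bqf_eval_subst)

lemma bqf_subst_inverse:
  assumes "\<alpha> * \<delta> - \<beta> * \<gamma> = 1"
  shows "bqf_subst (bqf_subst f \<alpha> \<beta> \<gamma> \<delta>) \<delta> (- \<beta>) (- \<gamma>) \<alpha> = f"
proof -
  have "\<alpha> * \<delta> + \<beta> * - \<gamma> = 1" "\<alpha> * - \<beta> + \<beta> * \<alpha> = 0" "\<gamma> * \<delta> + \<delta> * - \<gamma> = 0" "\<gamma> * - \<beta> + \<delta> * \<alpha> = 1"
    using assms by (simp_all add: algebra_simps)
  then show ?thesis by (simp only: bqf_subst_subst bqf_subst_id)
qed

lemma properly_equiv_refl: "properly_equiv f f"
  unfolding properly_equiv_iff_subst by (rule exI[of _ 1], rule exI[of _ 0], rule exI[of _ 0], rule exI[of _ 1]) (simp add: bqf_subst_id)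

lemma properly_equiv_sym: "properly_equiv f g \<Longrightarrow> properly_equiv g f"
proof -
  assume "properly_equiv f g"
  then obtain \<alpha> \<beta> \<gamma> \<delta> where d: "\<alpha> * \<delta> - \<beta> * \<gamma> = 1" and g: "g = bqf_subst f \<alpha> \<beta> \<gamma> \<delta>"
    unfolding properly_equiv_iff_subst by blast
  have "f = bqf_subst g \<delta> (- \<beta>) (- \<gamma>) \<alpha>" using bqf_subst_inverse[OF d] g by simp
  moreover have "\<delta> * \<alpha> - (- \<beta>) * (- \<gamma>) = 1" using d by (simp add: algebra_simps)
  ultimately show ?thesis unfolding properly_equiv_iff_subst by blast
qed

lemma properly_equiv_trans:
  assumes "properly_equiv f g" "properly_equiv g h"
  shows "properly_equiv f h"
proof -
  obtain \<alpha> \<beta> \<gamma> \<delta> where d: "\<alpha> * \<delta> - \<beta> * \<gamma> = 1" and g: "g = bqf_subst f \<alpha> \<beta> \<gamma> \<delta>"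
    using assms(1) unfolding properly_equiv_iff_subst by blast
  obtain \<alpha>' \<beta>' \<gamma>' \<delta>' where d': "\<alpha>' * \<delta>' - \<beta>' * \<gamma>' = 1" and h: "h = bqf_subst g \<alpha>' \<beta>' \<gamma>' \<delta>'"
    using assms(2) unfolding properly_equiv_iff_subst by blast
  have "(\<alpha> * \<alpha>' + \<beta> * \<gamma>') * (\<gamma> * \<beta>' + \<delta> * \<delta>') - (\<alpha> * \<beta>' + \<beta> * \<delta>') * (\<gamma> * \<alpha>' + \<delta> * \<gamma>')
      = (\<alpha> * \<delta> - \<beta> * \<gamma>) * (\<alpha>' * \<delta>' - \<beta>' * \<gamma>')" by (simp add: algebra_simps)
  then show ?thesis unfolding properly_equiv_iff_subst h g bqf_subst_subst using d d' by (metis mult_1)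
qed

lemma bqf_class_eq_iff: "bqf_class f = bqf_class g \<longleftrightarrow> properly_equiv f g"
  unfolding bqf_class_def using properly_equiv_refl properly_equiv_sym properly_equiv_trans by blast

lemma bqf_class_eqI: "g \<in> bqf_class f \<Longrightarrow> bqf_class g = bqf_class f"
  using bqf_class_eq_iff by (simp add: bqf_class_def) (blast intro: properly_equiv_sym)

lemma in_bqf_class_self: "f \<in> bqf_class f"
  by (simp add: bqf_class_def properly_equiv_refl)

lemma bqf_disc_subst:
  "bqf_disc (bqf_subst f \<alpha> \<beta> \<gamma> \<delta>) = (\<alpha> * \<delta> - \<beta> * \<gamma>)^2 * bqf_disc f"
  by (cases f) (simp add: algebra_simps power2_eq_square)

lemma prime_divisor_of_nonunit_int:
  assumes "\<not> is_unit (n::int)"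
  shows "\<exists>p. Factorial_Ring.prime p \<and> p dvd n"
proof (cases "n = 0")
  case True
  have "Factorial_Ring.prime (2::int)" by simp
  then show ?thesis using True by (metis dvd_0_right)
next
  case False
  then show ?thesis using assms prime_divisor_exists by blast
qed

lemma bqf_primitive_iff:
  "bqf_primitive (a, b, c) \<longleftrightarrow> (\<forall>d. d dvd a \<and> d dvd b \<and> d dvd c \<longrightarrow> is_unit d)"
proof
  assume "bqf_primitive (a, b, c)"
  then show "\<forall>d. d dvd a \<and> d dvd b \<and> d dvd c \<longrightarrow> is_unit d"
    using gcd_greatest[of _ a "gcd b c"] gcd_greatest[of _ b c] by auto
next
  assume "\<forall>d. d dvd a \<and> d dvd b \<and> d dvd c \<longrightarrow> is_unit d"
  then have "is_unit (gcd a (gcd b c))" by (meson dvd_trans gcd_dvd1 gcd_dvd2)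
  then show "bqf_primitive (a, b, c)" by simp
qed

lemma bqf_primitive_iff_prime:
  "bqf_primitive (a, b, c) \<longleftrightarrow>
     (\<forall>p. Factorial_Ring.prime p \<longrightarrow> \<not> (p dvd a \<and> p dvd b \<and> p dvd c))" (is "_ \<longleftrightarrow> ?R")
proof
  assume "bqf_primitive (a, b, c)"
  then show ?R unfolding bqf_primitive_iff using not_prime_unit by blast
next
  assume r: ?R
  show "bqf_primitive (a, b, c)"
  proof (rule ccontr)
    assume "\<not> bqf_primitive (a, b, c)"
    then have "gcd a (gcd b c) \<noteq> 1" by simp
    then have "\<not> is_unit (gcd a (gcd b c))"
      by simp
    then obtain p where "Factorial_Ring.prime p" "p dvd gcd a (gcd b c)"
      using prime_divisor_of_nonunit_int by blast
    then show False using r by auto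
  qed
qed

lemma bqf_primitive_subst:
  assumes "\<alpha> * \<delta> - \<beta> * \<gamma> = 1" "bqf_primitive f"
  shows "bqf_primitive (bqf_subst f \<alpha> \<beta> \<gamma> \<delta>)"
proof -
  obtain a b c where g: "bqf_subst f \<alpha> \<beta> \<gamma> \<delta> = (a, b, c)" by (rule prod_cases3)
  have f: "f = bqf_subst (a, b, c) \<delta> (- \<beta>) (- \<gamma>) \<alpha>" using bqf_subst_inverse[OF assms(1), of f] unfolding g by (rule sym)
  show ?thesis unfolding g bqf_primitive_iff
  proof (intro allI impI)
    fix d assume "d dvd a \<and> d dvd b \<and> d dvd c"
    then obtain a' b' c' where abc: "a = d * a'" "b = d * b'" "c = d * c'" by (auto elim!: dvdE)
    have "d dvd a * \<delta>^2 + b * \<delta> * (- \<gamma>) + c * (- \<gamma>)^2"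
      unfolding abc by (rule dvdI[of _ _ "a' * \<delta>^2 + b' * \<delta> * (- \<gamma>) + c' * (- \<gamma>)^2"]) (simp add: algebra_simps power2_eq_square)
    moreover have "d dvd 2 * a * \<delta> * (- \<beta>) + b * (\<delta> * \<alpha> + (- \<beta>) * (- \<gamma>)) + 2 * c * (- \<gamma>) * \<alpha>"
      unfolding abc by (rule dvdI[of _ _ "2 * a' * \<delta> * (- \<beta>) + b' * (\<delta> * \<alpha> + (- \<beta>) * (- \<gamma>)) + 2 * c' * (- \<gamma>) * \<alpha>"]) (simp add: algebra_simps power2_eq_square)
    moreover have "d dvd a * (- \<beta>)^2 + b * (- \<beta>) * \<alpha> + c * \<alpha>^2"
      unfolding abc by (rule dvdI[of _ _ "a' * (- \<beta>)^2 + b' * (- \<beta>) * \<alpha> + c' * \<alpha>^2"]) (simp add: algebra_simps power2_eq_square)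
    ultimately show "is_unit d" using assms(2) unfolding f bqf_subst.simps bqf_primitive_iff by blast
  qed
qed

lemma bqf_neg_def_subst:
  assumes "\<alpha> * \<delta> - \<beta> * \<gamma> = 1" "bqf_neg_def f"
  shows "bqf_neg_def (bqf_subst f \<alpha> \<beta> \<gamma> \<delta>)"
  unfolding bqf_neg_def_def bqf_eval_subst
proof (intro allI impI)
  fix x y :: int assume ne: "(x, y) \<noteq> (0, 0)"
  have "(\<alpha> * x + \<beta> * y, \<gamma> * x + \<delta> * y) \<noteq> (0, 0)"
  proof
    assume "(\<alpha> * x + \<beta> * y, \<gamma> * x + \<delta> * y) = (0, 0)"
    then have z: "\<alpha> * x + \<beta> * y = 0" "\<gamma> * x + \<delta> * y = 0" by (simp_all only: prod.inject)
    have "(\<alpha> * \<delta> - \<beta> * \<gamma>) * x = \<delta> * (\<alpha> * x + \<beta> * y) - \<beta> * (\<gamma> * x + \<delta> * y)"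
      "(\<alpha> * \<delta> - \<beta> * \<gamma>) * y = \<alpha> * (\<gamma> * x + \<delta> * y) - \<gamma> * (\<alpha> * x + \<beta> * y)"
      by (simp_all add: algebra_simps)
    then show False using ne z assms(1) by simp
  qed
  then show "bqf_eval f (\<alpha> * x + \<beta> * y) (\<gamma> * x + \<delta> * y) < 0"
    using assms(2) unfolding bqf_neg_def_def by blast
qed

lemma bqf_forms_equiv:
  assumes "properly_equiv f g" "f \<in> bqf_forms \<Delta>"
  shows "g \<in> bqf_forms \<Delta>"
proof -
  obtain \<alpha> \<beta> \<gamma> \<delta> where d: "\<alpha> * \<delta> - \<beta> * \<gamma> = 1" and g: "g = bqf_subst f \<alpha> \<beta> \<gamma> \<delta>"
    using assms(1) by (auto simp: properly_equiv_iff_subst)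
  have d': "\<delta> * \<alpha> - (- \<beta>) * (- \<gamma>) = 1" using d by (simp add: algebra_simps)
  have "\<not> bqf_neg_def g"
    using bqf_neg_def_subst[OF d', of g] bqf_subst_inverse[OF d, of f] assms(2) g
    by (auto simp: bqf_forms_def)
  then show ?thesis using assms(2) d bqf_primitive_subst[OF d] unfolding bqf_forms_def g
    by (simp add: bqf_disc_subst)
qed

lemma bqf_class_subset_forms: "f \<in> bqf_forms \<Delta> \<Longrightarrow> bqf_class f \<subseteq> bqf_forms \<Delta>"
  by (auto simp: bqf_class_def intro: bqf_forms_equiv)

lemma square_mod_4: "(x::int)^2 mod 4 = (if even x then 0 else 1)"
proof (cases "even x")
  case True then show ?thesis by (auto elim!: evenE simp: power2_eq_square)
next
  case False
  then obtain t where "x = 2 * t + 1" by (auto elim!: oddE)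
  then have "x^2 = 1 + 4 * (t^2 + t)" by (simp add: algebra_simps power2_eq_square)
  then show ?thesis using False by (simp only: mod_mult_self2) simp
qed

locale discriminant =
  fixes \<Delta> :: int
  assumes nonsquare: "\<nexists>k :: int. \<Delta> = k^2"
begin

abbreviation forms where "forms \<equiv> bqf_forms \<Delta>"
abbreviation G where "G \<equiv> form_class_group \<Delta>"

lemma disc_nonzero: "\<Delta> \<noteq> 0"
  using nonsquare by (metis power_zero_numeral)

lemma lead_nonzero: "bqf_disc (a, b, c) = \<Delta> \<Longrightarrow> a \<noteq> 0"
  using nonsquare by auto

text \<open>The sign of a form is read off from the two values \<open>f(1, 0) = a\<close> and \<open>f(-b, 2 a) = - a \<Delta>\<close>, and for
  \<open>\<Delta> < 0\<close> from completing the square in \<open>4 a f\<close>.\<close>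

lemma bqf_neg_def_iff:
  assumes disc: "bqf_disc (a, b, c) = \<Delta>"
  shows "bqf_neg_def (a, b, c) \<longleftrightarrow> \<Delta> < 0 \<and> a < 0"
proof
  assume n: "bqf_neg_def (a, b, c)"
  have "a \<noteq> 0" using lead_nonzero[OF disc] .
  have a: "a < 0" using n[unfolded bqf_neg_def_def, rule_format, of 1 0] by simp
  have "bqf_eval (a, b, c) (- b) (2 * a) < 0"
    using n[unfolded bqf_neg_def_def, rule_format, of "- b" "2 * a"] \<open>a \<noteq> 0\<close> by simp
  moreover have "bqf_eval (a, b, c) (- b) (2 * a) = - a * \<Delta>"
    unfolding disc[symmetric] by (simp add: algebra_simps power2_eq_square)
  ultimately show "\<Delta> < 0 \<and> a < 0" using a by (simp add: zero_less_mult_iff mult_less_0_iff)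
next
  assume h: "\<Delta> < 0 \<and> a < 0"
  show "bqf_neg_def (a, b, c)" unfolding bqf_neg_def_def
  proof (intro allI impI)
    fix x y :: int assume ne: "(x, y) \<noteq> (0, 0)"
    have e: "4 * a * bqf_eval (a, b, c) x y = (2 * a * x + b * y)^2 + (- \<Delta>) * y^2"
      unfolding disc[symmetric] by (simp add: algebra_simps power2_eq_square)
    have "(2 * a * x + b * y)^2 + (- \<Delta>) * y^2 > 0"
    proof (cases "y = 0")
      case True then show ?thesis using ne h by simp
    next
      case False then show ?thesis using h by (intro add_nonneg_pos mult_pos_pos) auto
    qed
    then have "4 * a * bqf_eval (a, b, c) x y > 0" using e by simp
    then show "bqf_eval (a, b, c) x y < 0" using h by (simp add: zero_less_mult_iff del: bqf_eval.simps)
  qed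
qed

lemma bqf_forms_iff:
  "(a, b, c) \<in> forms \<longleftrightarrow>
     b^2 - 4 * a * c = \<Delta> \<and> gcd a (gcd b c) = 1 \<and> (\<Delta> > 0 \<or> a > 0)"
  using bqf_neg_def_iff[of a b c] lead_nonzero[of a b c] disc_nonzero unfolding bqf_forms_def by auto

end

lemma bqf_translate: "properly_equiv (a, b, c) (a, b + 2 * a * k, a * k^2 + b * k + c)"
  unfolding properly_equiv_iff_subst
  by (rule exI[of _ 1], rule exI[of _ k], rule exI[of _ 0], rule exI[of _ 1]) (simp add: algebra_simps)

lemma (in discriminant) bqf_translate_to:
  assumes "b^2 - 4 * a * c = \<Delta>" "b'^2 - 4 * a * c' = \<Delta>" "2 * a dvd b' - b"
  shows "properly_equiv (a, b, c) (a, b', c')"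
proof -
  obtain k where k: "b' = b + 2 * a * k" using assms(3) by (metis dvdE add_diff_cancel_left' diff_add_cancel add.commute)
  have "a \<noteq> 0" using lead_nonzero assms(1) by simp
  have "4 * a * c' = 4 * a * (a * k^2 + b * k + c)"
    using assms(1,2) unfolding k by (simp add: algebra_simps power2_eq_square)
  then have "c' = a * k^2 + b * k + c" using \<open>a \<noteq> 0\<close> by simp
  then show ?thesis using bqf_translate k by simp
qed

lemma bqf_swap: "properly_equiv (a, b, c) (c, - b, a)"
  unfolding properly_equiv_iff_subst
  by (rule exI[of _ 0], rule exI[of _ "-1"], rule exI[of _ 1], rule exI[of _ 0]) simp

text \<open>A coprime pair can be completed to a unimodular matrix, so a properly represented number is the
  leading coefficient of an equivalent form.\<close>

lemma properly_represented_is_leading: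
  assumes "coprime x y"
  shows "\<exists>b c. properly_equiv f (bqf_eval f x y, b, c)"
proof -
  obtain u v where "u * x + v * y = 1" using assms bezout_int[of x y] by (auto simp: coprime_iff_gcd_eq_1)
  then have "x * u - (- v) * y = 1" by (simp add: algebra_simps)
  moreover obtain a b c where f: "f = (a, b, c)" by (cases f)
  ultimately show ?thesis unfolding properly_equiv_iff_subst f bqf_subst.simps bqf_eval.simps by blast
qed

text \<open>It suffices to find coprime \<open>x\<close>, \<open>y\<close> for which \<open>f(x, y) = a x\<^sup>2 + b x y + c y\<^sup>2\<close> is coprime to
  \<open>N\<close>. This is arranged at each prime \<open>p\<close> dividing \<open>N\<close> separately, so that exactly one of the three
  terms is not divisible by \<open>p\<close>: the first if \<open>p\<close> does not divide \<open>a\<close> (let \<open>p\<close> divide \<open>y\<close>), the last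
  if \<open>p\<close> divides \<open>a\<close> but not \<open>c\<close> (let \<open>p\<close> divide \<open>x\<close>), and the middle one if \<open>p\<close> divides both.\<close>

lemma equiv_coprime_leading:
  assumes f: "bqf_primitive f" and "N \<noteq> 0"
  shows "\<exists>a b c. properly_equiv f (a, b, c) \<and> coprime a (N::int)"
proof -
  obtain a b c where fe: "f = (a, b, c)" by (cases f)
  define Q where "Q = {p \<in> prime_factors N. p dvd a \<and> \<not> p dvd c}"
  define R where "R = {p \<in> prime_factors N. \<not> p dvd a}"
  define x where "x = \<Prod>Q"
  define y where "y = \<Prod>R"
  have fin: "finite Q" "finite R" by (auto simp: Q_def R_def)
  have pr: "Factorial_Ring.prime p" if "p \<in> Q \<union> R" for p using that by (auto simp: Q_def R_def)
  have dx: "p dvd x \<longleftrightarrow> p \<in> Q" if "p \<in> prime_factors N" for p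
  proof -
    have p: "Factorial_Ring.prime p" using that by auto
    have "p dvd x \<longleftrightarrow> (\<exists>q\<in>Q. p dvd q)"
      unfolding x_def using fin p by (simp add: prime_dvd_prod_iff)
    then show ?thesis using primes_dvd_imp_eq[OF p] pr by (metis UnI1 dvd_refl)
  qed
  have dy: "p dvd y \<longleftrightarrow> p \<in> R" if "p \<in> prime_factors N" for p
  proof -
    have p: "Factorial_Ring.prime p" using that by auto
    have "p dvd y \<longleftrightarrow> (\<exists>q\<in>R. p dvd q)"
      unfolding y_def using fin p by (simp add: prime_dvd_prod_iff)
    then show ?thesis using primes_dvd_imp_eq[OF p] pr by (metis UnI2 dvd_refl)
  qed
  have "coprime x y" unfolding x_def y_def
    by (intro prod_coprime_left prod_coprime_right primes_coprime pr) (auto simp: Q_def R_def)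
  then obtain b' c' where e: "properly_equiv f (bqf_eval f x y, b', c')"
    using properly_represented_is_leading by blast
  have "coprime (bqf_eval f x y) N"
  proof (rule ccontr)
    assume "\<not> coprime (bqf_eval f x y) N"
    then obtain p where "Factorial_Ring.prime p" "p dvd gcd (bqf_eval f x y) N"
      using prime_divisor_of_nonunit_int by (metis is_unit_gcd)
    then have p: "Factorial_Ring.prime p" "p dvd bqf_eval f x y" "p dvd N" by auto
    then have pf: "p \<in> prime_factors N" using assms(2) by (simp add: in_prime_factors_iff)
    have v: "p dvd a * x^2 + b * x * y + c * y^2" using p fe by simp
    have pm: "p dvd u * w \<longleftrightarrow> p dvd u \<or> p dvd w" for u w by (rule prime_dvd_mult_iff[OF p(1)])
    have p2: "p dvd u^2 \<longleftrightarrow> p dvd u" for u by (simp add: power2_eq_square pm)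
    show False
    proof (cases "p dvd a")
      case False
      then have "p dvd y" "\<not> p dvd x" using dx[OF pf] dy[OF pf] pf by (auto simp: Q_def R_def)
      then have "p dvd b * x * y + c * y^2" "\<not> p dvd a * x^2" using False by (auto simp: pm p2 intro!: dvd_add)
      then show False using v by (metis add.assoc dvd_add_left_iff)
    next
      case a: True
      then have ny: "\<not> p dvd y" using dy[OF pf] by (auto simp: R_def)
      show False
      proof (cases "p dvd c")
        case True
        then have "\<not> p dvd b" using f a p(1) unfolding fe bqf_primitive_iff_prime by blast
        moreover have "\<not> p dvd x" using dx[OF pf] True by (auto simp: Q_def)
        ultimately have "\<not> p dvd b * x * y" using ny by (simp add: pm)
        moreover have "p dvd a * x^2" "p dvd c * y^2" using a True by auto
        ultimately show False using v by (metis dvd_add_left_iff dvd_add_right_iff)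
      next
        case False
        then have "p dvd x" using dx[OF pf] a pf by (auto simp: Q_def)
        then have "p dvd a * x^2 + b * x * y" by (auto simp: power2_eq_square)
        moreover have "\<not> p dvd c * y^2" using False ny by (simp add: pm p2)
        ultimately show False using v by (metis dvd_add_right_iff)
      qed
    qed
  qed
  then show ?thesis using e by blast
qed

section \<open>Uniqueness of the direct composite\<close>

fun bqf_polar :: "bqf \<Rightarrow> int \<Rightarrow> int \<Rightarrow> int \<Rightarrow> int \<Rightarrow> int" where
  "bqf_polar (a, b, c) x y z w = 2 * a * x * z + b * (x * w + y * z) + 2 * c * y * w"

lemma bqf_eval_combination:
  "bqf_eval f (s * x + t * z) (s * y + t * w) =
     s^2 * bqf_eval f x y + s * t * bqf_polar f x y z w + t^2 * bqf_eval f z w"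
  by (cases f) (simp add: algebra_simps power2_eq_square)

lemma bqf_polar_self: "bqf_polar f x y x y = 2 * bqf_eval f x y"
  by (cases f) (simp add: algebra_simps power2_eq_square)

lemma bqf_polar_sym: "bqf_polar f x y z w = bqf_polar f z w x y"
  by (cases f) (simp add: algebra_simps)

text \<open>The Gram determinant of the polar form, in the version for two pairs of vectors.\<close>

lemma bqf_gram:
  "bqf_polar f x y u v * bqf_polar f z w s t - bqf_polar f x y s t * bqf_polar f z w u v =
     - bqf_disc f * (x * w - z * y) * (u * t - s * v)"
  by (cases f) (simp add: algebra_simps power2_eq_square)

lemma bqf_eqI_basis:
  assumes d: "x * w - z * y \<noteq> 0"
    and "bqf_eval f x y = bqf_eval g x y" "bqf_polar f x y z w = bqf_polar g x y z w"
      "bqf_eval f z w = bqf_eval g z w"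
  shows "f = g"
proof (rule bqf_eqI)
  fix u v
  define D where "D = x * w - z * y"
  have s: "bqf_eval k (D * u) (D * v) = D^2 * bqf_eval k u v" for k
    by (cases k) (simp add: algebra_simps power2_eq_square)
  have e: "D * u = (u * w - z * v) * x + (x * v - u * y) * z" "D * v = (u * w - z * v) * y + (x * v - u * y) * w"
    by (simp_all add: D_def algebra_simps)
  have "bqf_eval f (D * u) (D * v) = bqf_eval g (D * u) (D * v)"
    unfolding e bqf_eval_combination assms(2-4) ..
  then have "D^2 * bqf_eval f u v = D^2 * bqf_eval g u v" unfolding s .
  then show "bqf_eval f u v = bqf_eval g u v" using d unfolding D_def[symmetric] by simp
qed

definition bilinear_composition ::
  "bqf \<Rightarrow> bqf \<Rightarrow> bqf \<Rightarrow> int \<Rightarrow> int \<Rightarrow> int \<Rightarrow> int \<Rightarrow> int \<Rightarrow> int \<Rightarrow> int \<Rightarrow> int \<Rightarrow> bool" where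
  "bilinear_composition f g h p1 p2 p3 p4 q1 q2 q3 q4 \<longleftrightarrow>
     (\<forall>x y z w. bqf_eval f x y * bqf_eval g z w =
           bqf_eval h (p1 * x * z + p2 * x * w + p3 * y * z + p4 * y * w)
                      (q1 * x * z + q2 * x * w + q3 * y * z + q4 * y * w)) \<and>
        p1 * q2 - p2 * q1 = bqf_eval f 1 0 \<and>
        p1 * q3 - p3 * q1 = bqf_eval g 1 0"

lemma direct_composite_iff:
  "direct_composite f g h \<longleftrightarrow>
     (\<exists>p1 p2 p3 p4 q1 q2 q3 q4. bilinear_composition f g h p1 p2 p3 p4 q1 q2 q3 q4)"
  unfolding direct_composite_def bilinear_composition_def ..

lemma bilinear_composition_coeffs:
  assumes "bilinear_composition (a, b, c) (a', b', c') h p1 p2 p3 p4 q1 q2 q3 q4"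
  shows "bqf_eval h p1 q1 = a * a'" "bqf_eval h p2 q2 = a * c'"
    "bqf_eval h p3 q3 = c * a'" "bqf_eval h p4 q4 = c * c'"
    "bqf_polar h p1 q1 p2 q2 = a * b'" "bqf_polar h p1 q1 p3 q3 = b * a'"
    "bqf_polar h p2 q2 p4 q4 = b * c'" "bqf_polar h p3 q3 p4 q4 = c * b'"
    "bqf_polar h p1 q1 p4 q4 + bqf_polar h p2 q2 p3 q3 = b * b'"
proof -
  obtain A B C where h: "h = (A, B, C)" by (cases h)
  have I: "bqf_eval (a, b, c) x y * bqf_eval (a', b', c') z w =
           bqf_eval h (p1 * x * z + p2 * x * w + p3 * y * z + p4 * y * w)
                      (q1 * x * z + q2 * x * w + q3 * y * z + q4 * y * w)" for x y z w
    using assms unfolding bilinear_composition_def by blast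
  show 1: "bqf_eval h p1 q1 = a * a'" "bqf_eval h p2 q2 = a * c'"
    "bqf_eval h p3 q3 = c * a'" "bqf_eval h p4 q4 = c * c'"
    using I[of 1 0 1 0] I[of 1 0 0 1] I[of 0 1 1 0] I[of 0 1 0 1] by simp_all
  have pol: "bqf_polar h x y z w = bqf_eval h (x + z) (y + w) - bqf_eval h x y - bqf_eval h z w" for x y z w
    by (simp add: h algebra_simps power2_eq_square)
  show 2: "bqf_polar h p1 q1 p2 q2 = a * b'" "bqf_polar h p1 q1 p3 q3 = b * a'"
    "bqf_polar h p2 q2 p4 q4 = b * c'" "bqf_polar h p3 q3 p4 q4 = c * b'"
    unfolding pol 1
    using I[of 1 0 1 1] I[of 1 1 1 0] I[of 1 1 0 1] I[of 0 1 1 1]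
    by (simp_all add: algebra_simps)
  have "bqf_eval h (p1 + p2 + p3 + p4) (q1 + q2 + q3 + q4) = (a + b + c) * (a' + b' + c')"
    using I[of 1 1 1 1] by simp
  moreover have "bqf_eval h (p1 + p2 + p3 + p4) (q1 + q2 + q3 + q4) =
      bqf_eval h p1 q1 + bqf_eval h p2 q2 + bqf_eval h p3 q3 + bqf_eval h p4 q4 +
      bqf_polar h p1 q1 p2 q2 + bqf_polar h p1 q1 p3 q3 + bqf_polar h p2 q2 p4 q4 + bqf_polar h p3 q3 p4 q4 +
      bqf_polar h p1 q1 p4 q4 + bqf_polar h p2 q2 p3 q3"
    by (simp add: h algebra_simps power2_eq_square)
  ultimately show "bqf_polar h p1 q1 p4 q4 + bqf_polar h p2 q2 p3 q3 = b * b'"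
    unfolding 1 2 by (simp add: algebra_simps)
qed

context discriminant
begin

text \<open>Comparing coefficients gives all values of the polar form of \<open>h\<close> on the four columns
  \<open>(p\<^sub>i, q\<^sub>i)\<close>, except that only the sum of its values on the pairs 1, 4 and 2, 3 is known. The Gram
  identity for the known minors 12 and 13 separates these two values, and further instances of it
  give the other minors after division by \<open>a \<Delta>\<close> or \<open>a' \<Delta>\<close>.\<close>

lemma composition_minors:
  assumes comp: "bilinear_composition (a, b, c) (a', b', c') h p1 p2 p3 p4 q1 q2 q3 q4"
    and f: "bqf_disc (a, b, c) = \<Delta>" and g: "bqf_disc (a', b', c') = \<Delta>" and h: "bqf_disc h = \<Delta>"
  shows "p1 * q2 - p2 * q1 = a" "p1 * q3 - p3 * q1 = a'"
    "2 * (p1 * q4 - p4 * q1) = b + b'" "2 * (p2 * q3 - p3 * q2) = b' - b"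
    "p2 * q4 - p4 * q2 = c'" "p3 * q4 - p4 * q3 = c"
proof -
  note K = bilinear_composition_coeffs[OF comp]
  have a0: "a \<noteq> 0" and a0': "a' \<noteq> 0" using lead_nonzero f g by auto
  show D12: "p1 * q2 - p2 * q1 = a" and D13: "p1 * q3 - p3 * q1 = a'"
    using comp unfolding bilinear_composition_def by simp_all
  define P14 where "P14 = bqf_polar h p1 q1 p4 q4"
  define P23 where "P23 = bqf_polar h p2 q2 p3 q3"
  have P: "P14 + P23 = b * b'" using K(9) by (simp add: P14_def P23_def)
  have disc: "b^2 = \<Delta> + 4 * a * c" "b'^2 = \<Delta> + 4 * a' * c'" using f g by simp_all
  have b2: "b * (b * x) = \<Delta> * x + 4 * a * c * x" "b' * (b' * x) = \<Delta> * x + 4 * a' * c' * x" for x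
    using arg_cong[OF disc(1), of "\<lambda>t. t * x"] arg_cong[OF disc(2), of "\<lambda>t. t * x"]
    by (simp_all add: power2_eq_square distrib_right mult.assoc)
  have bb: "b * b = \<Delta> + 4 * a * c" "b' * b' = \<Delta> + 4 * a' * c'"
    using disc by (simp_all add: power2_eq_square)
  have "2 * (a * a') * P23 - (b * a') * (a * b') = - \<Delta> * a * a'"
    using bqf_gram[of h p1 q1 p1 q1 p2 q2 p3 q3] K D12 D13 h
    by (simp add: bqf_polar_self P23_def bqf_polar_sym[of h p2 q2 p1 q1])
  then have "(a * a') * (2 * P23) = (a * a') * (b * b' - \<Delta>)" by (simp add: algebra_simps)
  then have P23: "2 * P23 = b * b' - \<Delta>" using a0 a0' by simp
  then have P14: "2 * P14 = b * b' + \<Delta>" using P by simp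
  have "2 * (a * a') * (b * c') - P14 * (a * b') = - \<Delta> * a * (p1 * q4 - p4 * q1)"
    using bqf_gram[of h p1 q1 p1 q1 p2 q2 p4 q4] K D12 D13 h
    by (simp add: bqf_polar_self P14_def bqf_polar_sym[of h p2 q2 p1 q1])
  then have "2 * (2 * (a * a') * (b * c')) - (2 * P14) * (a * b') = - \<Delta> * a * (2 * (p1 * q4 - p4 * q1))"
    by (simp add: algebra_simps)
  then have "(\<Delta> * a) * (2 * (p1 * q4 - p4 * q1)) = (\<Delta> * a) * (b + b')"
    unfolding P14 by (simp add: algebra_simps b2 bb)
  then show "2 * (p1 * q4 - p4 * q1) = b + b'" using disc_nonzero a0 by simp
  have "(a * b') * P23 - (b * a') * (2 * (a * c')) = - \<Delta> * a * (p2 * q3 - p3 * q2)"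
    using bqf_gram[of h p1 q1 p2 q2 p2 q2 p3 q3] K D12 D13 h
    by (simp add: bqf_polar_self P23_def)
  then have "(a * b') * (2 * P23) - (b * a') * (2 * (2 * (a * c'))) = - \<Delta> * a * (2 * (p2 * q3 - p3 * q2))"
    by (simp add: algebra_simps)
  then have "(\<Delta> * a) * (2 * (p2 * q3 - p3 * q2)) = (\<Delta> * a) * (b' - b)"
    unfolding P23 by (simp add: algebra_simps b2 bb)
  then show "2 * (p2 * q3 - p3 * q2) = b' - b" using disc_nonzero a0 by simp
  have "(a * b') * (b * c') - P14 * (2 * (a * c')) = - \<Delta> * a * (p2 * q4 - p4 * q2)"
    using bqf_gram[of h p1 q1 p2 q2 p2 q2 p4 q4] K D12 D13 h
    by (simp add: bqf_polar_self P14_def)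
  then have "(a * b') * (b * c') - (2 * P14) * (a * c') = - \<Delta> * a * (p2 * q4 - p4 * q2)" by (simp add: algebra_simps)
  then have "(\<Delta> * a) * (p2 * q4 - p4 * q2) = (\<Delta> * a) * c'"
    unfolding P14 by (simp add: algebra_simps)
  then show "p2 * q4 - p4 * q2 = c'" using disc_nonzero a0 by simp
  have "(b * a') * (c * b') - P14 * (2 * (c * a')) = - \<Delta> * a' * (p3 * q4 - p4 * q3)"
    using bqf_gram[of h p1 q1 p3 q3 p3 q3 p4 q4] K D12 D13 h
    by (simp add: bqf_polar_self P14_def)
  then have "(b * a') * (c * b') - (2 * P14) * (c * a') = - \<Delta> * a' * (p3 * q4 - p4 * q3)" by (simp add: algebra_simps)
  then have "(\<Delta> * a') * (p3 * q4 - p4 * q3) = (\<Delta> * a') * c"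
    unfolding P14 by (simp add: algebra_simps)
  then show "p3 * q4 - p4 * q3 = c" using disc_nonzero a0' by simp
qed

text \<open>Two integral 2 by 4 matrices with the same minors, whose greatest common divisor is 1, differ by a
  matrix in \<open>SL\<^sub>2(\<int>)\<close>. For primitive \<open>f\<close> the minors are indeed coprime: \<open>a\<close> and \<open>c\<close> are minors, and
  \<open>b\<close> is a difference of two minors.\<close>

lemma direct_composite_unique:
  assumes "direct_composite f g h" "direct_composite f g h'"
    and f: "f \<in> forms" and g: "g \<in> forms" and h: "h \<in> forms" and h': "h' \<in> forms"
  shows "properly_equiv h' h"
proof -
  obtain a b c where fe: "f = (a, b, c)" by (cases f)
  obtain a' b' c' where ge: "g = (a', b', c')" by (cases g)
  obtain p1 p2 p3 p4 q1 q2 q3 q4 where c1: "bilinear_composition (a, b, c) (a', b', c') h p1 p2 p3 p4 q1 q2 q3 q4"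
    using assms(1) unfolding direct_composite_iff fe ge by blast
  obtain r1 r2 r3 r4 s1 s2 s3 s4 where c2: "bilinear_composition (a, b, c) (a', b', c') h' r1 r2 r3 r4 s1 s2 s3 s4"
    using assms(2) unfolding direct_composite_iff fe ge by blast
  have d: "bqf_disc (a, b, c) = \<Delta>" "bqf_disc (a', b', c') = \<Delta>" "bqf_disc h = \<Delta>" "bqf_disc h' = \<Delta>"
    using f g h h' by (auto simp: bqf_forms_def fe ge)
  note M1 = composition_minors[OF c1 d(1,2,3)]
  note M2 = composition_minors[OF c2 d(1,2,4)]
  note K1 = bilinear_composition_coeffs[OF c1]
  note K2 = bilinear_composition_coeffs[OF c2]
  have a0: "a \<noteq> 0" using d(1) lead_nonzero by blast
  obtain i j where "i * b + j * c = gcd b c" using bezout_int by blast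
  moreover obtain k l where "k * a + l * gcd b c = gcd a (gcd b c)" using bezout_int by blast
  ultimately obtain r s t where rst: "r * a + s * b + t * c = 1"
    using f by (simp add: bqf_forms_def fe) (metis add.assoc distrib_left mult.assoc)
  have half: "x = u - v" if "2 * u = x + y" "2 * v = y - x" for u v x y :: int using that by linarith
  have b1: "b = (p1 * q4 - p4 * q1) - (p2 * q3 - p3 * q2)" by (rule half[OF M1(3,4)])
  have b2: "b = (r1 * s4 - r4 * s1) - (r2 * s3 - r3 * s2)" by (rule half[OF M2(3,4)])
  have E14: "p1 * q4 - p4 * q1 = r1 * s4 - r4 * s1" using M1(3) M2(3) by simp
  have E23: "p2 * q3 - p3 * q2 = r2 * s3 - r3 * s2" using M1(4) M2(4) by simp
  have E12: "p1 * q2 - p2 * q1 = r1 * s2 - r2 * s1" using M1 M2 by simp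
  have E13: "p1 * q3 - p3 * q1 = r1 * s3 - r3 * s1" using M1 M2 by simp
  have E24: "p2 * q4 - p4 * q2 = r2 * s4 - r4 * s2" using M1 M2 by simp
  have one: "r * (r1 * s2 - r2 * s1) + s * (r1 * s4 - r4 * s1) - s * (r2 * s3 - r3 * s2) + t * (r3 * s4 - r4 * s3) = 1"
    using rst unfolding b2 M2(1)[symmetric] M2(6)[symmetric] by (simp add: algebra_simps)
  (* By Cramer's rule, each coprime combination of the minors equal to 1 gives an integral linear map taking
     the columns (p_i, q_i) to the columns (r_i, s_i); L is one coordinate of it. *)
  define L where "L = (\<lambda>u1 u2 u3 u4 x y :: int. r * (u1 * (x * q2 - p2 * y) + u2 * (p1 * y - x * q1))
     + s * (u1 * (x * q4 - p4 * y) + u4 * (p1 * y - x * q1))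
     - s * (u2 * (x * q3 - p3 * y) + u3 * (p2 * y - x * q2))
     + t * (u3 * (x * q4 - p4 * y) + u4 * (p3 * y - x * q3)))"
  have L1: "L u1 u2 u3 u4 p1 q1 = r * (u1 * (r1 * s2 - r2 * s1)) + s * (u1 * (r1 * s4 - r4 * s1))
     - s * (u2 * (r1 * s3 - r3 * s1) - u3 * (r1 * s2 - r2 * s1))
     + t * (u3 * (r1 * s4 - r4 * s1) - u4 * (r1 * s3 - r3 * s1))" for u1 u2 u3 u4
    unfolding L_def E12[symmetric] E14[symmetric] E13[symmetric] by (simp add: algebra_simps)
  have L2: "L u1 u2 u3 u4 p2 q2 = r * (u2 * (r1 * s2 - r2 * s1)) + s * (u1 * (r2 * s4 - r4 * s2) + u4 * (r1 * s2 - r2 * s1))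
     - s * (u2 * (r2 * s3 - r3 * s2))
     + t * (u3 * (r2 * s4 - r4 * s2) - u4 * (r2 * s3 - r3 * s2))" for u1 u2 u3 u4
    unfolding L_def E12[symmetric] E24[symmetric] E23[symmetric] by (simp add: algebra_simps)
  have lin: "L u1 u2 u3 u4 x y = L u1 u2 u3 u4 1 0 * x + L u1 u2 u3 u4 0 1 * y" for u1 u2 u3 u4 x y
    unfolding L_def by (simp add: algebra_simps)
  have "L r1 r2 r3 r4 p1 q1 = r1 * (r * (r1 * s2 - r2 * s1) + s * (r1 * s4 - r4 * s1) - s * (r2 * s3 - r3 * s2) + t * (r3 * s4 - r4 * s3))"
    unfolding L1 by (simp add: algebra_simps)
  then have i1: "L r1 r2 r3 r4 p1 q1 = r1" unfolding one by simp
  have "L s1 s2 s3 s4 p1 q1 = s1 * (r * (r1 * s2 - r2 * s1) + s * (r1 * s4 - r4 * s1) - s * (r2 * s3 - r3 * s2) + t * (r3 * s4 - r4 * s3))"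
    unfolding L1 by (simp add: algebra_simps)
  then have i2: "L s1 s2 s3 s4 p1 q1 = s1" unfolding one by simp
  have "L r1 r2 r3 r4 p2 q2 = r2 * (r * (r1 * s2 - r2 * s1) + s * (r1 * s4 - r4 * s1) - s * (r2 * s3 - r3 * s2) + t * (r3 * s4 - r4 * s3))"
    unfolding L2 by (simp add: algebra_simps)
  then have i3: "L r1 r2 r3 r4 p2 q2 = r2" unfolding one by simp
  have "L s1 s2 s3 s4 p2 q2 = s2 * (r * (r1 * s2 - r2 * s1) + s * (r1 * s4 - r4 * s1) - s * (r2 * s3 - r3 * s2) + t * (r3 * s4 - r4 * s3))"
    unfolding L2 by (simp add: algebra_simps)
  then have i4: "L s1 s2 s3 s4 p2 q2 = s2" unfolding one by simp
  define \<alpha> \<beta> \<gamma> \<delta> where "\<alpha> = L r1 r2 r3 r4 1 0" and "\<beta> = L r1 r2 r3 r4 0 1"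
    and "\<gamma> = L s1 s2 s3 s4 1 0" and "\<delta> = L s1 s2 s3 s4 0 1"
  have m: "\<alpha> * p1 + \<beta> * q1 = r1" "\<gamma> * p1 + \<delta> * q1 = s1" "\<alpha> * p2 + \<beta> * q2 = r2" "\<gamma> * p2 + \<delta> * q2 = s2"
    unfolding \<alpha>_def \<beta>_def \<gamma>_def \<delta>_def lin[symmetric] by (rule i1 i2 i3 i4)+
  have "(\<alpha> * \<delta> - \<beta> * \<gamma>) * (p1 * q2 - p2 * q1) = (\<alpha> * p1 + \<beta> * q1) * (\<gamma> * p2 + \<delta> * q2) - (\<alpha> * p2 + \<beta> * q2) * (\<gamma> * p1 + \<delta> * q1)"
    by (simp add: algebra_simps)
  then have "(\<alpha> * \<delta> - \<beta> * \<gamma>) * a = 1 * a" unfolding m M1(1) M2(1) by simp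
  then have det: "\<alpha> * \<delta> - \<beta> * \<gamma> = 1" using a0 by simp
  have pol: "bqf_polar k x y z w = bqf_eval k (x + z) (y + w) - bqf_eval k x y - bqf_eval k z w" for k x y z w
    by (cases k) (simp add: algebra_simps power2_eq_square)
  have "h = bqf_subst h' \<alpha> \<beta> \<gamma> \<delta>"
  proof (rule bqf_eqI_basis)
    show "p1 * q2 - p2 * q1 \<noteq> 0" using a0 M1(1) by simp
    show "bqf_eval h p1 q1 = bqf_eval (bqf_subst h' \<alpha> \<beta> \<gamma> \<delta>) p1 q1"
      "bqf_eval h p2 q2 = bqf_eval (bqf_subst h' \<alpha> \<beta> \<gamma> \<delta>) p2 q2"
      unfolding bqf_eval_subst m K1 K2 by simp_all
    have "\<alpha> * (p1 + p2) + \<beta> * (q1 + q2) = r1 + r2" "\<gamma> * (p1 + p2) + \<delta> * (q1 + q2) = s1 + s2"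
      using m by (simp_all add: algebra_simps)
    then show "bqf_polar h p1 q1 p2 q2 = bqf_polar (bqf_subst h' \<alpha> \<beta> \<gamma> \<delta>) p1 q1 p2 q2"
      unfolding pol[of "bqf_subst h' \<alpha> \<beta> \<gamma> \<delta>"] bqf_eval_subst m
      using K1(5) K2(5) pol[of h'] by simp
  qed
  then show ?thesis using det unfolding properly_equiv_iff_subst by blast
qed

end

section \<open>The composition class group\<close>

lemma direct_composite_commute: "direct_composite f g h \<Longrightarrow> direct_composite g f h"
proof -
  assume "direct_composite f g h"
  then obtain p1 p2 p3 p4 q1 q2 q3 q4 where "bilinear_composition f g h p1 p2 p3 p4 q1 q2 q3 q4"
    unfolding direct_composite_iff by blast
  then have "bilinear_composition g f h p1 p3 p2 p4 q1 q3 q2 q4"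
    unfolding bilinear_composition_def
    by (simp only: mult.commute[of "bqf_eval g _ _"]) (simp add: algebra_simps)
  then show ?thesis unfolding direct_composite_iff by blast
qed

lemma direct_composite_equiv_result:
  assumes "direct_composite f g h" "properly_equiv h h'"
  shows "direct_composite f g h'"
proof -
  obtain p1 p2 p3 p4 q1 q2 q3 q4 where c: "bilinear_composition f g h p1 p2 p3 p4 q1 q2 q3 q4"
    using assms(1) unfolding direct_composite_iff by blast
  obtain \<alpha> \<beta> \<gamma> \<delta> where d: "\<alpha> * \<delta> - \<beta> * \<gamma> = 1" and h: "h = bqf_subst h' \<alpha> \<beta> \<gamma> \<delta>"
    using properly_equiv_sym[OF assms(2)] unfolding properly_equiv_iff_subst by blast
  have *: "bqf_eval h' (\<alpha> * (p1 * x * z + p2 * x * w + p3 * y * z + p4 * y * w) + \<beta> * (q1 * x * z + q2 * x * w + q3 * y * z + q4 * y * w))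
       (\<gamma> * (p1 * x * z + p2 * x * w + p3 * y * z + p4 * y * w) + \<delta> * (q1 * x * z + q2 * x * w + q3 * y * z + q4 * y * w))
     = bqf_eval f x y * bqf_eval g z w" for x y z w
    using c unfolding bilinear_composition_def h bqf_eval_subst by simp
  have det: "(\<alpha> * p + \<beta> * q) * (\<gamma> * p' + \<delta> * q') - (\<alpha> * p' + \<beta> * q') * (\<gamma> * p + \<delta> * q) = p * q' - p' * q" for p q p' q'
  proof -
    have "(\<alpha> * p + \<beta> * q) * (\<gamma> * p' + \<delta> * q') - (\<alpha> * p' + \<beta> * q') * (\<gamma> * p + \<delta> * q) = (\<alpha> * \<delta> - \<beta> * \<gamma>) * (p * q' - p' * q)"
      by (simp add: algebra_simps)
    then show ?thesis unfolding d by simp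
  qed
  have "bilinear_composition f g h' (\<alpha> * p1 + \<beta> * q1) (\<alpha> * p2 + \<beta> * q2) (\<alpha> * p3 + \<beta> * q3) (\<alpha> * p4 + \<beta> * q4)
     (\<gamma> * p1 + \<delta> * q1) (\<gamma> * p2 + \<delta> * q2) (\<gamma> * p3 + \<delta> * q3) (\<gamma> * p4 + \<delta> * q4)"
    unfolding bilinear_composition_def det
  proof (intro conjI allI)
    fix x y z w
    have e: "(\<alpha> * p1 + \<beta> * q1) * x * z + (\<alpha> * p2 + \<beta> * q2) * x * w + (\<alpha> * p3 + \<beta> * q3) * y * z + (\<alpha> * p4 + \<beta> * q4) * y * w
      = \<alpha> * (p1 * x * z + p2 * x * w + p3 * y * z + p4 * y * w) + \<beta> * (q1 * x * z + q2 * x * w + q3 * y * z + q4 * y * w)"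
      "(\<gamma> * p1 + \<delta> * q1) * x * z + (\<gamma> * p2 + \<delta> * q2) * x * w + (\<gamma> * p3 + \<delta> * q3) * y * z + (\<gamma> * p4 + \<delta> * q4) * y * w
      = \<gamma> * (p1 * x * z + p2 * x * w + p3 * y * z + p4 * y * w) + \<delta> * (q1 * x * z + q2 * x * w + q3 * y * z + q4 * y * w)"
      by (simp_all add: algebra_simps)
    show "bqf_eval f x y * bqf_eval g z w = bqf_eval h'
          ((\<alpha> * p1 + \<beta> * q1) * x * z + (\<alpha> * p2 + \<beta> * q2) * x * w + (\<alpha> * p3 + \<beta> * q3) * y * z + (\<alpha> * p4 + \<beta> * q4) * y * w)
          ((\<gamma> * p1 + \<delta> * q1) * x * z + (\<gamma> * p2 + \<delta> * q2) * x * w + (\<gamma> * p3 + \<delta> * q3) * y * z + (\<gamma> * p4 + \<delta> * q4) * y * w)"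
      unfolding e by (rule *[symmetric])
  qed (use c in \<open>auto simp: bilinear_composition_def\<close>)
  then show ?thesis unfolding direct_composite_iff by blast
qed

context discriminant
begin

text \<open>The orientation condition for \<open>f'\<close> involves the minors 12, 14, 23 and 34 of the old substitution,
  which is why all of them had to be computed.\<close>

lemma direct_composite_equiv_left:
  assumes "direct_composite f g h" "properly_equiv f f'"
    and f: "f \<in> forms" and g: "g \<in> forms" and h: "h \<in> forms"
  shows "direct_composite f' g h"
proof -
  obtain a b c where fe: "f = (a, b, c)" by (cases f)
  obtain a' b' c' where ge: "g = (a', b', c')" by (cases g)
  obtain p1 p2 p3 p4 q1 q2 q3 q4 where comp: "bilinear_composition (a, b, c) (a', b', c') h p1 p2 p3 p4 q1 q2 q3 q4"
    using assms(1) unfolding direct_composite_iff fe ge by blast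
  have d: "bqf_disc (a, b, c) = \<Delta>" "bqf_disc (a', b', c') = \<Delta>" "bqf_disc h = \<Delta>"
    using f g h by (auto simp: bqf_forms_def fe ge)
  note M = composition_minors[OF comp d]
  obtain \<alpha> \<beta> \<gamma> \<delta> where det: "\<alpha> * \<delta> - \<beta> * \<gamma> = 1" and f': "f' = bqf_subst f \<alpha> \<beta> \<gamma> \<delta>"
    using assms(2) unfolding properly_equiv_iff_subst by blast
  have "bilinear_composition f' g h (\<alpha> * p1 + \<gamma> * p3) (\<alpha> * p2 + \<gamma> * p4) (\<beta> * p1 + \<delta> * p3) (\<beta> * p2 + \<delta> * p4)
     (\<alpha> * q1 + \<gamma> * q3) (\<alpha> * q2 + \<gamma> * q4) (\<beta> * q1 + \<delta> * q3) (\<beta> * q2 + \<delta> * q4)"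
    unfolding bilinear_composition_def
  proof (intro conjI allI)
    fix x y z w
    have e: "(\<alpha> * u1 + \<gamma> * u3) * x * z + (\<alpha> * u2 + \<gamma> * u4) * x * w + (\<beta> * u1 + \<delta> * u3) * y * z + (\<beta> * u2 + \<delta> * u4) * y * w
      = u1 * (\<alpha> * x + \<beta> * y) * z + u2 * (\<alpha> * x + \<beta> * y) * w + u3 * (\<gamma> * x + \<delta> * y) * z + u4 * (\<gamma> * x + \<delta> * y) * w" for u1 u2 u3 u4
      by (simp add: algebra_simps)
    show "bqf_eval f' x y * bqf_eval g z w = bqf_eval h
          ((\<alpha> * p1 + \<gamma> * p3) * x * z + (\<alpha> * p2 + \<gamma> * p4) * x * w + (\<beta> * p1 + \<delta> * p3) * y * z + (\<beta> * p2 + \<delta> * p4) * y * w)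
          ((\<alpha> * q1 + \<gamma> * q3) * x * z + (\<alpha> * q2 + \<gamma> * q4) * x * w + (\<beta> * q1 + \<delta> * q3) * y * z + (\<beta> * q2 + \<delta> * q4) * y * w)"
      unfolding e f' bqf_eval_subst fe ge using comp unfolding bilinear_composition_def by blast
  next
    have b: "b = (p1 * q4 - p4 * q1) - (p2 * q3 - p3 * q2)"
    proof -
      have "2 * b = 2 * ((p1 * q4 - p4 * q1) - (p2 * q3 - p3 * q2))"
        using M(3,4) unfolding right_diff_distrib by simp
      then show ?thesis by simp
    qed
    show "(\<alpha> * p1 + \<gamma> * p3) * (\<alpha> * q2 + \<gamma> * q4) - (\<alpha> * p2 + \<gamma> * p4) * (\<alpha> * q1 + \<gamma> * q3) = bqf_eval f' 1 0"
      unfolding f' fe bqf_subst.simps bqf_eval.simps M(1)[symmetric] M(6)[symmetric] b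
      by (simp add: algebra_simps power2_eq_square)
    have "(\<alpha> * p1 + \<gamma> * p3) * (\<beta> * q1 + \<delta> * q3) - (\<beta> * p1 + \<delta> * p3) * (\<alpha> * q1 + \<gamma> * q3) = (\<alpha> * \<delta> - \<beta> * \<gamma>) * (p1 * q3 - p3 * q1)"
      by (simp add: algebra_simps)
    then show "(\<alpha> * p1 + \<gamma> * p3) * (\<beta> * q1 + \<delta> * q3) - (\<beta> * p1 + \<delta> * p3) * (\<alpha> * q1 + \<gamma> * q3) = bqf_eval g 1 0"
      unfolding det M(2) ge by simp
  qed
  then show ?thesis unfolding direct_composite_iff by blast
qed

lemma class_mult_eq:
  assumes "direct_composite f g h"
    and f: "f \<in> forms" and g: "g \<in> forms" and h: "h \<in> forms"
  shows "bqf_class f \<otimes>\<^bsub>G\<^esub> bqf_class g = bqf_class h"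
proof -
  have "{h \<in> forms. \<exists>f'\<in>bqf_class f. \<exists>g'\<in>bqf_class g. direct_composite f' g' h} = bqf_class h" (is "?L = _")
  proof
    show "?L \<subseteq> bqf_class h"
    proof
      fix k assume "k \<in> ?L"
      then obtain f' g' where k: "k \<in> forms" and e: "properly_equiv f f'" "properly_equiv g g'" and "direct_composite f' g' k"
        by (auto simp: bqf_class_def)
      have f': "f' \<in> forms" and g': "g' \<in> forms" using e f g bqf_forms_equiv by blast+
      have "direct_composite f g' k"
        using direct_composite_equiv_left[OF \<open>direct_composite f' g' k\<close> properly_equiv_sym[OF e(1)] f' g' k] .
      then have "direct_composite g f k"
        using direct_composite_equiv_left[OF direct_composite_commute properly_equiv_sym[OF e(2)] g' f k] by blast
      then have "direct_composite f g k" by (rule direct_composite_commute)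
      then show "k \<in> bqf_class h" using direct_composite_unique[OF _ assms(1) f g k h] by (simp add: bqf_class_def)
    qed
    show "bqf_class h \<subseteq> ?L"
      using direct_composite_equiv_result[OF assms(1)] bqf_forms_equiv[OF _ h] in_bqf_class_self[of f] in_bqf_class_self[of g]
      unfolding bqf_class_def by blast
  qed
  then show ?thesis by (simp add: form_class_group_def)
qed

text \<open>Concordant forms have the explicit composite \<open>(a\<^sub>1 a\<^sub>2, b, c)\<close>, with
  \<open>x z - c y w\<close> and \<open>a\<^sub>1 x w + a\<^sub>2 y z + b y w\<close> as new arguments.\<close>

lemma concordant_mult:
  assumes f: "(a1, b, a2 * c) \<in> forms" and g: "(a2, b, a1 * c) \<in> forms"
  shows "(a1 * a2, b, c) \<in> forms"
    and "bqf_class (a1, b, a2 * c) \<otimes>\<^bsub>G\<^esub> bqf_class (a2, b, a1 * c) = bqf_class (a1 * a2, b, c)"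
proof -
  have "bqf_primitive (a1 * a2, b, c)"
    unfolding bqf_primitive_iff_prime
  proof (intro allI impI notI)
    fix p :: int assume p: "Factorial_Ring.prime p" and d: "p dvd a1 * a2 \<and> p dvd b \<and> p dvd c"
    then have "p dvd a1 \<or> p dvd a2" by (simp add: prime_dvd_mult_iff)
    moreover have "bqf_primitive (a1, b, a2 * c)" "bqf_primitive (a2, b, a1 * c)"
      using f g unfolding bqf_forms_def by blast+
    ultimately show False using p d unfolding bqf_primitive_iff_prime by (meson dvd_mult)
  qed
  then show h: "(a1 * a2, b, c) \<in> forms"
    using f g unfolding bqf_forms_iff by (auto simp: mult_ac)
  have "bilinear_composition (a1, b, a2 * c) (a2, b, a1 * c) (a1 * a2, b, c) 1 0 0 (- c) 0 a1 a2 b"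
    unfolding bilinear_composition_def by (simp add: algebra_simps power2_eq_square)
  then have "direct_composite (a1, b, a2 * c) (a2, b, a1 * c) (a1 * a2, b, c)"
    unfolding direct_composite_iff by blast
  then show "bqf_class (a1, b, a2 * c) \<otimes>\<^bsub>G\<^esub> bqf_class (a2, b, a1 * c) = bqf_class (a1 * a2, b, c)"
    using f g h by (rule class_mult_eq)
qed

lemma class_representative:
  assumes "F \<in> carrier G" "N \<noteq> 0"
  obtains a b c where "(a, b, c) \<in> forms" "F = bqf_class (a, b, c)" "coprime a N"
proof -
  obtain f where f: "f \<in> forms" "F = bqf_class f" using assms(1) by (auto simp: form_class_group_def)
  then have "bqf_primitive f" by (auto simp: bqf_forms_def)
  then obtain a b c where e: "properly_equiv f (a, b, c)" "coprime a N" using equiv_coprime_leading assms(2) by blast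
  then show thesis using that f bqf_forms_equiv bqf_class_eq_iff by metis
qed

text \<open>The middle coefficients are congruent modulo 2 because the discriminants agree. Hence the Chinese
  remainder theorem provides a common middle coefficient congruent to them modulo \<open>2 a\<^sub>1\<close> and \<open>2 a\<^sub>2\<close>;
  comparing discriminants then factors the last coefficients.\<close>

lemma align_middle_coefficients:
  assumes f: "(a1, b1, c1) \<in> forms" and g: "(a2, b2, c2) \<in> forms" and cop: "coprime a1 a2"
  obtains b c where "properly_equiv (a1, b1, c1) (a1, b, a2 * c)" "properly_equiv (a2, b2, c2) (a2, b, a1 * c)"
    "2 * a1 dvd b - b1" "b^2 - 4 * (a1 * a2) * c = \<Delta>"
proof -
  have d1: "b1^2 - 4 * a1 * c1 = \<Delta>" and d2: "b2^2 - 4 * a2 * c2 = \<Delta>" using f g by (auto simp: bqf_forms_iff)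
  have a0: "a1 \<noteq> 0" "a2 \<noteq> 0" using lead_nonzero d1 d2 by auto
  have "even (b1^2 - b2^2)"
  proof -
    have "b1^2 - b2^2 = 2 * (2 * (a1 * c1 - a2 * c2))" using d1 d2 by (simp add: algebra_simps)
    then show ?thesis by simp
  qed
  then have "even (b2 - b1)" by simp
  then obtain e where e: "b2 - b1 = 2 * e" by (elim evenE)
  obtain u v where uv: "u * a1 + v * a2 = 1" using cop bezout_int[of a1 a2] by (auto simp: coprime_iff_gcd_eq_1)
  define b where "b = b1 + 2 * a1 * (u * e)"
  have "b - b2 = 2 * e * (u * a1 - 1)" using e by (simp add: b_def algebra_simps)
  also have "u * a1 - 1 = - (v * a2)" using uv by simp
  finally have bb2: "b - b2 = 2 * a2 * (- (v * e))" by (simp add: algebra_simps)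
  define C1 where "C1 = a1 * (u * e)^2 + b1 * (u * e) + c1"
  define C2 where "C2 = a2 * (- (v * e))^2 + b2 * (- (v * e)) + c2"
  have p1: "properly_equiv (a1, b1, c1) (a1, b, C1)" unfolding b_def C1_def by (rule bqf_translate)
  have "b = b2 + 2 * a2 * (- (v * e))" using bb2 by simp
  then have p2: "properly_equiv (a2, b2, c2) (a2, b, C2)" unfolding C2_def using bqf_translate by metis
  have D1: "b^2 - 4 * a1 * C1 = \<Delta>" and D2: "b^2 - 4 * a2 * C2 = \<Delta>"
    using bqf_forms_equiv[OF p1 f] bqf_forms_equiv[OF p2 g] by (auto simp: bqf_forms_iff)
  then have E: "a1 * C1 = a2 * C2" by simp
  then have "a2 dvd C1" using cop by (metis coprime_commute coprime_dvd_mult_right_iff dvd_triv_left)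
  then obtain c where c: "C1 = a2 * c" by (elim dvdE)
  then have C2: "C2 = a1 * c" using E a0 by simp
  show thesis
    by (rule that[of b c]) (use p1 p2 D1 c C2 in \<open>auto simp: b_def mult_ac\<close>)
qed

lemma concordant_representatives:
  assumes A: "A \<in> carrier G" and B: "B \<in> carrier G"
  obtains a1 a2 b c where "(a1, b, a2 * c) \<in> forms" "(a2, b, a1 * c) \<in> forms"
    "A = bqf_class (a1, b, a2 * c)" "B = bqf_class (a2, b, a1 * c)"
proof -
  obtain a1 b1 c1 where f: "(a1, b1, c1) \<in> forms" and Ae: "A = bqf_class (a1, b1, c1)"
    using class_representative[OF A one_neq_zero] by metis
  have "a1 \<noteq> 0" using f lead_nonzero[of a1] by (auto simp: bqf_forms_def)
  then obtain a2 b2 c2 where g: "(a2, b2, c2) \<in> forms" and Be: "B = bqf_class (a2, b2, c2)" and "coprime a2 a1"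
    using class_representative[OF B] by metis
  then have "coprime a1 a2" by (simp add: coprime_commute)
  then obtain b c where "properly_equiv (a1, b1, c1) (a1, b, a2 * c)" "properly_equiv (a2, b2, c2) (a2, b, a1 * c)"
    using align_middle_coefficients[OF f g] by metis
  then show thesis using that f g Ae Be bqf_forms_equiv bqf_class_eq_iff by metis
qed

lemma class_mult_closed:
  assumes "A \<in> carrier G" "B \<in> carrier G"
  shows "A \<otimes>\<^bsub>G\<^esub> B \<in> carrier G"
proof -
  obtain a1 a2 b c where *: "(a1, b, a2 * c) \<in> forms" "(a2, b, a1 * c) \<in> forms"
    "A = bqf_class (a1, b, a2 * c)" "B = bqf_class (a2, b, a1 * c)"
    using concordant_representatives[OF assms] by metis
  show ?thesis using concordant_mult[OF *(1,2)] unfolding *(3,4) by (simp add: form_class_group_def)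
qed

lemma class_mult_commute:
  assumes "A \<in> carrier G" "B \<in> carrier G"
  shows "A \<otimes>\<^bsub>G\<^esub> B = B \<otimes>\<^bsub>G\<^esub> A"
proof -
  have "{h \<in> forms. \<exists>f\<in>A. \<exists>g\<in>B. direct_composite f g h} = {h \<in> forms. \<exists>f\<in>B. \<exists>g\<in>A. direct_composite f g h}"
    by (blast dest: direct_composite_commute)
  then show ?thesis by (simp add: form_class_group_def)
qed

text \<open>Three classes have representatives with the same middle coefficient and pairwise coprime leading
  coefficients, and both products are then the class of \<open>(a\<^sub>1 a\<^sub>2 a\<^sub>3, b, c)\<close>.\<close>

lemma class_mult_assoc:
  assumes A: "A \<in> carrier G" and B: "B \<in> carrier G"
    and C: "C \<in> carrier G"
  shows "(A \<otimes>\<^bsub>G\<^esub> B) \<otimes>\<^bsub>G\<^esub> C = A \<otimes>\<^bsub>G\<^esub> (B \<otimes>\<^bsub>G\<^esub> C)"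
proof -
  obtain a1 a2 b c where f: "(a1, b, a2 * c) \<in> forms" and g: "(a2, b, a1 * c) \<in> forms"
    and Ae: "A = bqf_class (a1, b, a2 * c)" and Be: "B = bqf_class (a2, b, a1 * c)"
    using concordant_representatives[OF A B] by metis
  note ab = concordant_mult[OF f g]
  have "a1 * a2 \<noteq> 0" using ab(1) lead_nonzero[of "a1 * a2"] by (auto simp: bqf_forms_def)
  then obtain a3 b3 c3 where h: "(a3, b3, c3) \<in> forms" and Ce: "C = bqf_class (a3, b3, c3)" and "coprime a3 (a1 * a2)"
    using class_representative[OF C] by metis
  then have cop: "coprime (a1 * a2) a3" by (simp add: coprime_commute)
  obtain b' c' where e: "properly_equiv (a1 * a2, b, c) (a1 * a2, b', a3 * c')" "properly_equiv (a3, b3, c3) (a3, b', a1 * a2 * c')"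
    "2 * (a1 * a2) dvd b' - b" "b'^2 - 4 * (a1 * a2 * a3) * c' = \<Delta>"
    using align_middle_coefficients[OF ab(1) h cop] by metis
  have "2 * a1 dvd b' - b" "2 * a2 dvd b' - b" using e(3) by (auto elim!: dvdE simp: mult_ac)
  then have e1: "properly_equiv (a1, b, a2 * c) (a1, b', a2 * (a3 * c'))" and e2: "properly_equiv (a2, b, a1 * c) (a2, b', a1 * (a3 * c'))"
    using f g e(4) by (auto intro!: bqf_translate_to simp: bqf_forms_iff mult_ac)
  have A': "A = bqf_class (a1, b', a2 * (a3 * c'))" and B': "B = bqf_class (a2, b', a1 * (a3 * c'))" and C': "C = bqf_class (a3, b', a1 * a2 * c')"
    using e1 e2 e(2) Ae Be Ce bqf_class_eq_iff by blast+
  have f': "(a1, b', a2 * (a3 * c')) \<in> forms" and g': "(a2, b', a1 * (a3 * c')) \<in> forms" and h': "(a3, b', a1 * a2 * c') \<in> forms"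
    using bqf_forms_equiv e1 e2 e(2) f g h by blast+
  note ab' = concordant_mult[OF f' g']
  have h'': "(a3, b', a2 * (a1 * c')) \<in> forms" using h' by (simp add: mult_ac)
  have g'': "(a2, b', a3 * (a1 * c')) \<in> forms" using g' by (simp add: mult_ac)
  note bc' = concordant_mult[OF g'' h'']
  have f'': "(a1, b', (a2 * a3) * c') \<in> forms" using f' by (simp add: mult_ac)
  have bc1: "(a2 * a3, b', a1 * c') \<in> forms" by (rule bc'(1))
  have "(A \<otimes>\<^bsub>G\<^esub> B) \<otimes>\<^bsub>G\<^esub> C = bqf_class (a1 * a2 * a3, b', c')"
    using ab'(2) concordant_mult(2)[OF ab'(1) h'] unfolding A' B' C' by simp
  moreover have "B \<otimes>\<^bsub>G\<^esub> C = bqf_class (a2 * a3, b', a1 * c')"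
    using bc'(2) unfolding B' C' by (simp add: mult_ac)
  then have "A \<otimes>\<^bsub>G\<^esub> (B \<otimes>\<^bsub>G\<^esub> C) = bqf_class (a1 * (a2 * a3), b', c')"
    using concordant_mult(2)[OF f'' bc1] unfolding A' by (simp add: mult_ac)
  ultimately show ?thesis by (simp add: mult.assoc)
qed

end

locale quadratic_discriminant = discriminant +
  assumes mod4: "\<Delta> mod 4 = 0 \<or> \<Delta> mod 4 = 1"
begin

definition s where "s = \<Delta> mod 4"
definition D where "D = \<Delta> div 4"

lemma disc_eq: "\<Delta> = 4 * D + s" "s = 0 \<or> s = 1" "s * s = s"
  using mod4 unfolding s_def D_def by auto

lemma disc_parity: "b^2 - 4 * a * c = \<Delta> \<Longrightarrow> even (b - s)"
proof -
  assume "b^2 - 4 * a * c = \<Delta>"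
  then have "b^2 - s = 2 * (2 * (D + a * c))" using disc_eq(1) by simp
  then have "even (b^2 - s)" by simp
  then show ?thesis by simp
qed

lemma principal_form: "(1, s, - D) \<in> forms"
  unfolding bqf_forms_iff power2_eq_square disc_eq(3) using disc_eq(1) by simp

lemma one_eq: "\<one>\<^bsub>G\<^esub> = bqf_class (1, s, - D)"
  by (simp add: form_class_group_def s_def D_def)

lemma leading_one_principal:
  assumes "b^2 - 4 * c = \<Delta>"
  shows "(1, b, c) \<in> forms" "bqf_class (1, b, c) = \<one>\<^bsub>G\<^esub>"
proof -
  show "(1, b, c) \<in> forms" unfolding bqf_forms_iff using assms by simp
  have "even (s - b)" using disc_parity[of b 1 c] assms by simp
  then have "properly_equiv (1, b, c) (1, s, - D)"
    using principal_form assms by (intro bqf_translate_to) (auto simp: bqf_forms_iff)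
  then show "bqf_class (1, b, c) = \<one>\<^bsub>G\<^esub>" unfolding one_eq bqf_class_eq_iff .
qed

text \<open>The form \<open>(a, - b, c)\<close> is equivalent to \<open>(c, b, a)\<close>, which is concordant with \<open>(a, b, c)\<close>; the
  composite \<open>(a c, b, 1)\<close> represents 1.\<close>

lemma class_inverse:
  assumes f: "(a, b, c) \<in> forms"
  shows "(a, - b, c) \<in> forms" "bqf_class (a, - b, c) \<otimes>\<^bsub>G\<^esub> bqf_class (a, b, c) = \<one>\<^bsub>G\<^esub>"
proof -
  show g: "(a, - b, c) \<in> forms" using f by (simp add: bqf_forms_iff)
  have e: "properly_equiv (a, - b, c) (c, b, a)" using bqf_swap[of a "- b" c] by simp
  have g': "(c, b, a) \<in> forms" using e g by (rule bqf_forms_equiv)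
  have "bqf_class (a, - b, c) = bqf_class (c, b, a * 1)" using e by (simp add: bqf_class_eq_iff)
  then have "bqf_class (a, - b, c) \<otimes>\<^bsub>G\<^esub> bqf_class (a, b, c) = bqf_class (c, b, a * 1) \<otimes>\<^bsub>G\<^esub> bqf_class (a, b, c * 1)"
    by simp
  also have "\<dots> = bqf_class (c * a, b, 1)"
    by (rule concordant_mult(2)) (simp_all add: f g')
  also have "\<dots> = bqf_class (1, - b, c * a)" using bqf_swap bqf_class_eq_iff by blast
  also have "\<dots> = \<one>\<^bsub>G\<^esub>" using f by (intro leading_one_principal(2)) (auto simp: bqf_forms_iff mult_ac)
  finally show "bqf_class (a, - b, c) \<otimes>\<^bsub>G\<^esub> bqf_class (a, b, c) = \<one>\<^bsub>G\<^esub>" .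
qed

theorem form_class_group_comm_group: "comm_group G"
proof (rule comm_groupI)
  fix A assume A: "A \<in> carrier G"
  then obtain a b c where f: "(a, b, c) \<in> forms" and Ae: "A = bqf_class (a, b, c)"
    using class_representative[OF A one_neq_zero] by blast
  have "bqf_class (1, b, a * c) \<otimes>\<^bsub>G\<^esub> bqf_class (a, b, 1 * c) = bqf_class (1 * a, b, c)"
    using f by (intro concordant_mult(2)) (auto simp: bqf_forms_iff mult_ac)
  moreover have "bqf_class (1, b, a * c) = \<one>\<^bsub>G\<^esub>"
    using f by (intro leading_one_principal(2)) (auto simp: bqf_forms_iff mult_ac)
  ultimately show "\<one>\<^bsub>G\<^esub> \<otimes>\<^bsub>G\<^esub> A = A" unfolding Ae by simp
  have "bqf_class (a, - b, c) \<in> carrier G" using class_inverse(1)[OF f] by (simp add: form_class_group_def)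
  then show "\<exists>B \<in> carrier G. B \<otimes>\<^bsub>G\<^esub> A = \<one>\<^bsub>G\<^esub>" unfolding Ae using class_inverse(2)[OF f] by blast
next
  show "\<one>\<^bsub>G\<^esub> \<in> carrier G" unfolding one_eq using principal_form by (simp add: form_class_group_def)
qed (use class_mult_closed class_mult_commute class_mult_assoc in blast)+

sublocale G: comm_group G by (rule form_class_group_comm_group)

lemma class_in_carrier: "f \<in> forms \<Longrightarrow> bqf_class f \<in> carrier G"
  by (simp add: form_class_group_def)

lemma class_inv:
  assumes "(a, b, c) \<in> forms"
  shows "inv\<^bsub>G\<^esub> (bqf_class (a, b, c)) = bqf_class (a, - b, c)"
  using class_inverse[OF assms] assms class_in_carrier by (intro G.inv_equality) auto

end

section \<open>Signed products\<close>

text \<open>The inductive form of the condition defining \<open>pm_zero_sum_monoid\<close>: adding one letter at a time matches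
  the descent along one prime at a time, and keeps track of all signed products instead of only the trivial
  one.\<close>

inductive signed_product :: "('a, 'b) monoid_scheme \<Rightarrow> 'a multiset \<Rightarrow> 'a \<Rightarrow> bool" for G where
  empty: "signed_product G {#} \<one>\<^bsub>G\<^esub>"
| plus: "signed_product G M x \<Longrightarrow> g \<in> carrier G \<Longrightarrow> signed_product G (add_mset g M) (x \<otimes>\<^bsub>G\<^esub> g)"
| minus: "signed_product G M x \<Longrightarrow> g \<in> carrier G \<Longrightarrow> signed_product G (add_mset g M) (x \<otimes>\<^bsub>G\<^esub> inv\<^bsub>G\<^esub> g)"

context comm_group
begin

lemma signed_product_closed: "signed_product G M x \<Longrightarrow> x \<in> carrier G \<and> set_mset M \<subseteq> carrier G"
  by (induction rule: signed_product.induct) auto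

lemma signed_product_add:
  "signed_product G M x \<Longrightarrow> signed_product G N y \<Longrightarrow> signed_product G (N + M) (y \<otimes> x)"
proof (induction rule: signed_product.induct)
  case empty
  then show ?case using signed_product_closed by simp
next
  case (plus M x g)
  then have "signed_product G (add_mset g (N + M)) ((y \<otimes> x) \<otimes> g)" by (intro signed_product.plus) auto
  then show ?case using plus signed_product_closed by (simp add: m_assoc)
next
  case (minus M x g)
  then have "signed_product G (add_mset g (N + M)) ((y \<otimes> x) \<otimes> inv g)" by (intro signed_product.minus) auto
  then show ?case using minus signed_product_closed by (simp add: m_assoc)
qed

lemma signed_product_list:
  assumes "set gs \<subseteq> carrier G" "\<forall>i < length gs. \<epsilon> i \<in> {1, -1 :: int}"
  shows "signed_product G (mset gs) (\<Otimes>i\<in>{..<length gs}. (gs ! i) [^] \<epsilon> i)"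
  using assms
proof (induction gs rule: rev_induct)
  case Nil
  then show ?case by (simp add: signed_product.empty)
next
  case (snoc g gs)
  let ?x = "\<Otimes>i\<in>{..<length gs}. (gs ! i) [^] \<epsilon> i"
  have c: "set gs \<subseteq> carrier G" "g \<in> carrier G" using snoc.prems by auto
  have sp: "signed_product G (mset gs) ?x" using snoc by auto
  have xc: "?x \<in> carrier G" using signed_product_closed[OF sp] by simp
  have nth: "gs ! i \<in> carrier G" if "i < length gs" for i using c(1) that nth_mem by blast
  have e1: "(\<Otimes>i\<in>{..<length gs}. ((gs @ [g]) ! i) [^] \<epsilon> i) = ?x"
    using nth by (intro finprod_cong') (auto simp: nth_append)
  have "(\<Otimes>i\<in>{..<length (gs @ [g])}. ((gs @ [g]) ! i) [^] \<epsilon> i) =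
      (\<Otimes>i\<in>insert (length gs) {..<length gs}. ((gs @ [g]) ! i) [^] \<epsilon> i)"
    by (simp add: lessThan_Suc)
  also have "\<dots> = g [^] \<epsilon> (length gs) \<otimes> (\<Otimes>i\<in>{..<length gs}. ((gs @ [g]) ! i) [^] \<epsilon> i)"
    using c nth by (subst finprod_insert) (auto simp: nth_append)
  also have "\<dots> = g [^] \<epsilon> (length gs) \<otimes> ?x" unfolding e1 ..
  also have "\<dots> = ?x \<otimes> g [^] \<epsilon> (length gs)" using c xc by (intro m_comm) auto
  finally have e: "(\<Otimes>i\<in>{..<length (gs @ [g])}. ((gs @ [g]) ! i) [^] \<epsilon> i) = ?x \<otimes> g [^] \<epsilon> (length gs)" .
  have "\<epsilon> (length gs) = 1 \<or> \<epsilon> (length gs) = -1" using snoc.prems(2) by auto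
  then show ?case
  proof
    assume "\<epsilon> (length gs) = 1"
    then show ?thesis unfolding e using signed_product.plus[OF sp c(2)] c(2) by (simp add: int_pow_1)
  next
    assume "\<epsilon> (length gs) = -1"
    then show ?thesis unfolding e using signed_product.minus[OF sp c(2)] c(2) by (simp add: int_pow_neg int_pow_1)
  qed
qed

lemma signed_product_obtain_signs:
  assumes "signed_product G M x"
  shows "\<exists>gs. \<exists>\<epsilon> :: nat \<Rightarrow> int. mset gs = M \<and> set gs \<subseteq> carrier G \<and> (\<forall>i < length gs. \<epsilon> i \<in> {1, -1}) \<and>
     (\<Otimes>i\<in>{..<length gs}. (gs ! i) [^] \<epsilon> i) = x"
proof -
  have snoc: "\<exists>gs'. \<exists>\<epsilon>' :: nat \<Rightarrow> int. mset gs' = add_mset g (mset gs) \<and> set gs' \<subseteq> carrier G \<and> (\<forall>i < length gs'. \<epsilon>' i \<in> {1, -1}) \<and>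
     (\<Otimes>i\<in>{..<length gs'}. (gs' ! i) [^] \<epsilon>' i) = (\<Otimes>i\<in>{..<length gs}. (gs ! i) [^] \<epsilon> i) \<otimes> g [^] e"
    if c: "set gs \<subseteq> carrier G" "\<forall>i < length gs. \<epsilon> i \<in> {1, -1}" "g \<in> carrier G" and e: "e = 1 \<or> e = -1"
    for gs g and \<epsilon> :: "nat \<Rightarrow> int" and e :: int
  proof (rule exI[of _ "gs @ [g]"], rule exI[of _ "\<epsilon>(length gs := e)"], intro conjI)
    let ?\<epsilon> = "\<epsilon>(length gs := e)" and ?x = "\<Otimes>i\<in>{..<length gs}. (gs ! i) [^] \<epsilon> i"
    show "\<forall>i<length (gs @ [g]). ?\<epsilon> i \<in> {1, - 1}" using c(2) e by (auto simp: less_Suc_eq)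
    have nth: "gs ! i \<in> carrier G" if "i < length gs" for i using c(1) that nth_mem by blast
    have xc: "?x \<in> carrier G" using nth by (intro finprod_closed) auto
    have e1: "(\<Otimes>i\<in>{..<length gs}. ((gs @ [g]) ! i) [^] ?\<epsilon> i) = ?x"
      using nth by (intro finprod_cong') (auto simp: nth_append)
    have "(\<Otimes>i\<in>{..<length (gs @ [g])}. ((gs @ [g]) ! i) [^] ?\<epsilon> i) =
        (\<Otimes>i\<in>insert (length gs) {..<length gs}. ((gs @ [g]) ! i) [^] ?\<epsilon> i)"
      by (simp add: lessThan_Suc)
    also have "\<dots> = g [^] e \<otimes> (\<Otimes>i\<in>{..<length gs}. ((gs @ [g]) ! i) [^] ?\<epsilon> i)"
      using c(3) nth by (subst finprod_insert) (auto simp: nth_append)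
    also have "\<dots> = ?x \<otimes> g [^] e" unfolding e1 using c(3) xc by (intro m_comm) auto
    finally show "(\<Otimes>i\<in>{..<length (gs @ [g])}. ((gs @ [g]) ! i) [^] ?\<epsilon> i) = ?x \<otimes> g [^] e" .
  qed (use c in auto)
  show ?thesis using assms
  proof (induction rule: signed_product.induct)
    case empty
    show ?case by (rule exI[of _ "[]"]) simp
  next
    case (plus M x g)
    then obtain gs and \<epsilon> :: "nat \<Rightarrow> int" where "mset gs = M" "set gs \<subseteq> carrier G" "\<forall>i < length gs. \<epsilon> i \<in> {1, -1}"
      "(\<Otimes>i\<in>{..<length gs}. (gs ! i) [^] \<epsilon> i) = x" by blast
    then show ?case using snoc[of gs \<epsilon> g 1] plus.hyps(2) by (simp add: int_pow_1)
  next
    case (minus M x g)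
    then obtain gs and \<epsilon> :: "nat \<Rightarrow> int" where "mset gs = M" "set gs \<subseteq> carrier G" "\<forall>i < length gs. \<epsilon> i \<in> {1, -1}"
      "(\<Otimes>i\<in>{..<length gs}. (gs ! i) [^] \<epsilon> i) = x" by blast
    then show ?case using snoc[of gs \<epsilon> g "-1"] minus.hyps(2) by (simp add: int_pow_neg int_pow_1)
  qed
qed

lemma pm_zero_sum_iff: "M \<in> carrier (pm_zero_sum_monoid G) \<longleftrightarrow> signed_product G M \<one>"
proof
  assume "M \<in> carrier (pm_zero_sum_monoid G)"
  then obtain gs and \<epsilon> :: "nat \<Rightarrow> int" where gs: "M = mset gs" "set gs \<subseteq> carrier G" "\<forall>i < length gs. \<epsilon> i \<in> {1, -1}"
      and one: "(\<Otimes>i\<in>{..<length gs}. (gs ! i) [^] \<epsilon> i) = \<one>"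
    unfolding pm_zero_sum_monoid_def by auto
  show "signed_product G M \<one>" using signed_product_list[OF gs(2,3)] unfolding one gs(1) .
next
  assume "signed_product G M \<one>"
  then obtain gs and \<epsilon> :: "nat \<Rightarrow> int" where gs: "mset gs = M" "set gs \<subseteq> carrier G" "\<forall>i < length gs. \<epsilon> i \<in> {1, -1}"
      and one: "(\<Otimes>i\<in>{..<length gs}. (gs ! i) [^] \<epsilon> i) = \<one>"
    using signed_product_obtain_signs[of M \<one>] by blast
  show "M \<in> carrier (pm_zero_sum_monoid G)"
    unfolding pm_zero_sum_monoid_def partial_object.simps mem_Collect_eq gs(1)[symmetric] using gs(2,3) one by blast
qed

end

text \<open>The letters of a multiset come in no order, so the letter to be removed need not be the one added last;
  commutativity moves it to the end.\<close>

lemma (in comm_group) signed_product_remove: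
  assumes "signed_product G S x" "S = add_mset g M" "g \<in> carrier G"
  shows "signed_product G M (x \<otimes> inv g) \<or> signed_product G M (x \<otimes> g)"
  using assms
proof (induction arbitrary: M rule: signed_product.induct)
  case empty
  then show ?case by simp
next
  case (plus N y h)
  have y: "y \<in> carrier G" using signed_product_closed[OF plus.hyps(1)] by simp
  from plus.prems(1) consider "N = M" "h = g" | K where "N = add_mset g K" "M = add_mset h K"
    unfolding add_eq_conv_ex by blast
  then show ?case
  proof cases
    case 1
    then show ?thesis using plus.hyps(1) y plus.prems(2) by (simp add: m_assoc)
  next
    case 2
    have "signed_product G K (y \<otimes> inv g) \<or> signed_product G K (y \<otimes> g)" by (rule plus.IH[OF 2(1) plus.prems(2)])
    then have "signed_product G M ((y \<otimes> inv g) \<otimes> h) \<or> signed_product G M ((y \<otimes> g) \<otimes> h)"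
      unfolding 2(2) using signed_product.plus[OF _ plus.hyps(2)] by blast
    then show ?thesis using y plus.prems(2) plus.hyps(2) by (simp add: m_ac)
  qed
next
  case (minus N y h)
  have y: "y \<in> carrier G" using signed_product_closed[OF minus.hyps(1)] by simp
  from minus.prems(1) consider "N = M" "h = g" | K where "N = add_mset g K" "M = add_mset h K"
    unfolding add_eq_conv_ex by blast
  then show ?case
  proof cases
    case 1
    then show ?thesis using minus.hyps(1) y minus.prems(2) by (simp add: m_assoc)
  next
    case 2
    have "signed_product G K (y \<otimes> inv g) \<or> signed_product G K (y \<otimes> g)" by (rule minus.IH[OF 2(1) minus.prems(2)])
    then have "signed_product G M ((y \<otimes> inv g) \<otimes> inv h) \<or> signed_product G M ((y \<otimes> g) \<otimes> inv h)"
      unfolding 2(2) using signed_product.minus[OF _ minus.hyps(2)] by blast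
    then show ?thesis using y minus.prems(2) minus.hyps(2) by (simp add: m_ac)
  qed
qed

lemma (in comm_group) signed_product_add_mset_iff:
  assumes g: "g \<in> carrier G" and x: "x \<in> carrier G"
  shows "signed_product G (add_mset g M) x \<longleftrightarrow> signed_product G M (x \<otimes> g) \<or> signed_product G M (x \<otimes> inv g)"
proof
  assume "signed_product G M (x \<otimes> g) \<or> signed_product G M (x \<otimes> inv g)"
  then show "signed_product G (add_mset g M) x"
    using signed_product.minus[of G M "x \<otimes> g" g] signed_product.plus[of G M "x \<otimes> inv g" g] g x
    by (auto simp: m_assoc)
qed (use signed_product_remove[OF _ refl g] in blast)

section \<open>Numbers represented by a class\<close>

context quadratic_discriminant
begin

lemma class_of_member:
  assumes "F \<in> carrier G" "f \<in> F"
  shows "f \<in> forms" "F = bqf_class f"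
proof -
  obtain g where g: "g \<in> forms" "F = bqf_class g" using assms(1) by (auto simp: form_class_group_def)
  show "f \<in> forms" using bqf_class_subset_forms[OF g(1)] assms(2) g(2) by blast
  show "F = bqf_class f" using bqf_class_eqI[of f g] assms(2) g(2) by simp
qed

lemma represents_class_iff: "represents (bqf_class f) n \<longleftrightarrow> (\<exists>x y. n = bqf_eval f x y)"
proof
  assume "represents (bqf_class f) n"
  then obtain g x y where "properly_equiv f g" "n = bqf_eval g x y" by (auto simp: represents_def bqf_class_def)
  then show "\<exists>x y. n = bqf_eval f x y" unfolding properly_equiv_def by metis
next
  assume "\<exists>x y. n = bqf_eval f x y"
  then show "represents (bqf_class f) n" using in_bqf_class_self unfolding represents_def by blast
qed

text \<open>Divide a representation by the greatest common divisor \<open>e\<close> of its arguments.\<close>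

lemma represents_iff_leading:
  assumes F: "F \<in> carrier G" and "n \<noteq> 0"
  shows "represents F n \<longleftrightarrow> (\<exists>e n0 b c. n = e^2 * n0 \<and> (n0, b, c) \<in> F)"
proof
  assume "represents F n"
  then obtain f x y where f: "f \<in> F" and n: "n = bqf_eval f x y" by (auto simp: represents_def)
  obtain a b c where fe: "f = (a, b, c)" by (cases f)
  define e where "e = gcd x y"
  have "e \<noteq> 0" using \<open>n \<noteq> 0\<close> by (auto simp: n e_def fe)
  then obtain x' y' where xy: "x = x' * e" "y = y' * e" "coprime x' y'"
    unfolding e_def using gcd_coprime_exists[of x y] by auto
  obtain b' c' where "properly_equiv f (bqf_eval f x' y', b', c')" using properly_represented_is_leading[OF xy(3)] by blast
  then have "(bqf_eval f x' y', b', c') \<in> F" using class_of_member[OF F f] by (simp add: bqf_class_def)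
  moreover have "n = e^2 * bqf_eval f x' y'" by (simp add: n xy(1,2) fe algebra_simps power2_eq_square)
  ultimately show "\<exists>e n0 b c. n = e^2 * n0 \<and> (n0, b, c) \<in> F" by blast
next
  assume "\<exists>e n0 b c. n = e^2 * n0 \<and> (n0, b, c) \<in> F"
  then obtain e n0 b c where h: "n = e^2 * n0" "(n0, b, c) \<in> F" by blast
  then have "n = bqf_eval (n0, b, c) e 0" by simp
  then show "represents F n" using h(2) unfolding represents_def by blast
qed

lemma represents_square_mult:
  assumes "represents F n"
  shows "represents F (e^2 * n)"
proof -
  obtain f x y where f: "f \<in> F" and n: "n = bqf_eval f x y" using assms by (auto simp: represents_def)
  have "e^2 * n = bqf_eval f (e * x) (e * y)" by (cases f) (simp add: n algebra_simps power2_eq_square)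
  then show ?thesis using f unfolding represents_def by blast
qed

lemma represents_mult:
  assumes F: "F \<in> carrier G" and E: "E \<in> carrier G" and "represents F n" "represents E k"
  shows "represents (F \<otimes>\<^bsub>G\<^esub> E) (n * k)"
proof -
  obtain f where f: "f \<in> forms" "F \<otimes>\<^bsub>G\<^esub> E = bqf_class f"
    using G.m_closed[OF F E] by (auto simp: form_class_group_def)
  have "f \<in> F \<otimes>\<^bsub>G\<^esub> E" using f(2) in_bqf_class_self by simp
  then obtain g h where g: "g \<in> F" and h: "h \<in> E" and d: "direct_composite g h f" by (auto simp: form_class_group_def)
  obtain x y where n: "n = bqf_eval g x y" using assms(3) class_of_member(2)[OF F g] represents_class_iff by auto
  obtain z w where k: "k = bqf_eval h z w" using assms(4) class_of_member(2)[OF E h] represents_class_iff by auto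
  obtain u v where "bqf_eval g x y * bqf_eval h z w = bqf_eval f u v"
    using d unfolding direct_composite_iff bilinear_composition_def by blast
  then show ?thesis unfolding f(2) represents_class_iff n k by blast
qed

lemma represents_inv:
  assumes F: "F \<in> carrier G" and "represents F n"
  shows "represents (inv\<^bsub>G\<^esub> F) n"
proof -
  obtain a b c where f: "(a, b, c) \<in> forms" and Fe: "F = bqf_class (a, b, c)"
    using class_representative[OF F one_neq_zero] by blast
  obtain x y where "n = bqf_eval (a, b, c) x y" using assms(2) unfolding Fe represents_class_iff by blast
  then have "n = bqf_eval (a, - b, c) x (- y)" by simp
  then show ?thesis unfolding Fe class_inv[OF f] represents_class_iff by blast
qed

lemma represents_1_iff:
  assumes F: "F \<in> carrier G"
  shows "represents F 1 \<longleftrightarrow> F = \<one>\<^bsub>G\<^esub>"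
proof
  assume "represents F 1"
  then obtain e n0 b c where h: "1 = e^2 * n0" "(n0, b, c) \<in> F" unfolding represents_iff_leading[OF F one_neq_zero] by blast
  have "e^2 * n0 = 1" using h(1) by simp
  then have "e^2 = 1 \<and> n0 = 1 \<or> e^2 = -1 \<and> n0 = -1" by (simp add: zmult_eq_1_iff)
  moreover have "e^2 \<noteq> -1" using zero_le_power2[of e] by linarith
  ultimately have "n0 = 1" by blast
  then have "(1, b, c) \<in> F" using h(2) by simp
  then have "(1, b, c) \<in> forms" "F = bqf_class (1, b, c)" using class_of_member[OF F] by auto
  then show "F = \<one>\<^bsub>G\<^esub>" using leading_one_principal(2)[of b c] by (simp add: bqf_forms_iff)
next
  assume F1: "F = \<one>\<^bsub>G\<^esub>"
  show "represents F 1" unfolding F1 one_eq represents_class_iff by (intro exI[of _ 1] exI[of _ 0]) simp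
qed

text \<open>A prime determines a form with that leading coefficient up to the sign of the middle coefficient,
  because \<open>b\<^sup>2 \<equiv> b'\<^sup>2\<close> modulo \<open>4p\<close> forces \<open>b \<equiv> \<plusminus>b'\<close> modulo \<open>2p\<close>.\<close>

lemma prime_leading_unique:
  assumes p: "Factorial_Ring.prime p" and f: "(p, b, c) \<in> forms" and g: "(p, b', c') \<in> forms"
  shows "bqf_class (p, b', c') = bqf_class (p, b, c) \<or> bqf_class (p, b', c') = inv\<^bsub>G\<^esub> (bqf_class (p, b, c))"
proof -
  have d: "b^2 - 4 * p * c = \<Delta>" "b'^2 - 4 * p * c' = \<Delta>" using f g by (auto simp: bqf_forms_iff)
  have "even (b - s)" "even (b' - s)" using disc_parity d by blast+
  then obtain u v where uv: "b - s = 2 * u" "b' - s = 2 * v" by (elim dvdE)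
  have b': "b' - b = 2 * (v - u)" "b' + b = 2 * (u + v + s)" using uv by (simp_all add: algebra_simps)
  have "4 * ((v - u) * (u + v + s)) = (b' - b) * (b' + b)" unfolding b' by (simp add: algebra_simps)
  also have "\<dots> = 4 * (p * (c' - c))" using d by (simp add: algebra_simps power2_eq_square)
  finally have "p dvd (v - u) * (u + v + s)" by simp
  then have "p dvd v - u \<or> p dvd u + v + s" using p by (simp add: prime_dvd_mult_iff)
  then show ?thesis
  proof
    assume "p dvd v - u"
    then have "2 * p dvd b' - b" unfolding b' by (intro mult_dvd_mono dvd_refl)
    then have "properly_equiv (p, b, c) (p, b', c')" using d by (intro bqf_translate_to)
    then show ?thesis using bqf_class_eq_iff by blast
  next
    assume "p dvd u + v + s"
    then have "2 * p dvd b' + b" unfolding b' by (intro mult_dvd_mono dvd_refl)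
    then have "2 * p dvd b' - (- b)" by simp
    then have "properly_equiv (p, - b, c) (p, b', c')" using d by (intro bqf_translate_to) simp_all
    then show ?thesis unfolding class_inv[OF f] using bqf_class_eq_iff by blast
  qed
qed

end

text \<open>The number \<open>m\<close> stands for the conductor: at the primes that do not divide it, \<open>\<Delta>\<close> behaves like a
  fundamental discriminant.\<close>

locale fundamental_outside = quadratic_discriminant +
  fixes m :: nat
  assumes fundamental: "p \<in> primes_not_dvd m \<Longrightarrow> \<Delta> = (int p)^2 * d \<Longrightarrow> d mod 4 \<noteq> 0 \<and> d mod 4 \<noteq> 1"
begin

definition split_prime :: "nat \<Rightarrow> bool" where
  "split_prime p \<longleftrightarrow> (\<exists>b. 4 * int p dvd b^2 - \<Delta>)"

lemma prime_int: "p \<in> primes_not_dvd m \<Longrightarrow> Factorial_Ring.prime (int p)"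
  by (simp add: primes_not_dvd_def)

text \<open>Otherwise \<open>\<Delta> / p\<^sup>2\<close> would be the discriminant of the form divided by \<open>p\<close>.\<close>

lemma not_dvd_coefficients:
  assumes p: "p \<in> primes_not_dvd m" and d: "b^2 - 4 * a * c = \<Delta>" and "int p dvd a" "int p dvd b" "int p dvd c"
  shows False
proof -
  obtain a' b' c' where e: "a = int p * a'" "b = int p * b'" "c = int p * c'" using assms(3-5) by (auto elim!: dvdE)
  have "\<Delta> = (int p)^2 * (b'^2 - 4 * (a' * c'))" unfolding d[symmetric] e by (simp add: algebra_simps power2_eq_square)
  moreover have "(b'^2 - 4 * (a' * c')) mod 4 = b'^2 mod 4" by (simp add: mod_diff_eq[symmetric])
  moreover have "b'^2 mod 4 = 0 \<or> b'^2 mod 4 = 1" by (simp add: square_mod_4)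
  ultimately show False using fundamental[OF p] by metis
qed

lemma prime_form_primitive:
  assumes p: "p \<in> primes_not_dvd m" and d: "b^2 - 4 * int p * c = \<Delta>"
  shows "(int p, b, c) \<in> forms"
proof -
  have pp: "Factorial_Ring.prime (int p)" by (rule prime_int[OF p])
  have "bqf_primitive (int p, b, c)" unfolding bqf_primitive_iff_prime
  proof (intro allI impI notI)
    fix q :: int assume q: "Factorial_Ring.prime q" and h: "q dvd int p \<and> q dvd b \<and> q dvd c"
    then have "q = int p" using primes_dvd_imp_eq[OF q pp] by simp
    then show False using not_dvd_coefficients[OF p d] h by simp
  qed
  moreover have "int p > 0" using p by (simp add: primes_not_dvd_def prime_gt_0_nat)
  ultimately show ?thesis unfolding bqf_forms_iff using d by simp
qed

text \<open>If \<open>p\<close> divides the primitively represented part \<open>n\<^sub>0\<close>, split the form \<open>(n\<^sub>0, b, c)\<close> along \<open>p\<close>. Otherwise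
  \<open>p\<close> divides the square part, and one of the two factors \<open>p\<close> is represented by \<open>Q\<close> itself.\<close>

lemma descent_split:
  assumes p: "p \<in> primes_not_dvd m" and f: "(int p, b0, c0) \<in> forms" and n: "n > 0"
    and F: "F \<in> carrier G" and r: "represents F (int p * n)"
  defines "Q \<equiv> bqf_class (int p, b0, c0)"
  shows "represents (F \<otimes>\<^bsub>G\<^esub> Q) n \<or> represents (F \<otimes>\<^bsub>G\<^esub> inv\<^bsub>G\<^esub> Q) n"
proof -
  have pp: "Factorial_Ring.prime (int p)" by (rule prime_int[OF p])
  have p0: "int p > 0" using p by (simp add: primes_not_dvd_def prime_gt_0_nat)
  have Q: "Q \<in> carrier G" unfolding Q_def by (rule class_in_carrier[OF f])
  have "int p * n \<noteq> 0" using p0 n by simp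
  then obtain e n0 b c where e: "int p * n = e^2 * n0" and h: "(n0, b, c) \<in> F"
    using r unfolding represents_iff_leading[OF F \<open>int p * n \<noteq> 0\<close>] by blast
  have h': "(n0, b, c) \<in> forms" and Fe: "F = bqf_class (n0, b, c)" using class_of_member[OF F h] by auto
  have n0pos: "n0 > 0" and "e \<noteq> 0"
  proof -
    have "e^2 * n0 > 0" using e p0 n by (metis mult_pos_pos)
    then show "n0 > 0" "e \<noteq> 0" by (auto simp: zero_less_mult_iff)
  qed
  show ?thesis
  proof (cases "int p dvd n0")
    case True
    then obtain n1 where n1: "n0 = int p * n1" by (elim dvdE)
    have n1pos: "n1 > 0" using n0pos p0 n1 by (simp add: zero_less_mult_iff)
    have d: "b^2 - 4 * n0 * c = \<Delta>" using h' by (simp add: bqf_forms_iff)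
    have g1: "(int p, b, n1 * c) \<in> forms" using d n1 by (intro prime_form_primitive[OF p]) (simp add: mult_ac)
    have g2: "(n1, b, int p * c) \<in> forms"
    proof -
      have "bqf_primitive (n1, b, int p * c)" unfolding bqf_primitive_iff_prime
      proof (intro allI impI notI)
        fix q :: int assume q: "Factorial_Ring.prime q" and hq: "q dvd n1 \<and> q dvd b \<and> q dvd int p * c"
        have "q dvd int p \<or> q dvd c" using q hq by (simp add: prime_dvd_mult_iff)
        then show False
        proof
          assume "q dvd int p"
          then have "q = int p" using primes_dvd_imp_eq[OF q pp] by simp
          then show False using not_dvd_coefficients[OF p, of b n1 "int p * c"] hq d n1 by (simp add: mult_ac)
        next
          assume "q dvd c"
          moreover have "bqf_primitive (n0, b, c)" using h' unfolding bqf_forms_def by blast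
          ultimately show False using q hq n1 unfolding bqf_primitive_iff_prime by auto
        qed
      qed
      then show ?thesis unfolding bqf_forms_iff using d n1 n1pos by (simp add: mult_ac)
    qed
    define E where "E = bqf_class (int p, b, n1 * c)"
    define K where "K = bqf_class (n1, b, int p * c)"
    have E: "E \<in> carrier G" and K: "K \<in> carrier G" unfolding E_def K_def using class_in_carrier g1 g2 by auto
    have FEK: "F = E \<otimes>\<^bsub>G\<^esub> K" using concordant_mult(2)[OF g1 g2] unfolding E_def K_def Fe n1 by simp
    have ne: "n = e^2 * n1" using e n1 p0 by simp
    have "n1 = bqf_eval (n1, b, int p * c) 1 0" by simp
    then have "represents K n1" unfolding K_def represents_class_iff by blast
    then have rep: "represents K n" unfolding ne by (rule represents_square_mult)
    have "E = Q \<or> E = inv\<^bsub>G\<^esub> Q" unfolding E_def Q_def by (rule prime_leading_unique[OF pp f g1])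
    then show ?thesis
    proof
      assume "E = Q"
      then have "F \<otimes>\<^bsub>G\<^esub> inv\<^bsub>G\<^esub> Q = K" unfolding FEK using Q K by (simp add: G.m_comm[of Q K] G.m_assoc)
      then show ?thesis using rep by simp
    next
      assume "E = inv\<^bsub>G\<^esub> Q"
      then have "F \<otimes>\<^bsub>G\<^esub> Q = K" unfolding FEK using Q K by (simp add: G.m_comm[of _ K] G.m_assoc)
      then show ?thesis using rep by simp
    qed
  next
    case False
    have "int p dvd e^2 * n0" using e by (metis dvd_triv_left)
    then have "int p dvd e" using False pp by (simp add: prime_dvd_mult_iff prime_dvd_power_iff)
    then obtain e1 where e1: "e = int p * e1" by (elim dvdE)
    have "int p * n = int p * (e1^2 * n0 * int p)" using e e1 by (simp add: power2_eq_square mult_ac)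
    then have ne: "n = e1^2 * n0 * int p" using p0 by simp
    have "n0 = bqf_eval (n0, b, c) 1 0" by simp
    then have "represents F n0" unfolding Fe represents_class_iff by blast
    then have "represents F (e1^2 * n0)" by (rule represents_square_mult)
    moreover have "int p = bqf_eval (int p, b0, c0) 1 0" by simp
    then have "represents Q (int p)" unfolding Q_def represents_class_iff by blast
    ultimately show ?thesis unfolding ne using represents_mult[OF F Q] by blast
  qed
qed

text \<open>A form \<open>(n\<^sub>0, b, c)\<close> with \<open>p\<close> dividing \<open>n\<^sub>0\<close> would make \<open>\<Delta>\<close> a square modulo \<open>4 p\<close>, so \<open>p\<close> divides
  only the square part of the representation.\<close>

lemma descent_inert:
  assumes p: "p \<in> primes_not_dvd m" and ns: "\<not> split_prime p" and n: "n \<noteq> 0"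
    and F: "F \<in> carrier G" and r: "represents F n" and dv: "int p dvd n"
  shows "\<exists>k. n = (int p)^2 * k \<and> represents F k"
proof -
  have pp: "Factorial_Ring.prime (int p)" by (rule prime_int[OF p])
  obtain e n0 b c where e: "n = e^2 * n0" and h: "(n0, b, c) \<in> F"
    using r unfolding represents_iff_leading[OF F n] by blast
  have h': "(n0, b, c) \<in> forms" and Fe: "F = bqf_class (n0, b, c)" using class_of_member[OF F h] by auto
  have "\<not> int p dvd n0"
  proof
    assume "int p dvd n0"
    then have "4 * int p dvd 4 * n0 * c" by (simp add: mult_dvd_mono)
    also have "4 * n0 * c = b^2 - \<Delta>" using h' by (auto simp: bqf_forms_iff)
    finally show False using ns unfolding split_prime_def by blast
  qed
  then have "int p dvd e" using dv e pp by (simp add: prime_dvd_mult_iff prime_dvd_power_iff)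
  then obtain e1 where e1: "e = int p * e1" by (elim dvdE)
  have "n0 = bqf_eval (n0, b, c) 1 0" by simp
  then have "represents F n0" unfolding Fe represents_class_iff by blast
  then have "represents F (e1^2 * n0)" by (rule represents_square_mult)
  moreover have "n = (int p)^2 * (e1^2 * n0)" using e e1 by (simp add: power2_eq_square mult_ac)
  ultimately show ?thesis by blast
qed

end

section \<open>The quadratic order and its lattices\<close>

lemma ring_on_simps [simp]:
  "carrier (ring_on S) = S" "mult (ring_on S) = (*)" "one (ring_on S) = 1"
  "ring.zero (ring_on S) = 0" "add (ring_on S) = (+)"
  by (simp_all add: ring_on_def)

lemma ring_on_cring:
  assumes "0 \<in> S" "1 \<in> S" "\<And>x y. x \<in> S \<Longrightarrow> y \<in> S \<Longrightarrow> x + y \<in> S" "\<And>x y. x \<in> S \<Longrightarrow> y \<in> S \<Longrightarrow> x * y \<in> S"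
    "\<And>x. x \<in> S \<Longrightarrow> - x \<in> S"
  shows "cring (ring_on S)"
proof (rule cringI)
  show "abelian_group (ring_on S)"
    by (rule abelian_groupI) (use assms in \<open>auto simp: algebra_simps intro!: bexI[of _ "- _"]\<close>)
  show "Group.comm_monoid (ring_on S)"
    by (rule comm_monoidI) (use assms in \<open>auto simp: algebra_simps\<close>)
qed (auto simp: algebra_simps)

lemma additive_subgroup_ring_on:
  assumes "cring (ring_on S)" "I \<subseteq> S" "0 \<in> I" "\<And>x y. x \<in> I \<Longrightarrow> y \<in> I \<Longrightarrow> x + y \<in> I" "\<And>x. x \<in> I \<Longrightarrow> - x \<in> I"
  shows "subgroup I (add_monoid (ring_on S))"
proof -
  interpret cring "ring_on S" by fact
  have inv: "inv\<^bsub>add_monoid (ring_on S)\<^esub> x = - x" if "x \<in> I" for x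
  proof -
    have "\<ominus>\<^bsub>ring_on S\<^esub> x = - x" using that assms by (intro minus_equality) auto
    then show ?thesis by (simp add: a_inv_def)
  qed
  show ?thesis
    by (rule group.subgroupI[OF add.is_group]) (use assms inv in auto)
qed

lemma ideal_ring_onI:
  assumes "cring (ring_on S)" "I \<subseteq> S" "0 \<in> I" "\<And>x y. x \<in> I \<Longrightarrow> y \<in> I \<Longrightarrow> x + y \<in> I"
    "\<And>r x. r \<in> S \<Longrightarrow> x \<in> I \<Longrightarrow> r * x \<in> I"
  shows "ideal I (ring_on S)"
proof -
  interpret cring "ring_on S" by fact
  have "- 1 \<in> S"
  proof -
    have "\<ominus>\<^bsub>ring_on S\<^esub> 1 \<oplus>\<^bsub>ring_on S\<^esub> 1 = 0" using l_neg[of 1] one_closed by simp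
    then have "\<ominus>\<^bsub>ring_on S\<^esub> 1 = - 1" by (simp add: eq_neg_iff_add_eq_0)
    then show ?thesis using a_inv_closed[of 1] one_closed by simp
  qed
  then have "- x \<in> I" if "x \<in> I" for x using assms(5)[of "- 1" x] that by simp
  then have "subgroup I (add_monoid (ring_on S))" by (intro additive_subgroup_ring_on assms) auto
  moreover have "a * x \<in> I" if "a \<in> I" "x \<in> S" for a x
    using assms(5)[OF that(2,1)] by (simp add: mult.commute)
  ultimately show ?thesis
    by (intro idealI[OF cring.axioms(1)[OF assms(1)]]) (use assms(5) in auto)
qed

context quadratic_discriminant
begin

abbreviation r where "r \<equiv> sqrtD \<Delta>"
abbreviation "\<O> \<equiv> ring_on (quad_order \<Delta>)"
abbreviation "\<K> \<equiv> ring_on (quad_field \<Delta>)"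

lemma r_square: "r * r = of_int \<Delta>"
  unfolding sqrtD_def by (metis power2_csqrt power2_eq_square)

lemma rat_norm_zero:
  fixes x y :: rat
  assumes "x^2 = of_int \<Delta> * y^2"
  shows "x = 0 \<and> y = 0"
proof (cases "y = 0")
  case False
  define q where "q = x / y"
  have q: "q^2 = of_int \<Delta>" using assms False by (simp add: q_def power_divide)
  obtain u v where uv: "quotient_of q = (u, v)" by (cases "quotient_of q")
  have v: "v > 0" "coprime u v" "q = of_int u / of_int v"
    using uv quotient_of_denom_pos quotient_of_coprime quotient_of_div by auto
  have "(of_int (u^2) :: rat) = of_int (\<Delta> * v^2)" using q v(1) by (simp add: v(3) power_divide field_simps)
  then have e: "u^2 = \<Delta> * v^2" by (simp only: of_int_eq_iff)
  then have "v^2 dvd u^2" by simp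
  then have "v dvd u" by simp
  then have "is_unit v" using v(2) by (metis coprime_common_divisor dvd_refl)
  then have "v = 1" using v(1) by simp
  then have "\<Delta> = u^2" using e by simp
  then show ?thesis using nonsquare by blast
qed (use assms in simp)

definition K_elt :: "rat \<Rightarrow> rat \<Rightarrow> complex" where "K_elt x y = of_rat x + of_rat y * r"

lemma quad_field_eq: "quad_field \<Delta> = {K_elt x y | x y. True}"
  by (simp add: quad_field_def K_elt_def)

lemma K_elt_in [simp]: "K_elt x y \<in> quad_field \<Delta>"
  by (auto simp: quad_field_eq)

lemma K_elt_mult: "K_elt x y * K_elt z w = K_elt (x * z + of_int \<Delta> * y * w) (x * w + y * z)"
proof -
  have "K_elt x y * K_elt z w = of_rat x * of_rat z + of_rat x * of_rat w * r + of_rat y * of_rat z * r + of_rat y * of_rat w * (r * r)"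
    by (simp add: K_elt_def algebra_simps)
  then show ?thesis unfolding r_square by (simp add: K_elt_def of_rat_add of_rat_mult algebra_simps)
qed

lemma K_elt_add: "K_elt x y + K_elt z w = K_elt (x + z) (y + w)"
  by (simp add: K_elt_def of_rat_add algebra_simps)

lemma K_elt_minus: "- K_elt x y = K_elt (- x) (- y)"
  by (simp add: K_elt_def of_rat_minus)

lemma K_elt_of_int: "of_int n = K_elt (of_int n) 0" "of_nat k = K_elt (of_nat k) 0" "0 = K_elt 0 0" "1 = K_elt 1 0"
  by (simp_all add: K_elt_def)

lemma K_elt_zero_iff: "K_elt x y = 0 \<longleftrightarrow> x = 0 \<and> y = 0"
proof
  assume "K_elt x y = 0"
  then have "K_elt x y * K_elt x (- y) = 0" by simp
  then have "of_rat (x * x - of_int \<Delta> * y * y) = (0 :: complex)" unfolding K_elt_mult by (simp add: K_elt_def)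
  then have "x^2 = of_int \<Delta> * y^2" by (simp add: power2_eq_square)
  then show "x = 0 \<and> y = 0" by (rule rat_norm_zero)
qed (simp add: K_elt_def)

lemma K_elt_eq_iff: "K_elt x y = K_elt z w \<longleftrightarrow> x = z \<and> y = w"
  using K_elt_zero_iff[of "x - z" "y - w"] by (simp add: K_elt_def of_rat_diff algebra_simps)

lemma rat_norm_nonzero: "x \<noteq> 0 \<or> y \<noteq> 0 \<Longrightarrow> x^2 - of_int \<Delta> * y^2 \<noteq> (0 :: rat)"
  using rat_norm_zero[of x y] by auto

lemma K_elt_inverse:
  assumes "x \<noteq> 0 \<or> y \<noteq> 0"
  defines "N \<equiv> x^2 - of_int \<Delta> * y^2"
  shows "K_elt x y * K_elt (x / N) (- y / N) = 1"
proof -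
  have N: "N \<noteq> 0" unfolding N_def by (rule rat_norm_nonzero[OF assms(1)])
  have "x * (x / N) + of_int \<Delta> * y * (- y / N) = (x^2 - of_int \<Delta> * y^2) / N"
    by (simp add: diff_divide_distrib power2_eq_square)
  also have "\<dots> = 1" unfolding N_def[symmetric] using N by simp
  finally show ?thesis unfolding K_elt_mult K_elt_of_int K_elt_eq_iff by simp
qed

lemma quad_field_cring: "cring \<K>"
proof (rule ring_on_cring)
  show "0 \<in> quad_field \<Delta>" "1 \<in> quad_field \<Delta>" by (auto simp: K_elt_of_int(3,4))
qed (auto simp: quad_field_eq K_elt_add K_elt_mult K_elt_minus K_elt_eq_iff)

text \<open>Half-integral coordinates cover all the lattices below, and equations between such elements are equations
  between integers.\<close>

definition half_int :: "int \<Rightarrow> int \<Rightarrow> complex" where "half_int u v = (of_int u + of_int v * r) / 2"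

lemma half_int_K: "half_int u v = K_elt (of_int u / 2) (of_int v / 2)"
  by (simp add: half_int_def K_elt_def of_rat_divide add_divide_distrib)

lemma half_int_eq_iff: "half_int u v = half_int u' v' \<longleftrightarrow> u = u' \<and> v = v'"
  unfolding half_int_K K_elt_eq_iff by simp

lemma half_int_add: "half_int u v + half_int u' v' = half_int (u + u') (v + v')"
  by (simp add: half_int_def algebra_simps add_divide_distrib)

lemma half_int_scale: "of_int k * half_int u v = half_int (k * u) (k * v)"
  by (simp add: half_int_def algebra_simps)

lemma half_int_of_int: "of_int k = half_int (2 * k) 0"
  by (simp add: half_int_def)

lemma half_int_mult:
  assumes "u * u' + \<Delta> * v * v' = 2 * P" "u * v' + u' * v = 2 * Q"
  shows "half_int u v * half_int u' v' = half_int P Q"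
proof -
  have "(of_int u * of_int u' + of_int \<Delta> * of_int v * of_int v' :: complex) = 2 * of_int P"
    using arg_cong[OF assms(1), of "of_int :: int \<Rightarrow> complex"] by simp
  moreover have "(of_int u * of_int v' + of_int u' * of_int v :: complex) = 2 * of_int Q"
    using arg_cong[OF assms(2), of "of_int :: int \<Rightarrow> complex"] by simp
  moreover have "half_int u v * half_int u' v' =
     ((of_int u * of_int u' + (r * r) * of_int v * of_int v') + (of_int u * of_int v' + of_int u' * of_int v) * r) / 4"
    by (simp add: half_int_def field_simps)
  ultimately have "half_int u v * half_int u' v' = (2 * of_int P + 2 * of_int Q * r) / 4"
    unfolding r_square by simp
  also have "\<dots> = half_int P Q" by (simp add: half_int_def)
  finally show ?thesis .
qed

definition lattice :: "int \<Rightarrow> int \<Rightarrow> complex set" where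
  "lattice a b = {half_int (2 * a * x + b * y) y | x y. True}"

lemma lattice_add: "z \<in> lattice a b \<Longrightarrow> w \<in> lattice a b \<Longrightarrow> z + w \<in> lattice a b"
proof -
  assume "z \<in> lattice a b" "w \<in> lattice a b"
  then obtain x y x' y' where "z = half_int (2 * a * x + b * y) y" "w = half_int (2 * a * x' + b * y') y'"
    by (auto simp: lattice_def)
  then have "z + w = half_int (2 * a * (x + x') + b * (y + y')) (y + y')" by (simp add: half_int_add algebra_simps)
  then show ?thesis by (auto simp: lattice_def)
qed

lemma lattice_scale: "z \<in> lattice a b \<Longrightarrow> of_int k * z \<in> lattice a b"
proof -
  assume "z \<in> lattice a b"
  then obtain x y where "z = half_int (2 * a * x + b * y) y" by (auto simp: lattice_def)
  then have "of_int k * z = half_int (2 * a * (k * x) + b * (k * y)) (k * y)" by (simp add: half_int_scale algebra_simps)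
  then show ?thesis unfolding lattice_def by blast
qed

lemma lattice_gens: "of_int a \<in> lattice a b" "half_int b 1 \<in> lattice a b" "0 \<in> lattice a b"
proof -
  have "of_int a = half_int (2 * a * 1 + b * 0) 0" by (simp add: half_int_of_int)
  then show "of_int a \<in> lattice a b" unfolding lattice_def by blast
  have "half_int b 1 = half_int (2 * a * 0 + b * 1) 1" by simp
  then show "half_int b 1 \<in> lattice a b" unfolding lattice_def by blast
  have "0 = half_int (2 * a * 0 + b * 0) 0" by (simp add: half_int_def)
  then show "0 \<in> lattice a b" unfolding lattice_def by blast
qed

lemma lattice_elt: "half_int (2 * a * x + b * y) y = of_int x * of_int a + of_int y * half_int b 1"
  by (simp add: half_int_def field_simps)

lemma s_D: "s * s = \<Delta> - 4 * D"
  using disc_eq(1,3) by linarith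

lemma lattice_module:
  assumes d: "b^2 - 4 * a * c = \<Delta>" and z: "z \<in> lattice a b" and w: "w \<in> lattice 1 s"
  shows "w * z \<in> lattice a b"
proof -
  obtain x y where ze: "z = half_int (2 * a * x + b * y) y" using z by (auto simp: lattice_def)
  obtain u v where we: "w = half_int (2 * u + s * v) v" using w by (auto simp: lattice_def)
  obtain t where t: "b - s = 2 * t" using disc_parity[OF d] by (elim evenE)
  then have s: "s = b - 2 * t" by simp
  have De: "\<Delta> = b * b - 4 * (a * c)" using d by (simp add: power2_eq_square)
  have "w * z = half_int (2 * a * (u * x - t * v * x - c * v * y) + b * (u * y + a * v * x + b * v * y - t * v * y)) (u * y + a * v * x + b * v * y - t * v * y)"
    unfolding ze we s by (rule half_int_mult) (simp_all add: De algebra_simps)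
  then show ?thesis unfolding lattice_def by blast
qed

text \<open>The order is closed under multiplication by its generator, hence already spanned by 1 and the generator.\<close>

lemma quad_order_eq: "quad_order \<Delta> = lattice 1 s"
proof -
  define w where "w = (of_int (\<Delta> mod 4) + sqrtD \<Delta>) / 2"
  have w: "w = half_int s 1" by (simp add: w_def half_int_def s_def)
  have d: "s^2 - 4 * 1 * (- D) = \<Delta>" by (simp add: power2_eq_square s_D)
  have one: "1 \<in> lattice 1 s" using lattice_gens(1)[of 1 s] by simp
  have wl: "w \<in> lattice 1 s" unfolding w by (rule lattice_gens)
  have "poly (map_poly of_int p) w \<in> lattice 1 s" for p :: "int poly"
  proof (induction p)
    case 0
    then show ?case using lattice_gens(3) by simp
  next
    case (pCons a p)
    have "poly (map_poly of_int (pCons a p)) w = of_int a * 1 + w * poly (map_poly of_int p) w"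
      by (simp add: map_poly_pCons)
    then show ?case using lattice_add[OF lattice_scale[OF one] lattice_module[OF d pCons.IH wl]] by simp
  qed
  then have "quad_order \<Delta> \<subseteq> lattice 1 s" unfolding quad_order_def w_def[symmetric] by blast
  moreover have "lattice 1 s \<subseteq> quad_order \<Delta>"
  proof
    fix z assume "z \<in> lattice 1 s"
    then obtain x y where "z = half_int (2 * 1 * x + s * y) y" by (auto simp: lattice_def)
    then have "z = poly (map_poly of_int [:x, y:]) w" unfolding lattice_elt w
      by (simp add: map_poly_pCons mult.commute)
    then show "z \<in> quad_order \<Delta>" unfolding quad_order_def w_def[symmetric] by blast
  qed
  ultimately show ?thesis by blast
qed

lemma order_one: "1 \<in> quad_order \<Delta>"
  unfolding quad_order_eq using lattice_gens(1)[of 1 s] by simp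

lemma order_of_int: "of_int k \<in> quad_order \<Delta>"
  using lattice_scale[of 1 1 s k] order_one unfolding quad_order_eq by simp

lemma order_mult: "z \<in> quad_order \<Delta> \<Longrightarrow> w \<in> quad_order \<Delta> \<Longrightarrow> z * w \<in> quad_order \<Delta>"
  unfolding quad_order_eq by (rule lattice_module[of s 1 "- D"]) (simp add: power2_eq_square s_D)

lemma order_in_K: "quad_order \<Delta> \<subseteq> quad_field \<Delta>"
  unfolding quad_order_eq lattice_def by (auto simp: half_int_K)

lemma lattice_in_K: "lattice a b \<subseteq> quad_field \<Delta>"
  unfolding lattice_def by (auto simp: half_int_K)

lemma quad_order_cring: "cring \<O>"
proof (rule ring_on_cring)
  show "0 \<in> quad_order \<Delta>" "1 \<in> quad_order \<Delta>" using order_of_int[of 0] order_one by simp_all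
  show "- x \<in> quad_order \<Delta>" if "x \<in> quad_order \<Delta>" for x
    using lattice_scale[of x 1 s "-1"] that by (simp add: quad_order_eq)
  show "x + y \<in> quad_order \<Delta>" if "x \<in> quad_order \<Delta>" "y \<in> quad_order \<Delta>" for x y
    using that unfolding quad_order_eq by (rule lattice_add)
qed (rule order_mult)

lemma half_int_in_order: "half_int u v \<in> quad_order \<Delta> \<longleftrightarrow> even (u - s * v)"
proof
  assume "half_int u v \<in> quad_order \<Delta>"
  then obtain x y where "half_int u v = half_int (2 * 1 * x + s * y) y" by (auto simp: quad_order_eq lattice_def)
  then show "even (u - s * v)" unfolding half_int_eq_iff by auto
next
  assume "even (u - s * v)"
  then obtain x where "u - s * v = 2 * x" by (elim evenE)
  then have "half_int u v = half_int (2 * 1 * x + s * v) v" by (simp add: algebra_simps)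
  then show "half_int u v \<in> quad_order \<Delta>" unfolding quad_order_eq lattice_def by blast
qed

lemma lattice_subset_order:
  assumes "b^2 - 4 * a * c = \<Delta>"
  shows "lattice a b \<subseteq> quad_order \<Delta>"
proof
  fix z assume "z \<in> lattice a b"
  then obtain x y where z: "z = half_int (2 * a * x + b * y) y" by (auto simp: lattice_def)
  have "2 * a * x + b * y - s * y = 2 * (a * x) + (b - s) * y" by (simp add: algebra_simps)
  then show "z \<in> quad_order \<Delta>" unfolding z half_int_in_order using disc_parity[OF assms] by simp
qed

lemma lattice_ideal:
  assumes "b^2 - 4 * a * c = \<Delta>"
  shows "ideal (lattice a b) \<O>"
  by (rule ideal_ring_onI[OF quad_order_cring lattice_subset_order[OF assms] lattice_gens(3) lattice_add])
    (auto simp: quad_order_eq intro: lattice_module[OF assms])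

lemma ideal_int_mult:
  assumes "ideal I \<O>" "z \<in> I"
  shows "of_int k * z \<in> I"
  using ideal.I_l_closed[OF assms, of "of_int k"] order_of_int by simp

lemma ideal_add:
  assumes "ideal I \<O>" "z \<in> I" "w \<in> I"
  shows "z + w \<in> I"
  using additive_subgroup.a_closed[OF ideal.axioms(1)[OF assms(1)] assms(2,3)] by simp

lemma Idl_eq_lattice:
  assumes "b^2 - 4 * a * c = \<Delta>"
  shows "Idl\<^bsub>\<O>\<^esub> {of_int a, (of_int b + sqrtD \<Delta>) / 2} = lattice a b"
proof
  have g: "(of_int b + sqrtD \<Delta>) / 2 = half_int b 1" by (simp add: half_int_def)
  interpret cring "\<O>" by (rule quad_order_cring)
  show "Idl\<^bsub>\<O>\<^esub> {of_int a, (of_int b + sqrtD \<Delta>) / 2} \<subseteq> lattice a b"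
    unfolding g by (rule genideal_minimal[OF lattice_ideal[OF assms]]) (simp add: lattice_gens)
  have sub: "{of_int a, half_int b 1} \<subseteq> carrier \<O>"
    using lattice_gens lattice_subset_order[OF assms] by auto
  note id = genideal_ideal[OF sub]
  show "lattice a b \<subseteq> Idl\<^bsub>\<O>\<^esub> {of_int a, (of_int b + sqrtD \<Delta>) / 2}"
    unfolding g
  proof
    fix z assume "z \<in> lattice a b"
    then obtain x y where z: "z = half_int (2 * a * x + b * y) y" by (auto simp: lattice_def)
    show "z \<in> Idl\<^bsub>\<O>\<^esub> {of_int a, half_int b 1}"
      unfolding z lattice_elt using genideal_self[OF sub] by (intro ideal_add[OF id] ideal_int_mult[OF id]) auto
  qed
qed

end

section \<open>Totally positive elements\<close>

context quadratic_discriminant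
begin

lemma embedding_of_rat:
  assumes h: "\<sigma> \<in> ring_hom \<K> (ring_on (UNIV :: real set))"
  shows "\<sigma> (K_elt x 0) = of_rat x"
proof -
  have add: "\<sigma> (K_elt a b + K_elt c d) = \<sigma> (K_elt a b) + \<sigma> (K_elt c d)"
    and mult: "\<sigma> (K_elt a b * K_elt c d) = \<sigma> (K_elt a b) * \<sigma> (K_elt c d)" for a b c d
    using h by (auto simp: ring_hom_def)
  have one: "\<sigma> (K_elt 1 0) = 1" using h by (simp add: ring_hom_def K_elt_of_int(4))
  have nat: "\<sigma> (K_elt (of_nat n) 0) = of_nat n" for n
  proof (induction n)
    case 0
    show ?case using add[of 0 0 0 0] by (simp add: K_elt_add)
  next
    case (Suc n)
    have "K_elt (of_nat (Suc n)) 0 = K_elt (of_nat n) 0 + K_elt 1 0" by (simp add: K_elt_add add.commute)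
    then show ?case using add Suc one by simp
  qed
  have int: "\<sigma> (K_elt (of_int k) 0) = of_int k" for k
  proof (cases "k \<ge> 0")
    case True
    then show ?thesis using nat[of "nat k"] by simp
  next
    case False
    have "K_elt (of_int k) 0 + K_elt (of_nat (nat (- k))) 0 = K_elt 0 0" using False by (simp add: K_elt_add)
    then have "\<sigma> (K_elt (of_int k) 0) + of_nat (nat (- k)) = \<sigma> (K_elt (of_nat 0) 0)" using add nat by (metis of_nat_0)
    then show ?thesis using nat[of 0] False by simp
  qed
  obtain u v where uv: "quotient_of x = (u, v)" by (cases "quotient_of x")
  have v: "v > 0" "x = of_int u / of_int v" using uv quotient_of_denom_pos quotient_of_div by auto
  have "K_elt (of_int v) 0 * K_elt x 0 = K_elt (of_int u) 0" using v by (simp add: K_elt_mult)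
  then have "of_int v * \<sigma> (K_elt x 0) = of_int u" using mult int by metis
  then have "\<sigma> (K_elt x 0) = of_int u / of_int v" using v(1) by (simp add: field_simps)
  moreover have "of_rat x = (of_int u / of_int v :: real)" unfolding v(2) by (simp add: of_rat_divide)
  ultimately show ?thesis by simp
qed

lemma embedding_value:
  assumes h: "\<sigma> \<in> ring_hom \<K> (ring_on (UNIV :: real set))"
  shows "\<sigma> (K_elt x y) = of_rat x + of_rat y * \<sigma> r" "(\<sigma> r)^2 = of_int \<Delta>"
proof -
  have r: "r = K_elt 0 1" by (simp add: K_elt_def)
  have "K_elt x y = K_elt x 0 + K_elt y 0 * r" unfolding r K_elt_mult K_elt_add by simp
  moreover have "\<sigma> (K_elt x 0 + K_elt y 0 * r) = \<sigma> (K_elt x 0) + \<sigma> (K_elt y 0 * r)"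
    unfolding r K_elt_mult using h by (simp add: ring_hom_def)
  moreover have "\<sigma> (K_elt y 0 * r) = \<sigma> (K_elt y 0) * \<sigma> r" unfolding r using h by (simp add: ring_hom_def)
  ultimately show "\<sigma> (K_elt x y) = of_rat x + of_rat y * \<sigma> r" using embedding_of_rat[OF h] by simp
  have "\<sigma> (r * r) = \<sigma> r * \<sigma> r" unfolding r using h by (simp add: ring_hom_def)
  moreover have "r * r = K_elt (of_int \<Delta>) 0" unfolding r_square by (rule K_elt_of_int)
  ultimately show "(\<sigma> r)^2 = of_int \<Delta>" using embedding_of_rat[OF h] by (simp add: power2_eq_square)
qed

lemma real_embedding:
  assumes \<rho>: "\<rho>^2 = (of_int \<Delta> :: real)"
  shows "\<exists>\<sigma> \<in> ring_hom \<K> (ring_on (UNIV :: real set)). \<forall>x y. \<sigma> (K_elt x y) = of_rat x + of_rat y * \<rho>"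
proof -
  define \<sigma> where "\<sigma> z = (THE w. \<exists>x y. z = K_elt x y \<and> w = of_rat x + of_rat y * \<rho>)" for z
  have v: "\<sigma> (K_elt x y) = of_rat x + of_rat y * \<rho>" for x y
    unfolding \<sigma>_def by (rule the_equality) (auto simp: K_elt_eq_iff)
  have "\<sigma> \<in> ring_hom \<K> (ring_on (UNIV :: real set))"
  proof (rule ring_hom_memI)
    fix x y assume "x \<in> carrier \<K>" "y \<in> carrier \<K>"
    then obtain a b c d where xy: "x = K_elt a b" "y = K_elt c d" by (auto simp: quad_field_eq)
    have "(of_rat (a * c + of_int \<Delta> * b * d) + of_rat (a * d + b * c) * \<rho> :: real) = (of_rat a + of_rat b * \<rho>) * (of_rat c + of_rat d * \<rho>)"
      using \<rho> by (simp add: of_rat_add of_rat_mult power2_eq_square algebra_simps flip: \<rho>)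
    then show "\<sigma> (x \<otimes>\<^bsub>\<K>\<^esub> y) = \<sigma> x \<otimes>\<^bsub>ring_on UNIV\<^esub> \<sigma> y"
      by (simp add: xy K_elt_mult v)
    show "\<sigma> (x \<oplus>\<^bsub>\<K>\<^esub> y) = \<sigma> x \<oplus>\<^bsub>ring_on UNIV\<^esub> \<sigma> y"
      by (simp add: xy K_elt_add v of_rat_add algebra_simps)
  next
    show "\<sigma> \<one>\<^bsub>\<K>\<^esub> = \<one>\<^bsub>ring_on UNIV\<^esub>" using v[of 1 0] by (simp add: K_elt_of_int(4))
  qed auto
  then show ?thesis using v by blast
qed

lemma totally_positive_norm:
  assumes tp: "totally_positive \<Delta> (K_elt x y)" and nz: "K_elt x y \<noteq> 0"
  shows "x^2 - of_int \<Delta> * y^2 > 0"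
proof (cases "\<Delta> > 0")
  case False
  then have "of_int \<Delta> * y^2 \<le> 0" by (simp add: mult_nonpos_nonneg)
  then have "x^2 - of_int \<Delta> * y^2 \<ge> 0" using zero_le_power2[of x] by linarith
  moreover have "x^2 - of_int \<Delta> * y^2 \<noteq> 0" using rat_norm_nonzero nz K_elt_zero_iff by blast
  ultimately show ?thesis by simp
next
  case True
  define \<rho> where "\<rho> = sqrt (of_int \<Delta>)"
  have \<rho>: "\<rho>^2 = of_int \<Delta>" "(- \<rho>)^2 = of_int \<Delta>" using True by (simp_all add: \<rho>_def)
  have 1: "of_rat x + of_rat y * \<rho> > 0" using real_embedding[OF \<rho>(1)] tp unfolding totally_positive_def by metis
  have 2: "of_rat x + of_rat y * - \<rho> > 0" using real_embedding[OF \<rho>(2)] tp unfolding totally_positive_def by metis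
  have "(of_rat x + of_rat y * \<rho>) * (of_rat x + of_rat y * - \<rho>) = of_rat x * of_rat x - \<rho>^2 * (of_rat y * of_rat y)"
    by (simp add: algebra_simps power2_eq_square)
  also have "\<dots> = of_rat (x^2 - of_int \<Delta> * y^2)" unfolding \<rho> by (simp add: of_rat_diff of_rat_mult power2_eq_square)
  finally have "(of_rat (x^2 - of_int \<Delta> * y^2) :: real) > 0" using mult_pos_pos[OF 1 2] by simp
  then show ?thesis by (simp only: zero_less_of_rat_iff)
qed

text \<open>A real embedding sends \<open>\<surd>\<Delta>\<close> to one of the two real roots, and for \<open>\<Delta> < 0\<close> there is none. The two possible
  values of an element multiply to its norm, so they have the same sign if the norm is positive.\<close>

lemma norm_totally_positive:
  assumes "x^2 - of_int \<Delta> * y^2 > (0 :: rat)"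
  shows "totally_positive \<Delta> (K_elt x y) \<or> totally_positive \<Delta> (- K_elt x y)"
proof (cases "\<Delta> > 0")
  case False
  have "totally_positive \<Delta> z" for z
    unfolding totally_positive_def
  proof
    fix \<sigma> assume "\<sigma> \<in> ring_hom \<K> (ring_on (UNIV :: real set))"
    then have "(\<sigma> r)^2 = of_int \<Delta>" by (rule embedding_value)
    moreover have "(of_int \<Delta> :: real) < 0" using False disc_nonzero by simp
    ultimately show "\<sigma> z > 0" by (metis not_less zero_le_power2)
  qed
  then show ?thesis by blast
next
  case True
  define \<rho> where "\<rho> = sqrt (of_int \<Delta>)"
  have \<rho>: "\<rho>^2 = of_int \<Delta>" using True by (simp_all add: \<rho>_def)
  define A B :: real where "A = of_rat x + of_rat y * \<rho>" and "B = of_rat x + of_rat y * - \<rho>"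
  have "A * B = of_rat x * of_rat x - \<rho>^2 * (of_rat y * of_rat y)"
    by (simp add: A_def B_def algebra_simps power2_eq_square)
  also have "\<dots> = of_rat (x^2 - of_int \<Delta> * y^2)" unfolding \<rho> by (simp add: of_rat_diff of_rat_mult power2_eq_square)
  finally have AB: "A * B > 0" using assms by simp
  have val: "\<sigma> (K_elt x y) = A \<or> \<sigma> (K_elt x y) = B" "\<sigma> (- K_elt x y) = - \<sigma> (K_elt x y)"
    if h: "\<sigma> \<in> ring_hom \<K> (ring_on (UNIV :: real set))" for \<sigma>
  proof -
    have "(\<sigma> r)^2 = \<rho>^2" using embedding_value(2)[OF h] \<rho> by simp
    then have "\<sigma> r = \<rho> \<or> \<sigma> r = - \<rho>" by (simp add: power2_eq_iff)
    then show "\<sigma> (K_elt x y) = A \<or> \<sigma> (K_elt x y) = B" unfolding embedding_value(1)[OF h] A_def B_def by auto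
    show "\<sigma> (- K_elt x y) = - \<sigma> (K_elt x y)" unfolding K_elt_minus embedding_value(1)[OF h] by (simp add: of_rat_minus)
  qed
  from AB have "A > 0 \<and> B > 0 \<or> A < 0 \<and> B < 0" by (auto simp: zero_less_mult_iff)
  then show ?thesis unfolding totally_positive_def using val by (metis neg_0_less_iff_less)
qed

lemma totally_positive_mult:
  assumes "z \<in> quad_field \<Delta>" "w \<in> quad_field \<Delta>" "totally_positive \<Delta> z" "totally_positive \<Delta> w"
  shows "totally_positive \<Delta> (z * w)"
  using assms unfolding totally_positive_def by (auto simp: ring_hom_def)

lemma totally_positive_of_int: "k > 0 \<Longrightarrow> totally_positive \<Delta> (of_int k)"
  unfolding totally_positive_def K_elt_of_int(1) by (auto simp: embedding_of_rat)

lemma totally_positive_inverse: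
  assumes z: "z \<in> quad_field \<Delta>" "z \<noteq> 0" and tp: "totally_positive \<Delta> z"
  shows "\<exists>w \<in> quad_field \<Delta>. w \<noteq> 0 \<and> totally_positive \<Delta> w \<and> w * z = 1"
proof -
  obtain x y where ze: "z = K_elt x y" using z by (auto simp: quad_field_eq)
  then have "x \<noteq> 0 \<or> y \<noteq> 0" using z(2) K_elt_zero_iff by auto
  note inv = K_elt_inverse[OF this]
  define w where "w = K_elt (x / (x^2 - of_int \<Delta> * y^2)) (- y / (x^2 - of_int \<Delta> * y^2))"
  have w: "z * w = 1" using inv unfolding ze w_def .
  have wK: "w \<in> quad_field \<Delta>" unfolding w_def by (rule K_elt_in)
  have "totally_positive \<Delta> w" unfolding totally_positive_def
  proof
    fix \<sigma> assume h: "\<sigma> \<in> ring_hom \<K> (ring_on (UNIV :: real set))"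
    have "\<sigma> (z * w) = \<sigma> z * \<sigma> w" "\<sigma> 1 = 1" using h z(1) wK by (auto simp: ring_hom_def)
    then have "\<sigma> z * \<sigma> w = 1" using w by simp
    moreover have "\<sigma> z > 0" using tp h unfolding totally_positive_def by blast
    ultimately show "\<sigma> w > 0" by (metis zero_less_mult_pos zero_less_one)
  qed
  moreover have "w \<noteq> 0" using w by auto
  ultimately show ?thesis using wK w by (auto simp: mult.commute)
qed

section \<open>Narrow classes of lattices\<close>

definition order_module :: "complex set \<Rightarrow> bool" where
  "order_module I \<longleftrightarrow> 0 \<in> I \<and> (\<forall>x\<in>I. \<forall>y\<in>I. x + y \<in> I) \<and> (\<forall>w\<in>quad_order \<Delta>. \<forall>x\<in>I. w * x \<in> I)"

lemma lattice_order_module: "b^2 - 4 * a * c = \<Delta> \<Longrightarrow> order_module (lattice a b)"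
  unfolding order_module_def quad_order_eq using lattice_gens lattice_add lattice_module by blast

text \<open>Multiplication by a principal ideal is multiplication by its generator. So a coset of the subgroup of totally
  positive principal ideals consists of the multiples of an ideal by totally positive elements, and narrow
  classes can be compared without the group structure of the ideals.\<close>

lemma principal_times_module:
  assumes I: "order_module I"
  shows "ideal_prod \<K> ((*) l ` quad_order \<Delta>) I = (*) l ` I"
proof
  show "ideal_prod \<K> ((*) l ` quad_order \<Delta>) I \<subseteq> (*) l ` I"
  proof
    fix z assume "z \<in> ideal_prod \<K> ((*) l ` quad_order \<Delta>) I"
    then show "z \<in> (*) l ` I"
    proof (induction rule: ideal_prod.induct)
      case (prod i j)
      then obtain w where "w \<in> quad_order \<Delta>" "i = l * w" by blast
      then have e: "i * j = l * (w * j)" and "w * j \<in> I" using I prod(2) by (auto simp: order_module_def)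
      then show ?case unfolding ring_on_simps e by blast
    next
      case (sum z1 z2)
      then obtain i1 i2 where "i1 \<in> I" "i2 \<in> I" "z1 = l * i1" "z2 = l * i2" by blast
      then have e: "z1 + z2 = l * (i1 + i2)" and "i1 + i2 \<in> I" using I by (auto simp: order_module_def algebra_simps)
      then show ?case unfolding ring_on_simps e by blast
    qed
  qed
  show "(*) l ` I \<subseteq> ideal_prod \<K> ((*) l ` quad_order \<Delta>) I"
  proof
    fix z assume "z \<in> (*) l ` I"
    then obtain i where "i \<in> I" "z = l * i" by blast
    then have "z = (l * 1) \<otimes>\<^bsub>\<K>\<^esub> i" by simp
    then show "z \<in> ideal_prod \<K> ((*) l ` quad_order \<Delta>) I"
      using \<open>i \<in> I\<close> order_one ideal_prod.prod[of "l * 1"] by (metis image_eqI)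
  qed
qed

lemma narrow_class_eq:
  assumes "order_module I"
  shows "narrow_class \<Delta> I = {(*) l ` I | l. l \<in> quad_field \<Delta> \<and> l \<noteq> 0 \<and> totally_positive \<Delta> l}"
proof -
  have "narrow_class \<Delta> I = (\<lambda>P. ideal_prod \<K> P I) ` pos_principal_ideals \<Delta>"
    by (auto simp: narrow_class_def r_coset_def ideal_group_def)
  also have "\<dots> = {(*) l ` I | l. l \<in> quad_field \<Delta> \<and> l \<noteq> 0 \<and> totally_positive \<Delta> l}"
    unfolding pos_principal_ideals_def using principal_times_module[OF assms] by (auto simp: image_iff)
  finally show ?thesis .
qed

lemma narrow_class_eq_iff:
  assumes I: "order_module I" and J: "order_module J"
  shows "narrow_class \<Delta> I = narrow_class \<Delta> J \<longleftrightarrow>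
     (\<exists>l. l \<in> quad_field \<Delta> \<and> l \<noteq> 0 \<and> totally_positive \<Delta> l \<and> I = (*) l ` J)"
proof
  assume e: "narrow_class \<Delta> I = narrow_class \<Delta> J"
  have "(1 :: complex) \<in> quad_field \<Delta>" using K_elt_of_int(4) K_elt_in by metis
  moreover have "totally_positive \<Delta> 1" using totally_positive_of_int[of 1] by simp
  moreover have "I = (*) 1 ` I" by simp
  ultimately have "I \<in> narrow_class \<Delta> I" unfolding narrow_class_eq[OF I] using one_neq_zero by blast
  then show "\<exists>l. l \<in> quad_field \<Delta> \<and> l \<noteq> 0 \<and> totally_positive \<Delta> l \<and> I = (*) l ` J"
    unfolding e narrow_class_eq[OF J] by blast
next
  have sub: "narrow_class \<Delta> A \<subseteq> narrow_class \<Delta> B" if A: "order_module A" and B: "order_module B"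
    and l: "l \<in> quad_field \<Delta>" "l \<noteq> 0" "totally_positive \<Delta> l" "A = (*) l ` B" for A B l
  proof
    fix C assume "C \<in> narrow_class \<Delta> A"
    then obtain k where k: "k \<in> quad_field \<Delta>" "k \<noteq> 0" "totally_positive \<Delta> k" "C = (*) k ` A"
      unfolding narrow_class_eq[OF A] by blast
    have "C = (*) (k * l) ` B" unfolding k(4) l(4) by (simp add: image_image mult.assoc)
    moreover have "k * l \<in> quad_field \<Delta>" using cring.cring_simprules(5)[OF quad_field_cring] k(1) l(1) by simp
    moreover have "totally_positive \<Delta> (k * l)" using totally_positive_mult k l by blast
    ultimately show "C \<in> narrow_class \<Delta> B" unfolding narrow_class_eq[OF B] using k(2) l(2) by auto
  qed
  assume "\<exists>l. l \<in> quad_field \<Delta> \<and> l \<noteq> 0 \<and> totally_positive \<Delta> l \<and> I = (*) l ` J"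
  then obtain l where l: "l \<in> quad_field \<Delta>" "l \<noteq> 0" "totally_positive \<Delta> l" "I = (*) l ` J" by blast
  obtain k where k: "k \<in> quad_field \<Delta>" "k \<noteq> 0" "totally_positive \<Delta> k" "k * l = 1"
    using totally_positive_inverse[OF l(1-3)] by blast
  have "J = (*) k ` I" unfolding l(4) by (simp add: image_image k(4) flip: mult.assoc)
  then show "narrow_class \<Delta> I = narrow_class \<Delta> J" using sub[OF I J l] sub[OF J I k(1-3)] by blast
qed

lemma K_elt_divide: "K_elt x y / of_int n = K_elt (x / of_int n) (y / of_int n)"
  by (simp add: K_elt_def of_rat_divide add_divide_distrib)

text \<open>A substitution with first column \<open>(\<alpha>, \<gamma>)\<close> changes the basis of the lattice to \<open>k = a \<alpha> + \<theta> \<gamma>\<close> and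
  \<open>k' = a \<beta> + \<theta> \<delta>\<close> with \<open>\<theta> = (b + \<surd>\<Delta>) / 2\<close>. Determinant 1 means that \<open>k' / k\<close> is
  \<open>(b' + \<surd>\<Delta>) / 2\<close> divided by \<open>a'\<close>, so the lattices differ by the factor \<open>k / a'\<close>, whose norm is \<open>a / a'\<close>.\<close>

lemma equiv_imp_same_narrow_class:
  assumes e: "properly_equiv (a, b, c) (a', b', c')" and f: "(a, b, c) \<in> forms" and pos: "a > 0" "a' > 0"
  shows "narrow_class \<Delta> (lattice a b) = narrow_class \<Delta> (lattice a' b')"
proof -
  obtain \<alpha> \<beta> \<gamma> \<delta> where det: "\<alpha> * \<delta> - \<beta> * \<gamma> = 1" and g: "(a', b', c') = bqf_subst (a, b, c) \<alpha> \<beta> \<gamma> \<delta>"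
    using e unfolding properly_equiv_iff_subst by blast
  have a': "a' = a * \<alpha>^2 + b * \<alpha> * \<gamma> + c * \<gamma>^2" and b': "b' = 2 * a * \<alpha> * \<beta> + b * (\<alpha> * \<delta> + \<beta> * \<gamma>) + 2 * c * \<gamma> * \<delta>"
    using g by simp_all
  have d: "b^2 - 4 * a * c = \<Delta>" using f by (simp add: bqf_forms_iff)
  have d': "b'^2 - 4 * a' * c' = \<Delta>" using bqf_forms_equiv[OF e f] by (simp add: bqf_forms_iff)
  have De: "\<Delta> = b * b - 4 * (a * c)" using d by (simp add: power2_eq_square)
  define k k' where "k = half_int (2 * a * \<alpha> + b * \<gamma>) \<gamma>" and "k' = half_int (2 * a * \<beta> + b * \<delta>) \<delta>"
  have ad: "\<alpha> * \<delta> = 1 + \<beta> * \<gamma>" using det by simp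
  have key: "of_int a' * k' = k * half_int b' 1"
  proof -
    have "of_int a' * k' = half_int (a' * (2 * a * \<beta> + b * \<delta>)) (a' * \<delta>)" unfolding k'_def by (rule half_int_scale)
    moreover have "k * half_int b' 1 = half_int (a' * (2 * a * \<beta> + b * \<delta>)) (a' * \<delta>)"
      unfolding k_def
    proof (rule half_int_mult)
      have 1: "\<alpha> * (\<delta> * t) = t + \<beta> * (\<gamma> * t)" for t using arg_cong[OF ad, of "\<lambda>u. u * t"] by (simp add: algebra_simps)
      show "(2 * a * \<alpha> + b * \<gamma>) * b' + \<Delta> * \<gamma> * 1 = 2 * (a' * (2 * a * \<beta> + b * \<delta>))"
        unfolding a' b' De by (simp add: algebra_simps power2_eq_square 1 ad)
      show "(2 * a * \<alpha> + b * \<gamma>) * 1 + b' * \<gamma> = 2 * (a' * \<delta>)"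
        unfolding a' b' by (simp add: algebra_simps power2_eq_square 1 ad)
    qed
    ultimately show ?thesis by simp
  qed
  have L: "lattice a b = {of_int x * k + of_int y * k' | x y. True}"
  proof -
    have comb: "of_int x * k + of_int y * k' = half_int (2 * a * (\<alpha> * x + \<beta> * y) + b * (\<gamma> * x + \<delta> * y)) (\<gamma> * x + \<delta> * y)" for x y
      unfolding k_def k'_def half_int_scale half_int_add by (simp add: algebra_simps)
    have "{of_int x * k + of_int y * k' | x y. True} \<subseteq> lattice a b" unfolding comb lattice_def by blast
    moreover have "half_int (2 * a * x + b * y) y \<in> {of_int x * k + of_int y * k' | x y. True}" for x y
    proof -
      have "\<alpha> * (\<delta> * x - \<beta> * y) + \<beta> * (\<alpha> * y - \<gamma> * x) = (\<alpha> * \<delta> - \<beta> * \<gamma>) * x"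
        "\<gamma> * (\<delta> * x - \<beta> * y) + \<delta> * (\<alpha> * y - \<gamma> * x) = (\<alpha> * \<delta> - \<beta> * \<gamma>) * y" by (simp_all add: algebra_simps)
      then have "half_int (2 * a * x + b * y) y = of_int (\<delta> * x - \<beta> * y) * k + of_int (\<alpha> * y - \<gamma> * x) * k'"
        unfolding comb det by simp
      then show ?thesis by blast
    qed
    ultimately show ?thesis unfolding lattice_def by blast
  qed
  define l where "l = k / of_int a'"
  have kl: "k = l * of_int a'" "k' = l * half_int b' 1" using key pos by (simp_all add: l_def field_simps)
  have "lattice a b = (*) l ` lattice a' b'"
  proof -
    have e: "of_int x * k + of_int y * k' = l * half_int (2 * a' * x + b' * y) y" for x y
      unfolding kl lattice_elt by (simp add: algebra_simps)
    show ?thesis unfolding L e unfolding lattice_def by blast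
  qed
  have le: "l = K_elt (of_int (2 * a * \<alpha> + b * \<gamma>) / (2 * of_int a')) (of_int \<gamma> / (2 * of_int a'))"
    unfolding l_def k_def half_int_K K_elt_divide by (simp add: mult.commute)
  have "(of_int (2 * a * \<alpha> + b * \<gamma>) / (2 * of_int a'))^2 - of_int \<Delta> * (of_int \<gamma> / (2 * of_int a'))^2 = (of_int a / of_int a' :: rat)"
  proof -
    have "(2 * a * \<alpha> + b * \<gamma>)^2 - \<Delta> * \<gamma>^2 = 4 * a * a'" unfolding a' De by (simp add: algebra_simps power2_eq_square)
    then have "(of_int (2 * a * \<alpha> + b * \<gamma>))^2 - of_int \<Delta> * (of_int \<gamma>)^2 = (4 * of_int a * of_int a' :: rat)"
      by (metis of_int_diff of_int_mult of_int_numeral of_int_power)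
    moreover have "(of_int (2 * a * \<alpha> + b * \<gamma>) / (2 * of_int a'))^2 - of_int \<Delta> * (of_int \<gamma> / (2 * of_int a'))^2
      = ((of_int (2 * a * \<alpha> + b * \<gamma>))^2 - of_int \<Delta> * (of_int \<gamma>)^2) / (4 * of_int a' * of_int a' :: rat)"
      by (simp add: power_divide diff_divide_distrib power2_eq_square)
    ultimately show ?thesis using pos by simp
  qed
  then have norm_pos: "(of_int (2 * a * \<alpha> + b * \<gamma>) / (2 * of_int a'))^2 - of_int \<Delta> * (of_int \<gamma> / (2 * of_int a'))^2 > (0 :: rat)"
    using pos by simp
  have tp: "totally_positive \<Delta> l \<or> totally_positive \<Delta> (- l)" unfolding le by (rule norm_totally_positive[OF norm_pos])
  have l0: "l \<noteq> 0"
  proof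
    assume "l = 0"
    then have "k = 0" "k' = 0" using kl by simp_all
    then have "\<gamma> = 0" "\<delta> = 0" using half_int_eq_iff[of _ _ 0 0] by (auto simp: k_def k'_def half_int_def[of 0 0])
    then show False using det by simp
  qed
  have neg: "(*) (- l) ` lattice a' b' = (*) l ` lattice a' b'"
  proof -
    have m: "- z \<in> lattice a' b'" if "z \<in> lattice a' b'" for z using lattice_scale[OF that, of "-1"] by simp
    show ?thesis
    proof (intro equalityI subsetI)
      fix w assume "w \<in> (*) (- l) ` lattice a' b'"
      then obtain z where "z \<in> lattice a' b'" "w = l * (- z)" by auto
      then show "w \<in> (*) l ` lattice a' b'" using m by blast
    next
      fix w assume "w \<in> (*) l ` lattice a' b'"
      then obtain z where "z \<in> lattice a' b'" "w = (- l) * (- z)" by auto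
      then show "w \<in> (*) (- l) ` lattice a' b'" using m by blast
    qed
  qed
  have lK: "l \<in> quad_field \<Delta>" "- l \<in> quad_field \<Delta>" unfolding le K_elt_minus by simp_all
  show ?thesis unfolding narrow_class_eq_iff[OF lattice_order_module[OF d] lattice_order_module[OF d']]
    using tp l0 lK neg \<open>lattice a b = (*) l ` lattice a' b'\<close> by (metis neg_equal_0_iff_equal)
qed

text \<open>The factor \<open>l\<close> maps one basis to integral combinations of the other, with determinant \<open>\<plusminus>1\<close>. Comparing
  coordinates expresses both forms by the same matrix, where \<open>g(\<delta>, - \<gamma>)\<close> equals \<open>a\<close> times the determinant;
  positivity of the norm of \<open>l\<close> makes this value positive and so excludes the determinant -1.\<close>

lemma same_narrow_class_imp_equiv:
  assumes e: "narrow_class \<Delta> (lattice a b) = narrow_class \<Delta> (lattice a' b')"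
    and f: "(a, b, c) \<in> forms" and g: "(a', b', c') \<in> forms" and pos: "a > 0" "a' > 0"
  shows "properly_equiv (a, b, c) (a', b', c')"
proof -
  have d: "b^2 - 4 * a * c = \<Delta>" and d': "b'^2 - 4 * a' * c' = \<Delta>" using f g by (simp_all add: bqf_forms_iff)
  obtain l where l: "l \<in> quad_field \<Delta>" "l \<noteq> 0" "totally_positive \<Delta> l" and L: "lattice a b = (*) l ` lattice a' b'"
    using e unfolding narrow_class_eq_iff[OF lattice_order_module[OF d] lattice_order_module[OF d']] by blast
  have "l * of_int a' \<in> lattice a b" "l * half_int b' 1 \<in> lattice a b" unfolding L using lattice_gens by auto
  then obtain \<alpha> \<gamma> \<beta> \<delta> where k: "l * of_int a' = half_int (2 * a * \<alpha> + b * \<gamma>) \<gamma>" and k': "l * half_int b' 1 = half_int (2 * a * \<beta> + b * \<delta>) \<delta>"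
    unfolding lattice_def by blast
  have comb: "l * half_int (2 * a' * x + b' * y) y = half_int (2 * a * (\<alpha> * x + \<beta> * y) + b * (\<gamma> * x + \<delta> * y)) (\<gamma> * x + \<delta> * y)" for x y
  proof -
    have "l * half_int (2 * a' * x + b' * y) y = of_int x * (l * of_int a') + of_int y * (l * half_int b' 1)"
      unfolding lattice_elt by (simp add: algebra_simps)
    then show ?thesis unfolding k k' half_int_scale half_int_add by (simp add: algebra_simps)
  qed
  have onto: "\<exists>p q. \<alpha> * p + \<beta> * q = x \<and> \<gamma> * p + \<delta> * q = y" for x y
  proof -
    have "half_int (2 * a * x + b * y) y \<in> lattice a b" unfolding lattice_def by blast
    then have "half_int (2 * a * x + b * y) y \<in> (*) l ` lattice a' b'" unfolding L .
    then obtain p q where "half_int (2 * a * x + b * y) y = l * half_int (2 * a' * p + b' * q) q" by (auto simp: lattice_def)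
    then have e: "y = \<gamma> * p + \<delta> * q" "2 * a * x + b * y = 2 * a * (\<alpha> * p + \<beta> * q) + b * (\<gamma> * p + \<delta> * q)"
      unfolding comb half_int_eq_iff by blast+
    then have "2 * a * x + b * y = 2 * a * (\<alpha> * p + \<beta> * q) + b * y" by simp
    then have "(2 * a) * x = (2 * a) * (\<alpha> * p + \<beta> * q)" by simp
    then have "x = \<alpha> * p + \<beta> * q" using pos by simp
    then show ?thesis using e(1) by auto
  qed
  obtain p q where pq: "\<alpha> * p + \<beta> * q = 1" "\<gamma> * p + \<delta> * q = 0" using onto by blast
  obtain p' q' where pq': "\<alpha> * p' + \<beta> * q' = 0" "\<gamma> * p' + \<delta> * q' = 1" using onto by blast
  have "(\<alpha> * \<delta> - \<beta> * \<gamma>) * (p * q' - p' * q) = (\<alpha> * p + \<beta> * q) * (\<gamma> * p' + \<delta> * q') - (\<alpha> * p' + \<beta> * q') * (\<gamma> * p + \<delta> * q)"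
    by (simp add: algebra_simps)
  also have "\<dots> = 1" unfolding pq pq' by simp
  finally have det1: "\<alpha> * \<delta> - \<beta> * \<gamma> = 1 \<or> \<alpha> * \<delta> - \<beta> * \<gamma> = -1" by (auto simp: zmult_eq_1_iff)
  have kk: "of_int a' * half_int (2 * a * \<beta> + b * \<delta>) \<delta> = half_int (2 * a * \<alpha> + b * \<gamma>) \<gamma> * half_int b' 1"
    unfolding k[symmetric] k'[symmetric] by simp
  (* U and V are the rational parts of 2 l a' and l (b' + \<surd>\<Delta>). Expressed by a', b', c' they turn the
     coefficients of one form into those of the other. *)
  define U where "U = 2 * a * \<alpha> + b * \<gamma>"
  define V where "V = 2 * a * \<beta> + b * \<delta>"
  have "K_elt (of_int (a' * V) / 2) (of_int (a' * \<delta>) / 2) = K_elt ((of_int U / 2) * (of_int b' / 2) + of_int \<Delta> * (of_int \<gamma> / 2) * (1 / 2)) ((of_int U / 2) * (1 / 2) + (of_int \<gamma> / 2) * (of_int b' / 2))"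
    using kk unfolding half_int_scale unfolding half_int_K K_elt_mult U_def V_def by simp
  then have r1: "of_int (a' * V) / 2 = (of_int U / 2) * (of_int b' / 2) + of_int \<Delta> * (of_int \<gamma> / 2) * (1 / 2 :: rat)"
    and r2: "of_int (a' * \<delta>) / 2 = (of_int U / 2) * (1 / 2) + (of_int \<gamma> / 2) * (of_int b' / 2 :: rat)"
    unfolding K_elt_eq_iff by blast+
  have "(of_int (2 * (a' * V)) :: rat) = of_int (U * b' + \<Delta> * \<gamma>)" using r1 by (simp add: field_simps)
  then have e1: "2 * (a' * V) = U * b' + \<Delta> * \<gamma>" by (simp only: of_int_eq_iff)
  have "(of_int (2 * (a' * \<delta>)) :: rat) = of_int (U + \<gamma> * b')" using r2 by (simp add: field_simps)
  then have e2: "2 * (a' * \<delta>) = U + \<gamma> * b'" by (simp only: of_int_eq_iff)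
  have U: "U = 2 * a' * \<delta> - b' * \<gamma>" using e2 by (simp add: algebra_simps)
  have De: "\<Delta> = b' * b' - 4 * (a' * c')" using d' by (simp add: power2_eq_square)
  have "2 * (a' * V) = 2 * (a' * (b' * \<delta> - 2 * c' * \<gamma>))" unfolding e1 U De by (simp add: algebra_simps)
  then have V: "V = b' * \<delta> - 2 * c' * \<gamma>" using pos by simp
  have "2 * (a * (\<alpha> * \<delta> - \<beta> * \<gamma>)) = U * \<delta> - V * \<gamma>" by (simp add: U_def V_def algebra_simps)
  also have "\<dots> = 2 * (a' * \<delta>^2 - b' * \<delta> * \<gamma> + c' * \<gamma>^2)" unfolding U V by (simp add: algebra_simps power2_eq_square)
  finally have A: "a * (\<alpha> * \<delta> - \<beta> * \<gamma>) = a' * \<delta>^2 - b' * \<delta> * \<gamma> + c' * \<gamma>^2" by simp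
  have "U * \<beta> = V * \<alpha> - b * (\<alpha> * \<delta> - \<beta> * \<gamma>)" by (simp add: U_def V_def algebra_simps)
  then have B: "b * (\<alpha> * \<delta> - \<beta> * \<gamma>) = b' * (\<delta> * \<alpha> + \<beta> * \<gamma>) - 2 * a' * \<delta> * \<beta> - 2 * c' * \<gamma> * \<alpha>"
    unfolding U V by (simp add: algebra_simps)
  obtain x y where lxy: "l = K_elt x y" using l(1) by (auto simp: quad_field_eq)
  have npos: "x^2 - of_int \<Delta> * y^2 > 0" using totally_positive_norm l unfolding lxy by blast
  have "K_elt (x * of_int a') (y * of_int a') = K_elt (of_int U / 2) (of_int \<gamma> / 2)"
    using k unfolding lxy K_elt_of_int(1) half_int_K K_elt_mult U_def by simp
  then have xy: "of_int U = 2 * of_int a' * x" "of_int \<gamma> = 2 * of_int a' * y" unfolding K_elt_eq_iff by (simp_all add: field_simps)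
  have "(of_int (U^2 - \<Delta> * \<gamma>^2) :: rat) = 4 * (of_int a')^2 * (x^2 - of_int \<Delta> * y^2)"
    by (simp add: xy algebra_simps power2_eq_square)
  then have "(of_int (U^2 - \<Delta> * \<gamma>^2) :: rat) > 0" using npos pos by simp
  then have "U^2 - \<Delta> * \<gamma>^2 > 0" by (simp only: of_int_0_less_iff)
  moreover have "U^2 - \<Delta> * \<gamma>^2 = 4 * (a' * (a * (\<alpha> * \<delta> - \<beta> * \<gamma>)))"
    unfolding A U De by (simp add: algebra_simps power2_eq_square)
  ultimately have "a' * (a * (\<alpha> * \<delta> - \<beta> * \<gamma>)) > 0" by linarith
  then have "\<alpha> * \<delta> - \<beta> * \<gamma> > 0" using pos by (simp add: zero_less_mult_iff)
  then have det: "\<alpha> * \<delta> - \<beta> * \<gamma> = 1" using det1 by auto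
  obtain a2 b2 c2 where h: "bqf_subst (a', b', c') \<delta> (- \<beta>) (- \<gamma>) \<alpha> = (a2, b2, c2)" by (rule prod_cases3)
  have a2: "a2 = a" using h A det by simp
  have b2: "b2 = b" using h B det by (simp add: algebra_simps)
  have det': "\<delta> * \<alpha> - (- \<beta>) * (- \<gamma>) = 1" using det by (simp add: algebra_simps)
  have eq: "properly_equiv (a', b', c') (a, b, c2)" unfolding properly_equiv_iff_subst using h det' unfolding a2 b2 by metis
  have "b^2 - 4 * a * c2 = \<Delta>" using bqf_forms_equiv[OF eq g] by (simp add: bqf_forms_iff)
  then have "4 * a * c2 = 4 * a * c" using d by linarith
  then have "c2 = c" using pos by simp
  then show ?thesis using eq properly_equiv_sym by blast
qed

end

section \<open>The isomorphism between form classes and narrow ideal classes\<close>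

context quadratic_discriminant
begin

text \<open>The product of the lattice with its conjugate divided by \<open>a\<close> contains \<open>a\<close>, \<open>b\<close> and \<open>c\<close>, hence 1 for a
  primitive form.\<close>

lemma lattice_invertible:
  assumes f: "(a, b, c) \<in> forms"
  shows "lattice a b \<in> invertible_ideals \<Delta>"
proof -
  have d: "b^2 - 4 * a * c = \<Delta>" and prim: "gcd a (gcd b c) = 1" using f by (simp_all add: bqf_forms_iff)
  have d': "(- b)^2 - 4 * a * c = \<Delta>" using d by simp
  have a0: "a \<noteq> 0" using lead_nonzero[of a b c] d by simp
  have De: "\<Delta> = b * b - 4 * (a * c)" using d by (simp add: power2_eq_square)
  define I J where "I = lattice a b" and "J = (\<lambda>z. z / of_int a) ` lattice a (- b)"
  have Im: "order_module I" and Lm: "order_module (lattice a (- b))"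
    unfolding I_def using lattice_order_module d d' by blast+
  have fracI: "fractional_ideal \<Delta> I"
    unfolding fractional_ideal_def
  proof (intro conjI)
    show "I \<subseteq> quad_field \<Delta>" unfolding I_def by (rule lattice_in_K)
    have "of_int a \<in> I" "(of_int a :: complex) \<noteq> 0" using lattice_gens(1) a0 by (auto simp: I_def)
    then show "I \<noteq> {0}" by blast
    show "\<exists>c\<in>quad_order \<Delta>. c \<noteq> 0 \<and> (\<forall>x\<in>I. c * x \<in> quad_order \<Delta>)"
      using order_one lattice_subset_order[OF d] by (intro bexI[of _ 1]) (auto simp: I_def)
  qed (use Im in \<open>auto simp: order_module_def\<close>)
  have fracJ: "fractional_ideal \<Delta> J"
    unfolding fractional_ideal_def
  proof (intro conjI ballI)
    show "J \<subseteq> quad_field \<Delta>"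
      using lattice_in_K[of a "- b"] unfolding J_def by (auto simp: quad_field_eq subset_iff) (metis K_elt_divide)
    have "1 \<in> J" unfolding J_def using lattice_gens(1)[of a "- b"] a0 by (force simp: image_iff)
    then show "J \<noteq> {0}" by force
    show "0 \<in> J" unfolding J_def using lattice_gens(3) by force
    show "x + y \<in> J" if xy: "x \<in> J" "y \<in> J" for x y
    proof -
      obtain u v where "u \<in> lattice a (- b)" "v \<in> lattice a (- b)" "x = u / of_int a" "y = v / of_int a" using xy by (auto simp: J_def)
      then have "x + y = (u + v) / of_int a" "u + v \<in> lattice a (- b)" using lattice_add by (auto simp: add_divide_distrib)
      then show ?thesis unfolding J_def by blast
    qed
    show "w * x \<in> J" if xy: "w \<in> quad_order \<Delta>" "x \<in> J" for w x
    proof -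
      obtain u where "u \<in> lattice a (- b)" "x = u / of_int a" using xy by (auto simp: J_def)
      then have "w * x = (w * u) / of_int a" "w * u \<in> lattice a (- b)" using Lm xy(1) by (auto simp: order_module_def)
      then show ?thesis unfolding J_def by blast
    qed
    show "\<exists>c\<in>quad_order \<Delta>. c \<noteq> 0 \<and> (\<forall>x\<in>J. c * x \<in> quad_order \<Delta>)"
      using order_of_int[of a] lattice_subset_order[OF d'] a0 by (intro bexI[of _ "of_int a"]) (auto simp: J_def)
  qed
  have product: "half_int (2 * a * x + b * y) y * (half_int (2 * a * x' + - b * y') y' / of_int a)
      = half_int (2 * a * x * x' + b * (x' * y - x * y') - 2 * c * y * y') (x * y' + x' * y)" for x y x' y'
  proof -
    have "half_int (2 * a * x + b * y) y * half_int (2 * a * x' + - b * y') y' =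
       half_int (a * (2 * a * x * x' + b * (x' * y - x * y') - 2 * c * y * y')) (a * (x * y' + x' * y))"
      by (rule half_int_mult) (simp_all add: De algebra_simps)
    also have "\<dots> = of_int a * half_int (2 * a * x * x' + b * (x' * y - x * y') - 2 * c * y * y') (x * y' + x' * y)"
      by (simp add: half_int_scale)
    finally show ?thesis using a0 by (simp add: field_simps)
  qed
  let ?P = "ideal_prod \<K> I J"
  have add: "x + y \<in> ?P" if "x \<in> ?P" "y \<in> ?P" for x y using ideal_prod.sum[OF that] by simp
  have scale: "w * x \<in> ?P" if "x \<in> ?P" and w: "w \<in> quad_order \<Delta>" for w x
    using that(1)
  proof (induction rule: ideal_prod.induct)
    case (prod i j)
    then have "w * i \<in> I" using Im w by (simp add: order_module_def)
    from ideal_prod.prod[OF this prod(2), of "\<K>"] show ?case by (simp add: mult.assoc)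
  next
    case (sum z1 z2)
    then show ?case using add by (simp add: distrib_left)
  qed
  have el: "half_int (2 * a * x * x' + b * (x' * y - x * y') - 2 * c * y * y') (x * y' + x' * y) \<in> ?P" for x y x' y'
  proof -
    have "half_int (2 * a * x + b * y) y \<in> I" "half_int (2 * a * x' + - b * y') y' / of_int a \<in> J"
      unfolding I_def J_def lattice_def by blast+
    from ideal_prod.prod[OF this, of "\<K>"] show ?thesis unfolding ring_on_simps product .
  qed
  have Pa: "of_int a \<in> ?P" using el[of 1 1 0 0] by (simp add: half_int_of_int)
  have Pc: "of_int c \<in> ?P" using el[of 0 0 1 "- 1"] by (simp add: half_int_of_int)
  have Pb: "of_int b \<in> ?P" using add[OF el[of 0 1 1 0] el[of 1 0 0 "- 1"]] by (simp add: half_int_of_int half_int_add)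
  obtain i j where "i * b + j * c = gcd b c" using bezout_int by blast
  moreover obtain k l where "k * a + l * gcd b c = gcd a (gcd b c)" using bezout_int by blast
  ultimately have "k * a + (l * i * b + l * j * c) = 1" using prim by (metis distrib_left mult.assoc)
  then have "of_int k * of_int a + (of_int (l * i) * of_int b + of_int (l * j) * of_int c) = (1 :: complex)"
    by (metis of_int_1 of_int_add of_int_mult)
  moreover have "of_int k * of_int a + (of_int (l * i) * of_int b + of_int (l * j) * of_int c) \<in> ?P"
    by (intro add scale order_of_int Pa Pb Pc)
  ultimately have P1: "1 \<in> ?P" by simp
  have "?P = quad_order \<Delta>"
  proof
    show "quad_order \<Delta> \<subseteq> ?P"
    proof
      fix w assume "w \<in> quad_order \<Delta>"
      from scale[OF P1 this] show "w \<in> ?P" by simp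
    qed
    show "?P \<subseteq> quad_order \<Delta>"
    proof
      fix z assume "z \<in> ?P"
      then show "z \<in> quad_order \<Delta>"
      proof (induction rule: ideal_prod.induct)
        case (prod i j)
        then obtain x y x' y' where "i = half_int (2 * a * x + b * y) y" "j = half_int (2 * a * x' + - b * y') y' / of_int a"
          by (auto simp: I_def J_def lattice_def)
        then have e: "i * j = half_int (2 * a * x * x' + b * (x' * y - x * y') - 2 * c * y * y') (x * y' + x' * y)" by (simp only: product)
        have e2: "2 * a * x * x' + b * (x' * y - x * y') - 2 * c * y * y' - s * (x * y' + x' * y)
            = 2 * (a * x * x' - c * y * y' - b * x * y') + (b - s) * (x * y' + x' * y)" by (simp add: algebra_simps)
        show ?case unfolding ring_on_simps e half_int_in_order e2
          using disc_parity[OF d] by (intro dvd_add dvd_mult2[of 2 "b - s"]) auto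
      next
        case (sum z1 z2)
        then show ?case using lattice_add by (simp add: quad_order_eq)
      qed
    qed
  qed
  then show ?thesis unfolding invertible_ideals_def I_def[symmetric] using fracI fracJ by blast
qed

text \<open>If \<open>a < 0\<close> then \<open>\<Delta> > 0\<close>, and \<open>f(-b, 2 a) = - a \<Delta>\<close> is a positive value.\<close>

lemma class_positive_leading:
  assumes F: "F \<in> carrier G"
  obtains a b c where "(a, b, c) \<in> F" "a > 0"
proof -
  obtain f where f: "f \<in> forms" "F = bqf_class f" using F by (auto simp: form_class_group_def)
  obtain a b c where fe: "f = (a, b, c)" by (cases f)
  have d: "b^2 - 4 * a * c = \<Delta>" and pos: "\<Delta> > 0 \<or> a > 0" using f(1) by (auto simp: fe bqf_forms_iff)
  have a0: "a \<noteq> 0" using lead_nonzero[of a b c] d by simp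
  show thesis
  proof (cases "a > 0")
    case True
    then show ?thesis using that f(2) in_bqf_class_self[of f] fe by blast
  next
    case False
    define n where "n = bqf_eval f (- b) (2 * a)"
    have "n = - a * \<Delta>" unfolding n_def fe d[symmetric] by (simp add: algebra_simps power2_eq_square)
    moreover have "\<Delta> > 0" using pos False by blast
    ultimately have n: "n > 0" using False a0 by (simp add: zero_less_mult_iff mult_less_0_iff)
    have "represents F n" unfolding f(2) represents_class_iff n_def by blast
    moreover have "n \<noteq> 0" using n by simp
    ultimately obtain e n0 b' c' where h: "n = e^2 * n0" "(n0, b', c') \<in> F"
      using represents_iff_leading[OF F] by blast
    have "n0 > 0" using h(1) n by (auto simp: zero_less_mult_iff)
    then show ?thesis using that h(2) by blast
  qed
qed

lemma \<Phi>_eq: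
  assumes F: "F \<in> carrier G" and f: "(a, b, c) \<in> F" and a: "a > 0"
  shows "\<Phi> \<Delta> F = narrow_class \<Delta> (lattice a b)"
  unfolding \<Phi>_def
proof (rule the_equality)
  have "(a, b, c) \<in> forms" using class_of_member[OF F f] by blast
  then have d: "b^2 - 4 * a * c = \<Delta>" by (simp add: bqf_forms_iff)
  show "\<exists>a' b' c'. (a', b', c') \<in> F \<and> a' > 0 \<and> narrow_class \<Delta> (lattice a b) =
      narrow_class \<Delta> (Idl\<^bsub>\<O>\<^esub> {of_int a', (of_int b' + sqrtD \<Delta>) / 2})"
    by (rule exI[of _ a], rule exI[of _ b], rule exI[of _ c]) (simp only: f a Idl_eq_lattice[OF d])
  fix C assume "\<exists>a b c. (a, b, c) \<in> F \<and> a > 0 \<and>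
      C = narrow_class \<Delta> (Idl\<^bsub>\<O>\<^esub> {of_int a, (of_int b + sqrtD \<Delta>) / 2})"
  then obtain a' b' c' where g: "(a', b', c') \<in> F" "a' > 0"
    and C: "C = narrow_class \<Delta> (Idl\<^bsub>\<O>\<^esub> {of_int a', (of_int b' + sqrtD \<Delta>) / 2})" by blast
  have g': "(a', b', c') \<in> forms" and Fe: "F = bqf_class (a', b', c')" using class_of_member[OF F g(1)] by blast+
  have d': "b'^2 - 4 * a' * c' = \<Delta>" using g' by (simp add: bqf_forms_iff)
  have "properly_equiv (a', b', c') (a, b, c)" using f unfolding Fe by (simp add: bqf_class_def)
  then show "C = narrow_class \<Delta> (lattice a b)"
    unfolding C Idl_eq_lattice[OF d'] by (rule equiv_imp_same_narrow_class[OF _ g' g(2) a])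
qed

lemma \<Phi>_inj: "inj_on (\<Phi> \<Delta>) (carrier G)"
proof (rule inj_onI)
  fix A B assume A: "A \<in> carrier G" and B: "B \<in> carrier G" and e: "\<Phi> \<Delta> A = \<Phi> \<Delta> B"
  obtain a b c where f: "(a, b, c) \<in> A" "a > 0" using class_positive_leading[OF A] by blast
  obtain a' b' c' where g: "(a', b', c') \<in> B" "a' > 0" using class_positive_leading[OF B] by blast
  have "narrow_class \<Delta> (lattice a b) = narrow_class \<Delta> (lattice a' b')"
    using e \<Phi>_eq[OF A f] \<Phi>_eq[OF B g] by simp
  then have "properly_equiv (a, b, c) (a', b', c')"
    using same_narrow_class_imp_equiv class_of_member(1)[OF A f(1)] class_of_member(1)[OF B g(1)] f(2) g(2) by blast
  then show "A = B" using class_of_member(2)[OF A f(1)] class_of_member(2)[OF B g(1)] bqf_class_eq_iff by blast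
qed

lemma \<Phi>_in_carrier:
  assumes F: "F \<in> carrier G"
  shows "\<Phi> \<Delta> F \<in> carrier (narrow_class_group \<Delta>)"
proof -
  obtain a b c where f: "(a, b, c) \<in> F" "a > 0" using class_positive_leading[OF F] by blast
  have "lattice a b \<in> carrier (ideal_group \<Delta>)"
    using lattice_invertible class_of_member(1)[OF F f(1)] by (simp add: ideal_group_def)
  then show ?thesis unfolding \<Phi>_eq[OF F f]
    by (auto simp: narrow_class_group_def FactGroup_def RCOSETS_def narrow_class_def)
qed

section \<open>Prime ideals above a rational prime\<close>

lemma half_int_norm: "even (u - s * v) \<Longrightarrow> \<exists>k. u^2 - \<Delta> * v^2 = 4 * k \<and> half_int u v * half_int u (- v) = of_int k"
proof -
  assume "even (u - s * v)"
  then obtain x where x: "u - s * v = 2 * x" by (elim evenE)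
  then have u: "u = 2 * x + s * v" by simp
  have e: "u^2 - \<Delta> * v^2 = 4 * (x^2 + s * x * v - D * v^2)"
  proof -
    have "u^2 = 4 * x^2 + 4 * s * x * v + (s * s) * v^2" unfolding u by (simp add: algebra_simps power2_eq_square)
    then show ?thesis unfolding s_D by (simp add: algebra_simps)
  qed
  have "half_int u v * half_int u (- v) = of_int (x^2 + s * x * v - D * v^2)"
    unfolding half_int_of_int
    by (rule half_int_mult) (use e in \<open>simp_all add: power2_eq_square algebra_simps\<close>)
  then show ?thesis using e by blast
qed

lemma int_in_prime_ideal:
  assumes "lies_above P p"
  shows "of_int k \<in> P \<longleftrightarrow> int p dvd k"
proof -
  have "(of_int k :: complex) \<in> P \<longleftrightarrow> (of_int k :: complex) \<in> range (\<lambda>j::int. of_nat p * of_int j)"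
    using assms unfolding lies_above_def by (metis Int_iff Ints_of_int)
  also have "\<dots> \<longleftrightarrow> (\<exists>j. (of_int k :: complex) = of_int (int p * j))" by auto
  also have "\<dots> \<longleftrightarrow> int p dvd k" by (simp only: of_int_eq_iff dvd_def)
  finally show ?thesis .
qed

text \<open>Dividing by \<open>v\<close> modulo \<open>p\<close> gives a square root of \<open>\<Delta>\<close> modulo \<open>p\<close>. For odd \<open>p\<close> its parity can be
  changed by adding \<open>p\<close>, which takes care of the factor 4; for \<open>p = 2\<close> the squares of odd numbers are 1
  modulo 8.\<close>

lemma root_of_norm_dvd:
  assumes p: "Factorial_Ring.prime p" and dv: "4 * int p dvd u^2 - \<Delta> * v^2" and nv: "\<not> int p dvd v"
  shows "\<exists>b. 4 * int p dvd b^2 - \<Delta>"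
proof (cases "p = 2")
  case True
  then have "odd v" using nv by simp
  then obtain t where v: "v = 2 * t + 1" by (elim oddE)
  have "even (t * (t + 1))" by simp
  then obtain k where "t * (t + 1) = 2 * k" by (elim evenE)
  then have "v^2 = 8 * k + 1" by (simp add: v power2_eq_square algebra_simps)
  then have "u^2 - \<Delta> = (u^2 - \<Delta> * v^2) + 8 * (\<Delta> * k)" by (simp add: algebra_simps)
  moreover have "8 dvd u^2 - \<Delta> * v^2" using dv True by simp
  then have "8 dvd (u^2 - \<Delta> * v^2) + 8 * (\<Delta> * k)" by (intro dvd_add dvd_triv_left)
  ultimately have "8 dvd u^2 - \<Delta>" by (simp only:)
  then show ?thesis using True by auto
next
  case False
  have pp: "Factorial_Ring.prime (int p)" using p by simp
  have odd: "odd p" using p False prime_odd_nat prime_ge_2_nat[OF p] by (metis le_neq_implies_less)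
  have "coprime (int p) v" using prime_imp_coprime[OF pp nv] .
  then obtain x w where xw: "x * int p + w * v = 1" using bezout_int[of "int p" v] by (auto simp: coprime_iff_gcd_eq_1)
  have "(u * w)^2 - \<Delta> = w^2 * (u^2 - \<Delta> * v^2) + \<Delta> * ((w * v - 1) * (w * v + 1))" by (simp add: algebra_simps power2_eq_square)
  moreover have "int p dvd w * v - 1" using xw by (metis dvd_minus_iff dvd_triv_right minus_diff_eq add_diff_cancel_right')
  moreover have "int p dvd u^2 - \<Delta> * v^2" using dv by (rule dvd_mult_right)
  ultimately have uw: "int p dvd (u * w)^2 - \<Delta>" by (simp add: dvd_add)
  define b where "b = (if even (u * w - s) then u * w else u * w + int p)"
  have "even (b - s)" using odd by (auto simp: b_def)
  then obtain k where "b - s = 2 * k" by (elim evenE)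
  then have "b = s + 2 * k" by simp
  then have "b^2 - \<Delta> = s * s + 4 * (s * k + k^2) - \<Delta>" by (simp add: algebra_simps power2_eq_square)
  then have "b^2 - \<Delta> = 4 * (s * k + k^2 - D)" unfolding s_D by simp
  then have 4: "4 dvd b^2 - \<Delta>" by simp
  have "int p dvd b^2 - \<Delta>"
  proof (cases "even (u * w - s)")
    case False
    have e: "(u * w + int p)^2 - \<Delta> = ((u * w)^2 - \<Delta>) + int p * (2 * (u * w) + int p)" by (simp add: algebra_simps power2_eq_square)
    have "int p dvd (u * w + int p)^2 - \<Delta>" unfolding e using uw by (intro dvd_add dvd_triv_left)
    then show ?thesis using False by (simp only: b_def if_False)
  qed (use uw in \<open>simp add: b_def\<close>)
  moreover have "coprime 4 (int p)"
  proof -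
    have "coprime (2 ^ 2) (int p)" using odd by (intro coprime_power_left_iff[THEN iffD2]) auto
    then show ?thesis by simp
  qed
  ultimately show ?thesis using 4 divides_mult by blast
qed

text \<open>The ideal contains one of the two elements \<open>(\<plusminus>b + \<surd>\<Delta>) / 2\<close>, because up to sign their product is the multiple
  \<open>(b\<^sup>2 - \<Delta>) / 4\<close> of \<open>p\<close>. Together with \<open>p\<close> this element spans a lattice of prime index in the order.\<close>

lemma prime_ideal_split:
  assumes P: "primeideal P \<O>" "lies_above P p" and b: "4 * int p dvd b^2 - \<Delta>"
  shows "\<exists>b'. 4 * int p dvd b'^2 - \<Delta> \<and> P = lattice (int p) b'"
proof -
  note id = primeideal.axioms(1)[OF P(1)]
  obtain c where "b^2 - \<Delta> = 4 * int p * c" using b by (elim dvdE)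
  then have d: "b^2 - 4 * int p * c = \<Delta>" by simp
  have par: "even (b - s)" using disc_parity[OF d] .
  have in_o: "half_int b 1 \<in> quad_order \<Delta>" "half_int b (- 1) \<in> quad_order \<Delta>" using par by (simp_all add: half_int_in_order)
  have "half_int b 1 * half_int b (- 1) = half_int (2 * (int p * c)) 0"
    by (rule half_int_mult) (use d in \<open>simp_all add: power2_eq_square algebra_simps\<close>)
  then have "half_int b 1 * half_int b (- 1) = of_int (int p * c)" by (simp add: half_int_of_int)
  moreover have "of_int (int p * c) \<in> P" using int_in_prime_ideal[OF P(2), of "int p * c"] by (simp only: dvd_triv_left)
  ultimately have "half_int b 1 \<in> P \<or> half_int b (- 1) \<in> P"
    using primeideal.I_prime[OF P(1), of "half_int b 1" "half_int b (- 1)"] in_o by simp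
  moreover have "half_int (- b) 1 = of_int (- 1) * half_int b (- 1)" by (simp only: half_int_scale) simp
  ultimately have "half_int b 1 \<in> P \<or> half_int (- b) 1 \<in> P"
    using ideal_int_mult[OF id, of "half_int b (- 1)" "- 1"] by auto
  moreover have "(- b)^2 = b^2" by simp
  ultimately obtain b' where b': "half_int b' 1 \<in> P" "b'^2 = b^2" by blast
  have d': "b'^2 - 4 * int p * c = \<Delta>" using d b'(2) by simp
  have pP: "of_int (int p) \<in> P" using int_in_prime_ideal[OF P(2), of "int p"] by (simp only: dvd_refl)
  have "lattice (int p) b' \<subseteq> P"
  proof
    fix z assume "z \<in> lattice (int p) b'"
    then obtain x y where z: "z = half_int (2 * int p * x + b' * y) y" by (auto simp: lattice_def)
    show "z \<in> P" unfolding z lattice_elt by (intro ideal_add[OF id] ideal_int_mult[OF id] b' pP)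
  qed
  moreover have "P \<subseteq> lattice (int p) b'"
  proof
    fix z assume z: "z \<in> P"
    have "z \<in> quad_order \<Delta>" using additive_subgroup.a_subset[OF ideal.axioms(1)[OF id]] z by auto
    then obtain u v where ze: "z = half_int (2 * u + s * v) v" by (auto simp: quad_order_eq lattice_def)
    obtain t where t: "b' - s = 2 * t" using disc_parity[OF d'] by (elim evenE)
    have "z + of_int (- v) * half_int b' 1 \<in> P" by (intro ideal_add[OF id] ideal_int_mult[OF id] b' z)
    moreover have "z + of_int (- v) * half_int b' 1 = of_int (u - t * v)"
    proof -
      have e: "2 * u + s * v + - v * b' = 2 * (u - t * v)" using t by (simp add: algebra_simps)
      have "z + of_int (- v) * half_int b' 1 = half_int (2 * u + s * v + - v * b') (v + - v * 1)"
        unfolding ze half_int_scale half_int_add ..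
      also have "\<dots> = of_int (u - t * v)" unfolding e half_int_of_int by simp
      finally show ?thesis .
    qed
    ultimately have "int p dvd u - t * v" using int_in_prime_ideal[OF P(2)] by metis
    then obtain k where "u - t * v = int p * k" by (elim dvdE)
    then have "2 * u + s * v = 2 * int p * k + b' * v" using t by (simp add: algebra_simps)
    then show "z \<in> lattice (int p) b'" unfolding ze lattice_def by auto
  qed
  moreover have "4 * int p dvd b'^2 - \<Delta>" using b b'(2) by simp
  ultimately show ?thesis by blast
qed

lemma inert_norm_dvd:
  assumes p: "Factorial_Ring.prime p" and ns: "\<nexists>b. 4 * int p dvd b^2 - \<Delta>"
    and z: "half_int (2 * u + s * v) v \<in> quad_order \<Delta>" and dv: "4 * int p dvd (2 * u + s * v)^2 - \<Delta> * v^2"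
  shows "int p dvd u \<and> int p dvd v"
proof -
  have v: "int p dvd v" using root_of_norm_dvd[OF p dv] ns by blast
  then obtain w where w: "v = int p * w" by (elim dvdE)
  have e: "(2 * u + s * v)^2 - \<Delta> * v^2 = 4 * (u^2 + s * u * v - D * v^2)"
  proof -
    have "(2 * u + s * v)^2 = 4 * u^2 + 4 * s * u * v + (s * s) * v^2" by (simp add: algebra_simps power2_eq_square)
    then show ?thesis unfolding s_D by (simp add: algebra_simps)
  qed
  have "int p dvd u^2 + s * u * v - D * v^2" using dv unfolding e by (rule dvd_mult_cancel_left[THEN iffD1, THEN disjE]) simp_all
  moreover have "u^2 + s * u * v - D * v^2 = u^2 + int p * (s * u * w - D * int p * w^2)"
    by (simp add: w algebra_simps power2_eq_square)
  ultimately have "int p dvd u^2" by (metis dvd_add_times_triv_right_iff mult.commute)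
  then show ?thesis using v p by (simp add: prime_dvd_power_iff)
qed

text \<open>A prime ideal above \<open>p\<close> contains the norms of its elements, so these norms are divisible by \<open>p\<close>; without a
  square root of \<open>\<Delta>\<close> modulo \<open>4 p\<close> the elements are then divisible by \<open>p\<close> themselves.\<close>

lemma prime_ideal_inert:
  assumes p: "Factorial_Ring.prime p" and P: "primeideal P \<O>" "lies_above P p"
    and ns: "\<nexists>b. 4 * int p dvd b^2 - \<Delta>"
  shows "P = (*) (of_nat p) ` quad_order \<Delta>"
proof
  note id = primeideal.axioms(1)[OF P(1)]
  have pP: "of_int (int p) \<in> P" using int_in_prime_ideal[OF P(2), of "int p"] by (simp only: dvd_refl)
  show "(*) (of_nat p) ` quad_order \<Delta> \<subseteq> P"
    using ideal.I_r_closed[OF id pP] by auto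
  show "P \<subseteq> (*) (of_nat p) ` quad_order \<Delta>"
  proof
    fix z assume z: "z \<in> P"
    have zo: "z \<in> quad_order \<Delta>" using additive_subgroup.a_subset[OF ideal.axioms(1)[OF id]] z by auto
    then obtain u v where ze: "z = half_int (2 * u + s * v) v" by (auto simp: quad_order_eq lattice_def)
    obtain k where k: "(2 * u + s * v)^2 - \<Delta> * v^2 = 4 * k" "half_int (2 * u + s * v) v * half_int (2 * u + s * v) (- v) = of_int k"
      using half_int_norm[of "2 * u + s * v" v] by auto
    have "half_int (2 * u + s * v) (- v) \<in> quad_order \<Delta>" by (simp add: half_int_in_order)
    then have "z * half_int (2 * u + s * v) (- v) \<in> P" using ideal.I_r_closed[OF id z] by simp
    then have "of_int k \<in> P" unfolding ze k(2) .
    then have "int p dvd k" using int_in_prime_ideal[OF P(2)] by blast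
    then have "int p dvd u \<and> int p dvd v" using k(1) by (intro inert_norm_dvd[OF p ns zo[unfolded ze]]) simp
    then obtain u' v' where "u = int p * u'" "v = int p * v'" by (auto elim!: dvdE)
    then have "z = of_int (int p) * half_int (2 * u' + s * v') v'" unfolding ze half_int_scale by (simp add: algebra_simps)
    moreover have "half_int (2 * u' + s * v') v' \<in> quad_order \<Delta>" by (simp add: half_int_in_order)
    ultimately show "z \<in> (*) (of_nat p) ` quad_order \<Delta>" by auto
  qed
qed

end

section \<open>Residue fields\<close>

locale prime_above = quadratic_discriminant +
  fixes P :: "complex set" and p :: nat
  assumes prime_P: "primeideal P \<O>" and above: "lies_above P p"
    and prime_p: "Factorial_Ring.prime p"
begin

definition k where "k = \<O> Quot P"
definition \<pi> where "\<pi> x = P +>\<^bsub>\<O>\<^esub> x"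
definition k0 where "k0 = range (\<lambda>n::int. \<pi> (of_int n))"

sublocale Pi: primeideal P \<O> by (rule prime_P)
sublocale kr: cring k unfolding k_def by (rule Pi.quotient_is_cring[OF quad_order_cring])

lemma P_add: "x \<in> P \<Longrightarrow> y \<in> P \<Longrightarrow> x + y \<in> P"
  by (rule ideal_add[OF Pi.is_ideal])

lemma P_int: "of_int n \<in> P \<longleftrightarrow> int p dvd n"
  by (rule int_in_prime_ideal[OF above])

lemma P_minus: "x \<in> P \<Longrightarrow> - x \<in> P"
  using ideal_int_mult[OF Pi.is_ideal, of x "- 1"] by simp

lemma P_zero: "0 \<in> P"
  using P_int[of 0] by simp

lemma \<pi>_set: "\<pi> x = (\<lambda>h. h + x) ` P"
  by (auto simp: \<pi>_def a_r_coset_def')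

lemma \<pi>_eq_iff: "\<pi> x = \<pi> y \<longleftrightarrow> x - y \<in> P"
proof
  assume "\<pi> x = \<pi> y"
  moreover have "x \<in> \<pi> x" unfolding \<pi>_set using P_zero by force
  ultimately have "x \<in> (\<lambda>h. h + y) ` P" by (simp add: \<pi>_set)
  then show "x - y \<in> P" by auto
next
  assume d: "x - y \<in> P"
  have "h + x \<in> \<pi> y" if "h \<in> P" for h
    unfolding \<pi>_set using P_add[OF that d] by (intro image_eqI[of _ _ "h + (x - y)"]) auto
  moreover have "h + y \<in> \<pi> x" if "h \<in> P" for h
    unfolding \<pi>_set using P_add[OF that P_minus[OF d]] by (intro image_eqI[of _ _ "h + - (x - y)"]) auto
  ultimately show "\<pi> x = \<pi> y" unfolding \<pi>_set by blast
qed

lemma \<pi>_hom: "\<pi> \<in> ring_hom \<O> k"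
proof -
  have "\<pi> = (+>\<^bsub>\<O>\<^esub>) P" by (rule ext) (simp add: \<pi>_def)
  then show ?thesis unfolding k_def using Pi.rcos_ring_hom by simp
qed

lemma \<pi>_simps:
  "x \<in> quad_order \<Delta> \<Longrightarrow> \<pi> x \<in> carrier k"
  "x \<in> quad_order \<Delta> \<Longrightarrow> y \<in> quad_order \<Delta> \<Longrightarrow> \<pi> x \<otimes>\<^bsub>k\<^esub> \<pi> y = \<pi> (x * y)"
  "x \<in> quad_order \<Delta> \<Longrightarrow> y \<in> quad_order \<Delta> \<Longrightarrow> \<pi> x \<oplus>\<^bsub>k\<^esub> \<pi> y = \<pi> (x + y)"
  "\<one>\<^bsub>k\<^esub> = \<pi> 1"
  using \<pi>_hom by (auto simp: ring_hom_def)

lemma k_zero: "\<zero>\<^bsub>k\<^esub> = \<pi> 0"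
  by (simp add: k_def FactRing_def \<pi>_set)

lemma carrier_k: "carrier k = \<pi> ` quad_order \<Delta>"
  by (auto simp: k_def FactRing_def A_RCOSETS_def' \<pi>_def)

lemma k0_subset: "k0 \<subseteq> carrier k"
  unfolding k0_def carrier_k using order_of_int by auto

text \<open>The image of \<open>\<int>\<close> is the field with \<open>p\<close> elements: inverses come from Bezout's identity. That it is a
  subfield makes dimensions over it unique.\<close>

lemma k0_subfield: "subfield k0 k"
proof (rule kr.subfieldI)
  have neg: "\<ominus>\<^bsub>k\<^esub> \<pi> (of_int n) = \<pi> (of_int (- n))" for n
    by (rule kr.minus_equality) (use order_of_int[of n] order_of_int[of "- n"] in \<open>auto simp: \<pi>_simps k_zero\<close>)
  have "subring k0 k"
  proof (rule kr.subringI[OF k0_subset])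
    show "\<one>\<^bsub>k\<^esub> \<in> k0" unfolding \<pi>_simps(4) k0_def by (rule range_eqI[of _ _ 1]) simp
    fix h assume "h \<in> k0"
    then obtain i where i: "h = \<pi> (of_int i)" by (auto simp: k0_def)
    show "\<ominus>\<^bsub>k\<^esub> h \<in> k0" unfolding i neg k0_def by blast
    fix h' assume "h' \<in> k0"
    then obtain j where j: "h' = \<pi> (of_int j)" by (auto simp: k0_def)
    have "h \<otimes>\<^bsub>k\<^esub> h' = \<pi> (of_int (i * j))" "h \<oplus>\<^bsub>k\<^esub> h' = \<pi> (of_int (i + j))"
      unfolding i j by (simp_all add: \<pi>_simps order_of_int)
    then show "h \<otimes>\<^bsub>k\<^esub> h' \<in> k0" "h \<oplus>\<^bsub>k\<^esub> h' \<in> k0" unfolding k0_def by blast+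
  qed
  then show "subcring k0 k" by (rule kr.subcringI')
  show "Units (k\<lparr>carrier := k0\<rparr>) = k0 - {\<zero>\<^bsub>k\<^esub>}"
  proof (intro equalityI subsetI)
    fix h assume "h \<in> Units (k\<lparr>carrier := k0\<rparr>)"
    then obtain h' where h: "h \<in> k0" "h' \<in> k0" "h' \<otimes>\<^bsub>k\<^esub> h = \<one>\<^bsub>k\<^esub>" by (auto simp: Units_def)
    have "h \<noteq> \<zero>\<^bsub>k\<^esub>"
    proof
      assume "h = \<zero>\<^bsub>k\<^esub>"
      then have "\<one>\<^bsub>k\<^esub> = \<zero>\<^bsub>k\<^esub>" using h k0_subset by auto
      then have "of_int 1 \<in> P" unfolding \<pi>_simps(4) k_zero \<pi>_eq_iff by simp
      then show False unfolding P_int using prime_p by (simp add: prime_ge_1_nat)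
    qed
    then show "h \<in> k0 - {\<zero>\<^bsub>k\<^esub>}" using h by simp
  next
    fix h assume h: "h \<in> k0 - {\<zero>\<^bsub>k\<^esub>}"
    then obtain i where i: "h = \<pi> (of_int i)" by (auto simp: k0_def)
    have "\<pi> (of_int i) \<noteq> \<pi> 0" using h i k_zero by simp
    then have "of_int i \<notin> P" unfolding \<pi>_eq_iff by simp
    then have "\<not> int p dvd i" unfolding P_int .
    then have "coprime (int p) i" using prime_p prime_imp_coprime[of "int p" i] by simp
    then obtain x w where xw: "x * int p + w * i = 1" using bezout_int[of "int p" i] by (auto simp: coprime_iff_gcd_eq_1)
    have "of_int (w * i) - of_int 1 \<in> P"
    proof -
      have "w * i - 1 = - x * int p" using xw by simp
      then have "int p dvd w * i - 1" by simp
      then show ?thesis unfolding of_int_diff[symmetric] P_int .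
    qed
    then have e: "\<pi> (of_int (w * i)) = \<one>\<^bsub>k\<^esub>" unfolding \<pi>_simps(4) \<pi>_eq_iff by simp
    have "\<pi> (of_int w) \<otimes>\<^bsub>k\<^esub> h = \<one>\<^bsub>k\<^esub>" "h \<otimes>\<^bsub>k\<^esub> \<pi> (of_int w) = \<one>\<^bsub>k\<^esub>"
      unfolding i using e by (simp_all add: \<pi>_simps order_of_int mult.commute)
    moreover have "\<pi> (of_int w) \<in> k0" by (simp add: k0_def)
    ultimately show "h \<in> Units (k\<lparr>carrier := k0\<rparr>)" using h unfolding Units_def by auto
  qed
qed

text \<open>The ideal contains an element \<open>(b + \<surd>\<Delta>) / 2\<close>, so modulo the ideal the generator of the order is an integer.\<close>

lemma residue_dimension_split:
  assumes b: "4 * int p dvd b^2 - \<Delta>"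
  shows "kr.dimension 1 k0 (carrier k)"
proof -
  obtain b' where b': "4 * int p dvd b'^2 - \<Delta>" and P: "P = lattice (int p) b'"
    using prime_ideal_split[OF prime_P above b] by blast
  obtain c where "b'^2 - \<Delta> = 4 * int p * c" using b' by (elim dvdE)
  then have d: "b'^2 - 4 * int p * c = \<Delta>" by simp
  obtain t where t: "b' - s = 2 * t" using disc_parity[OF d] by (elim evenE)
  have "\<pi> z \<in> k0" if z: "z \<in> quad_order \<Delta>" for z
  proof -
    obtain u v where ze: "z = half_int (2 * u + s * v) v" using z by (auto simp: quad_order_eq lattice_def)
    have e: "2 * (u - t * v) + v * b' = 2 * u + s * v" using t by (simp add: algebra_simps)
    have "z = of_int (u - t * v) + of_int v * half_int b' 1"
      unfolding ze half_int_of_int[of "u - t * v"] half_int_scale half_int_add e by simp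
    then have "z - of_int (u - t * v) = of_int v * half_int b' 1" by simp
    moreover have "of_int v * half_int b' 1 \<in> P" unfolding P by (rule lattice_scale[OF lattice_gens(2)])
    ultimately have "\<pi> z = \<pi> (of_int (u - t * v))" unfolding \<pi>_eq_iff by simp
    then show ?thesis unfolding k0_def by blast
  qed
  then have "carrier k = k0" using k0_subset unfolding carrier_k by blast
  then show ?thesis using kr.dimension_one[OF k0_subfield] by simp
qed

text \<open>Since the ideal consists of the multiples of \<open>p\<close>, the residues of 1 and of the generator of the order are
  linearly independent.\<close>

lemma residue_dimension_inert:
  assumes ns: "\<nexists>b. 4 * int p dvd b^2 - \<Delta>"
  shows "kr.dimension 2 k0 (carrier k)"
proof -
  have P: "P = (*) (of_nat p) ` quad_order \<Delta>" by (rule prime_ideal_inert[OF prime_p prime_P above ns])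
  define w where "w = half_int s 1"
  have w: "w \<in> quad_order \<Delta>" by (simp add: w_def half_int_in_order)
  have elt: "half_int (2 * u + s * v) v = of_int u + of_int v * w" for u v
    unfolding w_def half_int_of_int[of u] half_int_scale half_int_add by (simp add: mult.commute)
  have "\<pi> w \<notin> k0"
  proof
    assume "\<pi> w \<in> k0"
    then obtain n where "\<pi> w = \<pi> (of_int n)" by (auto simp: k0_def)
    then have "w - of_int n \<in> P" unfolding \<pi>_eq_iff .
    then obtain z where z: "z \<in> quad_order \<Delta>" "w - of_int n = of_nat p * z" unfolding P by blast
    obtain u v where ze: "z = half_int (2 * u + s * v) v" using z(1) by (auto simp: quad_order_eq lattice_def)
    have "w - of_int n = half_int (s - 2 * n) 1" unfolding w_def by (simp add: half_int_def field_simps)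
    moreover have "of_nat p * z = half_int (int p * (2 * u + s * v)) (int p * v)"
      unfolding ze using half_int_scale[of "int p"] by simp
    ultimately have "int p * v = 1" using z(2) by (simp add: half_int_eq_iff)
    then show False using prime_p by (auto simp: zmult_eq_1_iff)
  qed
  then have "kr.dimension (Suc 1) k0 (kr.line_extension k0 (\<pi> w) k0)"
    by (intro kr.Suc_dim kr.dimension_one[OF k0_subfield] \<pi>_simps(1) w)
  moreover have "kr.line_extension k0 (\<pi> w) k0 = carrier k"
  proof -
    have "kr.line_extension k0 (\<pi> w) k0 = {(h \<otimes>\<^bsub>k\<^esub> \<pi> w) \<oplus>\<^bsub>k\<^esub> h' | h h'. h \<in> k0 \<and> h' \<in> k0}"
      unfolding kr.line_extension_def set_add_def' r_coset_def by auto
    also have "\<dots> = {\<pi> (of_int v * w + of_int u) | u v. True}"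
    proof -
      have e: "(\<pi> (of_int v) \<otimes>\<^bsub>k\<^esub> \<pi> w) \<oplus>\<^bsub>k\<^esub> \<pi> (of_int u) = \<pi> (of_int v * w + of_int u)" for u v
        by (simp add: \<pi>_simps order_of_int w order_mult)
      show ?thesis
      proof (intro equalityI subsetI)
        fix y assume "y \<in> {(h \<otimes>\<^bsub>k\<^esub> \<pi> w) \<oplus>\<^bsub>k\<^esub> h' | h h'. h \<in> k0 \<and> h' \<in> k0}"
        then obtain u v where "y = (\<pi> (of_int v) \<otimes>\<^bsub>k\<^esub> \<pi> w) \<oplus>\<^bsub>k\<^esub> \<pi> (of_int u)" by (auto simp: k0_def)
        then show "y \<in> {\<pi> (of_int v * w + of_int u) | u v. True}" unfolding e by blast
      next
        fix y assume "y \<in> {\<pi> (of_int v * w + of_int u) | u v. True}"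
        then obtain u v where "y = (\<pi> (of_int v) \<otimes>\<^bsub>k\<^esub> \<pi> w) \<oplus>\<^bsub>k\<^esub> \<pi> (of_int u)" unfolding e by blast
        moreover have "\<pi> (of_int v) \<in> k0" "\<pi> (of_int u) \<in> k0" by (simp_all add: k0_def)
        ultimately show "y \<in> {(h \<otimes>\<^bsub>k\<^esub> \<pi> w) \<oplus>\<^bsub>k\<^esub> h' | h h'. h \<in> k0 \<and> h' \<in> k0}" by blast
      qed
    qed
    also have "\<dots> = carrier k"
      unfolding carrier_k quad_order_eq lattice_def using elt by (auto simp: add.commute image_iff) 
    finally show ?thesis .
  qed
  ultimately show ?thesis by (simp add: numeral_2_eq_2)
qed

lemma residue_dimension_iff:
  "ring.dimension k f (range (\<lambda>n::int. P +>\<^bsub>\<O>\<^esub> of_int n)) (carrier k) \<longleftrightarrow>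
     f = (if \<exists>b. 4 * int p dvd b^2 - \<Delta> then 1 else 2)"
proof -
  have k0: "range (\<lambda>n::int. P +>\<^bsub>\<O>\<^esub> of_int n) = k0" by (simp add: k0_def \<pi>_def)
  have "kr.dimension (if \<exists>b. 4 * int p dvd b^2 - \<Delta> then 1 else 2) k0 (carrier k)"
    using residue_dimension_split residue_dimension_inert by auto
  then show ?thesis unfolding k0 using kr.dimension_is_inj[OF k0_subfield] by blast
qed

end

context quadratic_discriminant
begin

lemma lies_aboveI:
  assumes "\<And>n. of_int n \<in> P \<longleftrightarrow> int p dvd n"
  shows "lies_above P p"
  unfolding lies_above_def
proof (intro equalityI subsetI)
  fix x assume x: "x \<in> P \<inter> \<int>"
  then obtain n where n: "x = of_int n" by (auto elim: Ints_cases)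
  then obtain j where "n = int p * j" using assms x by (auto elim!: dvdE)
  then show "x \<in> range (\<lambda>k::int. of_nat p * of_int k)" by (intro range_eqI[of _ _ j]) (simp add: n)
next
  fix x assume "x \<in> range (\<lambda>k::int. of_nat p * of_int k :: complex)"
  then obtain j where x: "x = of_int (int p * j)" by auto
  show "x \<in> P \<inter> \<int>" unfolding x Int_iff assms by simp
qed

text \<open>The lattice is the kernel of the ring homomorphism to \<open>\<int>/p\<close> that sends the generator of the order to a root
  of its minimal polynomial modulo \<open>p\<close>; in coordinates this homomorphism is \<open>u - t v\<close>.\<close>

lemma split_prime_ideal_exists:
  assumes p: "Factorial_Ring.prime p" and b: "4 * int p dvd b^2 - \<Delta>"
  shows "primeideal (lattice (int p) b) \<O> \<and> lies_above (lattice (int p) b) p"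
proof -
  obtain c where "b^2 - \<Delta> = 4 * int p * c" using b by (elim dvdE)
  then have d: "b^2 - 4 * int p * c = \<Delta>" by simp
  obtain t where t: "b - s = 2 * t" using disc_parity[OF d] by (elim evenE)
  have pp: "Factorial_Ring.prime (int p)" using p by simp
  have mem: "half_int (2 * u + s * v) v \<in> lattice (int p) b \<longleftrightarrow> int p dvd u - t * v" for u v
  proof
    assume "half_int (2 * u + s * v) v \<in> lattice (int p) b"
    then obtain x where "2 * u + s * v = 2 * int p * x + b * v" by (auto simp: lattice_def half_int_eq_iff)
    then have "2 * (u - t * v) = 2 * (int p * x)" using t by (simp add: algebra_simps)
    moreover have "A = B" if "2 * A = 2 * B" for A B :: int using that by simp
    ultimately have "u - t * v = int p * x" by blast
    then show "int p dvd u - t * v" by simp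
  next
    assume "int p dvd u - t * v"
    then obtain x where "u - t * v = int p * x" by (elim dvdE)
    then have e: "2 * u + s * v = 2 * int p * x + b * v" using t by (simp add: algebra_simps)
    show "half_int (2 * u + s * v) v \<in> lattice (int p) b" unfolding e lattice_def by blast
  qed
  have above: "lies_above (lattice (int p) b) p"
  proof -
    have "(of_int n :: complex) \<in> lattice (int p) b \<longleftrightarrow> int p dvd n" for n
      using mem[of n 0] by (simp add: half_int_of_int)
    then show ?thesis by (rule lies_aboveI)
  qed
  have "primeideal (lattice (int p) b) \<O>"
  proof (rule primeidealI[OF lattice_ideal[OF d] quad_order_cring])
    have "1 \<notin> lattice (int p) b" using mem[of 1 0] prime_ge_2_nat[OF p] by (simp add: half_int_def)
    then show "carrier \<O> \<noteq> lattice (int p) b" using order_one by auto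
    fix z z' assume "z \<in> carrier \<O>" "z' \<in> carrier \<O>"
      and pr: "z \<otimes>\<^bsub>\<O>\<^esub> z' \<in> lattice (int p) b"
    then obtain u v u' v' where z: "z = half_int (2 * u + s * v) v" and z': "z' = half_int (2 * u' + s * v') v'"
      by (auto simp: quad_order_eq lattice_def)
    have De: "\<Delta> = 4 * D + s * s" using s_D by simp
    have zz': "z * z' = half_int (2 * (u * u' + D * v * v') + s * (u * v' + u' * v + s * v * v')) (u * v' + u' * v + s * v * v')"
      unfolding z z' by (rule half_int_mult) (use arg_cong[OF s_D, of "\<lambda>q. q * (v * v')"] in \<open>simp_all add: algebra_simps\<close>)
    have "int p dvd (u * u' + D * v * v') - t * (u * v' + u' * v + s * v * v')"
      using pr unfolding ring_on_simps zz' mem .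
    moreover have "(u - t * v) * (u' - t * v') = ((u * u' + D * v * v') - t * (u * v' + u' * v + s * v * v')) + (t * t + s * t - D) * (v * v')"
      by (simp add: algebra_simps)
    moreover have "t * t + s * t - D = int p * c"
    proof -
      have bt: "b = s + 2 * t" using t by simp
      have "4 * (t * t + s * t - D) = b * b - \<Delta>" unfolding bt using s_D by (simp add: algebra_simps)
      also have "\<dots> = 4 * (int p * c)" using d by (simp add: power2_eq_square)
      finally show ?thesis by simp
    qed
    ultimately have "int p dvd (u - t * v) * (u' - t * v')" by simp
    then show "z \<in> lattice (int p) b \<or> z' \<in> lattice (int p) b"
      unfolding z z' mem using prime_dvd_mult_iff[OF pp] by blast
  qed
  then show ?thesis using above by blast
qed

text \<open>Without a root modulo \<open>p\<close>, an element whose norm is divisible by \<open>p\<close> is itself divisible by \<open>p\<close>, and norms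
  are multiplicative.\<close>

lemma inert_prime_ideal_exists:
  assumes p: "Factorial_Ring.prime p" and ns: "\<nexists>b. 4 * int p dvd b^2 - \<Delta>"
  shows "primeideal ((*) (of_nat p) ` quad_order \<Delta>) \<O> \<and> lies_above ((*) (of_nat p) ` quad_order \<Delta>) p"
proof -
  let ?P = "(*) (of_nat p) ` quad_order \<Delta>"
  have pp: "Factorial_Ring.prime (int p)" using p by simp
  have mem: "half_int (2 * u + s * v) v \<in> ?P \<longleftrightarrow> int p dvd u \<and> int p dvd v" for u v
  proof
    assume "half_int (2 * u + s * v) v \<in> ?P"
    then obtain x y where "half_int (2 * u + s * v) v = of_nat p * half_int (2 * x + s * y) y"
      by (auto simp: quad_order_eq lattice_def)
    then have "half_int (2 * u + s * v) v = half_int (int p * (2 * x + s * y)) (int p * y)"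
      using half_int_scale[of "int p"] by simp
    then have v: "v = int p * y" and u: "2 * u + s * v = int p * (2 * x + s * y)"
      unfolding half_int_eq_iff by blast+
    have "2 * u = 2 * (int p * x)" using u unfolding v by (simp add: algebra_simps)
    then show "int p dvd u \<and> int p dvd v" using v by simp
  next
    assume "int p dvd u \<and> int p dvd v"
    then obtain x y where "u = int p * x" "v = int p * y" by (auto elim!: dvdE)
    then have "half_int (2 * u + s * v) v = of_int (int p) * half_int (2 * x + s * y) y"
      unfolding half_int_scale by (simp add: algebra_simps)
    then show "half_int (2 * u + s * v) v \<in> ?P" by (auto simp: half_int_in_order)
  qed
  have above: "lies_above ?P p"
  proof -
    have "(of_int n :: complex) \<in> ?P \<longleftrightarrow> int p dvd n" for n
      using mem[of n 0] by (simp add: half_int_of_int)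
    then show ?thesis by (rule lies_aboveI)
  qed
  have id: "ideal ?P \<O>"
  proof (rule ideal_ring_onI[OF quad_order_cring])
    show "?P \<subseteq> quad_order \<Delta>" using order_mult[OF order_of_int[of "int p"]] by auto
    show "0 \<in> ?P" using order_of_int[of 0] by (intro image_eqI[of _ _ 0]) auto
    show "x + y \<in> ?P" if xy: "x \<in> ?P" "y \<in> ?P" for x y
    proof -
      obtain x' y' where h: "x = of_nat p * x'" "y = of_nat p * y'" "x' \<in> quad_order \<Delta>" "y' \<in> quad_order \<Delta>" using xy by blast
      have "x + y = of_nat p * (x' + y')" unfolding h by (simp add: distrib_left)
      moreover have "x' + y' \<in> quad_order \<Delta>" using h lattice_add by (simp add: quad_order_eq)
      ultimately show ?thesis by blast
    qed
    show "w * x \<in> ?P" if wx: "w \<in> quad_order \<Delta>" "x \<in> ?P" for w x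
    proof -
      obtain x' where h: "x = of_nat p * x'" "x' \<in> quad_order \<Delta>" using wx by blast
      have "w * x = of_nat p * (w * x')" unfolding h by simp
      then show ?thesis using order_mult[OF wx(1) h(2)] by blast
    qed
  qed
  have "primeideal ?P \<O>"
  proof (rule primeidealI[OF id quad_order_cring])
    have "1 \<notin> ?P" using mem[of 1 0] prime_ge_2_nat[OF p] by (simp add: half_int_def)
    then show "carrier \<O> \<noteq> ?P" using order_one by auto
    fix z z' assume zz: "z \<in> carrier \<O>" "z' \<in> carrier \<O>"
      and pr: "z \<otimes>\<^bsub>\<O>\<^esub> z' \<in> ?P"
    then obtain u v u' v' where z: "z = half_int (2 * u + s * v) v" and z': "z' = half_int (2 * u' + s * v') v'"
      by (auto simp: quad_order_eq lattice_def)
    obtain n where n: "(2 * u + s * v)^2 - \<Delta> * v^2 = 4 * n" "z * half_int (2 * u + s * v) (- v) = of_int n"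
      using half_int_norm[of "2 * u + s * v" v] unfolding z by auto
    obtain n' where n': "(2 * u' + s * v')^2 - \<Delta> * v'^2 = 4 * n'" "z' * half_int (2 * u' + s * v') (- v') = of_int n'"
      using half_int_norm[of "2 * u' + s * v'" v'] unfolding z' by auto
    have "of_int (n * n') = (half_int (2 * u + s * v) (- v) * half_int (2 * u' + s * v') (- v')) * (z * z')"
      unfolding of_int_mult n(2)[symmetric] n'(2)[symmetric] by (simp add: mult_ac)
    moreover have "half_int (2 * u + s * v) (- v) * half_int (2 * u' + s * v') (- v') \<in> quad_order \<Delta>"
      by (intro order_mult) (simp_all add: half_int_in_order)
    ultimately have "of_int (n * n') \<in> ?P" using ideal.I_l_closed[OF id pr] by simp
    then have "int p dvd n * n'" by (rule int_in_prime_ideal[OF above, THEN iffD1])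
    then have "int p dvd n \<or> int p dvd n'" using prime_dvd_mult_iff[OF pp] by blast
    then show "z \<in> ?P \<or> z' \<in> ?P"
    proof
      assume "int p dvd n"
      then have "int p dvd u \<and> int p dvd v" using zz(1) n(1) z by (intro inert_norm_dvd[OF p ns]) auto
      then show ?thesis unfolding z mem by blast
    next
      assume "int p dvd n'"
      then have "int p dvd u' \<and> int p dvd v'" using zz(2) n'(1) z' by (intro inert_norm_dvd[OF p ns]) auto
      then show ?thesis unfolding z' mem by blast
    qed
  qed
  then show ?thesis using above by blast
qed

text \<open>Existence of a prime ideal above \<open>p\<close> and independence of the choice are both needed for the definite description
  to denote the expected number.\<close>

lemma residue_degree_eq:
  assumes p: "Factorial_Ring.prime p"
  shows "(THE f. \<exists>P. let R = \<O>; k = R Quot P in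
        primeideal P R \<and> lies_above P p \<and>
        ring.dimension k f (range (\<lambda>n::int. P +>\<^bsub>R\<^esub> of_int n)) (carrier k)) =
     (if \<exists>b. 4 * int p dvd b^2 - \<Delta> then 1 else 2)" (is "_ = ?f")
proof (rule the_equality)
  have dim: "ring.dimension (\<O> Quot P) f (range (\<lambda>n::int. P +>\<^bsub>\<O>\<^esub> of_int n))
      (carrier (\<O> Quot P)) \<longleftrightarrow> f = ?f"
    if "primeideal P \<O>" "lies_above P p" for P f
  proof -
    interpret prime_above \<Delta> P p using that p
      by (intro prime_above.intro[OF quadratic_discriminant_axioms] prime_above_axioms.intro)
    show ?thesis using residue_dimension_iff unfolding k_def .
  qed
  show "\<exists>P. let R = \<O>; k = R Quot P in
        primeideal P R \<and> lies_above P p \<and>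
        ring.dimension k ?f (range (\<lambda>n::int. P +>\<^bsub>R\<^esub> of_int n)) (carrier k)"
    unfolding Let_def using split_prime_ideal_exists[OF p] inert_prime_ideal_exists[OF p] dim by blast
  fix f assume "\<exists>P. let R = \<O>; k = R Quot P in
        primeideal P R \<and> lies_above P p \<and>
        ring.dimension k f (range (\<lambda>n::int. P +>\<^bsub>R\<^esub> of_int n)) (carrier k)"
  then show "f = ?f" unfolding Let_def using dim by blast
qed

end

section \<open>The maximal order and the discriminant of the field\<close>

text \<open>Every power of the denominator would divide \<open>d\<close>.\<close>

lemma rat_int_if_powers_bounded:
  fixes q :: rat and d :: int
  assumes d: "d \<noteq> 0" and powers: "\<And>k. \<exists>j. of_int d * q ^ k = of_int j"
  shows "q \<in> \<int>"
proof -
  obtain u v where uv: "quotient_of q = (u, v)" by (cases "quotient_of q")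
  have v: "v > 0" "coprime u v" "q = of_int u / of_int v"
    using uv quotient_of_denom_pos quotient_of_coprime quotient_of_div by auto
  have dv: "v ^ k dvd d" for k
  proof -
    obtain j where j: "of_int d * q ^ k = of_int j" using powers by blast
    have "(of_int (d * u ^ k) :: rat) = of_int (j * v ^ k)"
      using j v(1) by (simp add: v(3) power_divide field_simps)
    then have "d * u ^ k = j * v ^ k" by (simp only: of_int_eq_iff)
    then have "v ^ k dvd d * u ^ k" by simp
    moreover have "coprime (v ^ k) (u ^ k)" using v(2) by (simp add: coprime_commute)
    ultimately show ?thesis by (simp add: coprime_dvd_mult_left_iff)
  qed
  have "v = 1"
  proof (rule ccontr)
    assume "v \<noteq> 1"
    then have v2: "v \<ge> 2" using v(1) by simp
    define k where "k = nat \<bar>d\<bar>"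
    have "v ^ k \<le> \<bar>d\<bar>" using dvd_imp_le_int[OF d dv[of k]] v(1) by simp
    also have "\<bar>d\<bar> = int k" by (simp add: k_def)
    also have "int k < 2 ^ k" using of_nat_less_two_power[of k] by simp
    also have "(2::int) ^ k \<le> v ^ k" using v2 by (intro power_mono) auto
    finally show False by simp
  qed
  then show ?thesis using v(3) by simp
qed

context quadratic_discriminant
begin

definition int_elts :: "complex set" where "int_elts = {K_elt (of_int a) (of_int b) | a b. True}"

lemma int_elts_closed:
  "z \<in> int_elts \<Longrightarrow> w \<in> int_elts \<Longrightarrow> z + w \<in> int_elts"
  "z \<in> int_elts \<Longrightarrow> w \<in> int_elts \<Longrightarrow> z * w \<in> int_elts"
  "of_int n \<in> int_elts"
proof -
  assume "z \<in> int_elts" "w \<in> int_elts"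
  then obtain a b c d where zw: "z = K_elt (of_int a) (of_int b)" "w = K_elt (of_int c) (of_int d)" by (auto simp: int_elts_def)
  have "z + w = K_elt (of_int (a + c)) (of_int (b + d))" unfolding zw K_elt_add by simp
  then show "z + w \<in> int_elts" unfolding int_elts_def by blast
  have "z * w = K_elt (of_int (a * c + \<Delta> * b * d)) (of_int (a * d + b * c))" unfolding zw K_elt_mult by simp
  then show "z * w \<in> int_elts" unfolding int_elts_def by blast
next
  have "of_int n = K_elt (of_int n) (of_int 0)" by (simp add: K_elt_of_int(1))
  then show "of_int n \<in> int_elts" unfolding int_elts_def by blast
qed

lemma int_elts_sum: "(\<And>i. i \<in> A \<Longrightarrow> f i \<in> int_elts) \<Longrightarrow> sum f A \<in> int_elts"
  using int_elts_closed(3)[of 0] by (induction A rule: infinite_finite_induct) (auto intro: int_elts_closed)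

lemma int_elts_power: "z \<in> int_elts \<Longrightarrow> z ^ n \<in> int_elts"
  using int_elts_closed(3)[of 1] by (induction n) (auto intro: int_elts_closed)

lemma K_elt_power: "\<exists>a b. K_elt x y ^ n = K_elt a b \<and> (x^2 - of_int \<Delta> * y^2) ^ n = a^2 - of_int \<Delta> * b^2"
proof (induction n)
  case 0
  show ?case by (rule exI[of _ 1], rule exI[of _ 0]) (simp add: K_elt_of_int(4))
next
  case (Suc n)
  then obtain a b where ab: "K_elt x y ^ n = K_elt a b" "(x^2 - of_int \<Delta> * y^2) ^ n = a^2 - of_int \<Delta> * b^2" by blast
  have "K_elt x y ^ Suc n = K_elt (x * a + of_int \<Delta> * y * b) (x * b + y * a)" using ab(1) by (simp add: K_elt_mult)
  moreover have "(x^2 - of_int \<Delta> * y^2) ^ Suc n = (x * a + of_int \<Delta> * y * b)^2 - of_int \<Delta> * (x * b + y * a)^2"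
    unfolding power_Suc ab(2) by (simp add: algebra_simps power2_eq_square)
  ultimately show ?case by blast
qed

text \<open>The powers of an algebraic integer have bounded denominators: if \<open>c * z\<close> has integral coordinates
  and \<open>z\<close> is a root of a monic polynomial of degree \<open>n\<close>, then \<open>c\<^sup>n\<close> clears the denominators of
  every power of \<open>z\<close>. By the binomial theorem it does so for \<open>z + 1\<close> too.\<close>

lemma algebraic_int_powers_bounded:
  assumes "algebraic_int (K_elt x y)"
  shows "\<exists>d. d \<noteq> 0 \<and> (\<forall>k. of_int d * K_elt x y ^ k \<in> int_elts \<and> of_int d * (K_elt x y + 1) ^ k \<in> int_elts)"
proof -
  define z where "z = K_elt x y"
  obtain p where p: "poly (map_poly of_int p) z = 0" "Polynomial.coeff p (Polynomial.degree p) = (1 :: int)"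
    using assms unfolding algebraic_int_altdef_ipoly z_def by blast
  define n where "n = Polynomial.degree p"
  have deg: "Polynomial.degree (map_poly of_int p :: complex poly) = n" unfolding n_def by (rule degree_map_poly) simp
  have "(\<Sum>i\<le>n. of_int (Polynomial.coeff p i) * z ^ i) = 0"
    using p(1) unfolding poly_altdef deg by (simp add: coeff_map_poly)
  then have "(\<Sum>i<n. of_int (Polynomial.coeff p i) * z ^ i) + of_int (Polynomial.coeff p n) * z ^ n = 0"
    by (simp add: lessThan_Suc_atMost[symmetric])
  then have "(\<Sum>i<n. of_int (Polynomial.coeff p i) * z ^ i) + z ^ n = 0" using p(2) by (simp add: n_def)
  then have zn: "z ^ n = - (\<Sum>i<n. of_int (Polynomial.coeff p i) * z ^ i)" by (simp add: eq_neg_iff_add_eq_0 add.commute)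
  obtain u v where uv: "quotient_of x = (u, v)" by (cases "quotient_of x")
  obtain u' v' where uv': "quotient_of y = (u', v')" by (cases "quotient_of y")
  have v: "v > 0" "x = of_int u / of_int v" using uv quotient_of_denom_pos quotient_of_div by auto
  have v': "v' > 0" "y = of_int u' / of_int v'" using uv' quotient_of_denom_pos quotient_of_div by auto
  define c where "c = v * v'"
  have c0: "c \<noteq> 0" using v(1) v'(1) by (simp add: c_def)
  have "of_int c * z = K_elt (of_int (v' * u)) (of_int (v * u'))"
    unfolding z_def K_elt_of_int(1) K_elt_mult using v v' by (simp add: c_def)
  then have cz: "of_int c * z \<in> int_elts" unfolding int_elts_def by blast
  have pw: "of_int (c ^ n) * z ^ k \<in> int_elts" for k
  proof (induction k rule: less_induct)
    case (less k)
    show ?case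
    proof (cases "k < n")
      case True
      then have "c ^ n = c ^ (n - k) * c ^ k" by (simp flip: power_add)
      then have "(of_int (c ^ n) :: complex) = of_int (c ^ (n - k)) * of_int c ^ k" by simp
      then have e: "of_int (c ^ n) * z ^ k = of_int (c ^ (n - k)) * (of_int c * z) ^ k"
        by (simp add: power_mult_distrib)
      show ?thesis unfolding e by (rule int_elts_closed(2)[OF int_elts_closed(3) int_elts_power[OF cz]])
    next
      case False
      then have "z ^ k = z ^ (k - n) * z ^ n" using False by (simp flip: power_add)
      also have "\<dots> = - (\<Sum>i<n. of_int (Polynomial.coeff p i) * z ^ (k - n + i))"
        unfolding zn by (simp add: sum_distrib_left power_add mult_ac)
      finally have e: "of_int (c ^ n) * z ^ k = of_int (- 1) * (\<Sum>i<n. of_int (Polynomial.coeff p i) * (of_int (c ^ n) * z ^ (k - n + i)))"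
        by (simp add: sum_distrib_left sum_negf mult_ac)
      have "of_int (Polynomial.coeff p i) * (of_int (c ^ n) * z ^ (k - n + i)) \<in> int_elts" if i: "i < n" for i
        using False i by (intro int_elts_closed(2)[OF int_elts_closed(3) less.IH]) auto
      then show ?thesis unfolding e by (rule int_elts_closed(2)[OF int_elts_closed(3) int_elts_sum]) simp
    qed
  qed
  moreover have "of_int (c ^ n) * (z + 1) ^ k \<in> int_elts" for k
  proof -
    have e: "of_int (c ^ n) * (z + 1) ^ k = (\<Sum>i\<le>k. of_int (int (k choose i)) * (of_int (c ^ n) * z ^ i))"
      by (simp add: binomial_ring sum_distrib_left mult_ac)
    show ?thesis unfolding e by (rule int_elts_sum, rule int_elts_closed(2)[OF int_elts_closed(3) pw])
  qed
  moreover have "c ^ n \<noteq> 0" using c0 by simp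
  ultimately show ?thesis unfolding z_def by blast
qed

text \<open>The denominators of the powers of the norm are bounded along with those of the powers of
  \<open>z = x + y \<surd>\<Delta>\<close>, so the norm is integral. The same holds for \<open>z + 1\<close>, whose norm exceeds that of \<open>z\<close> by the trace plus 1.\<close>

lemma algebraic_int_trace_norm:
  assumes "algebraic_int (K_elt x y)"
  shows "2 * x \<in> \<int>" "x^2 - of_int \<Delta> * y^2 \<in> \<int>"
proof -
  obtain d where d: "d \<noteq> 0" "\<And>k. of_int d * K_elt x y ^ k \<in> int_elts" "\<And>k. of_int d * K_elt (x + 1) y ^ k \<in> int_elts"
    using algebraic_int_powers_bounded[OF assms] by (auto simp: K_elt_of_int(4) K_elt_add)
  have norm: "a^2 - of_int \<Delta> * b^2 \<in> \<int>" if q: "\<And>k. of_int d * K_elt a b ^ k \<in> int_elts" for a b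
  proof (rule rat_int_if_powers_bounded)
    (* The norm is quadratic in the coordinates, so its denominators are bounded by the square of d. *)
    show "d^2 \<noteq> 0" using d by simp
    fix k
    obtain e f where ef: "K_elt a b ^ k = K_elt e f" "(a^2 - of_int \<Delta> * b^2) ^ k = e^2 - of_int \<Delta> * f^2"
      using K_elt_power by blast
    have "of_int d * K_elt e f \<in> int_elts" using q[of k] unfolding ef(1) .
    then obtain g h where "K_elt (of_int d * e) (of_int d * f) = K_elt (of_int g) (of_int h)"
      unfolding K_elt_of_int(1) K_elt_mult by (auto simp: int_elts_def)
    then have gh: "of_int d * e = of_int g" "of_int d * f = of_int h" unfolding K_elt_eq_iff by blast+
    have "of_int (d^2) * (a^2 - of_int \<Delta> * b^2) ^ k = (of_int d * e)^2 - of_int \<Delta> * (of_int d * f)^2"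
      unfolding ef(2) by (simp add: algebra_simps power2_eq_square)
    also have "\<dots> = of_int (g^2 - \<Delta> * h^2)" unfolding gh by simp
    finally show "\<exists>j. of_int (d^2) * (a^2 - of_int \<Delta> * b^2) ^ k = of_int j" by blast
  qed
  show N: "x^2 - of_int \<Delta> * y^2 \<in> \<int>" by (rule norm[OF d(2)])
  have M: "(x + 1)^2 - of_int \<Delta> * y^2 \<in> \<int>"
    by (rule norm[OF d(3)])
  have "((x + 1)^2 - of_int \<Delta> * y^2) - (x^2 - of_int \<Delta> * y^2) - 1 \<in> \<int>"
    by (rule Ints_diff[OF Ints_diff[OF M N] Ints_1])
  then show "2 * x \<in> \<int>" by (simp add: power2_eq_square algebra_simps)
qed

lemma order_algebraic_int:
  assumes "z \<in> quad_order \<Delta>"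
  shows "algebraic_int z"
proof -
  obtain u v where z: "z = half_int u v" and par: "even (u - s * v)"
    using assms by (auto simp: quad_order_eq lattice_def) 
  obtain n where n: "half_int u v * half_int u (- v) = of_int n" using half_int_norm[OF par] by blast
  have "half_int u (- v) = of_int u - z" unfolding z by (simp add: half_int_def field_simps)
  then have "z * (of_int u - z) = of_int n" using n z by simp
  then have "poly (map_poly of_int [:n, - u, 1:]) z = 0" by (simp add: map_poly_pCons algebra_simps)
  then show ?thesis unfolding algebraic_int_altdef_ipoly by (intro exI[of _ "[:n, - u, 1:]"]) simp
qed

end

locale fundamental_discriminant = quadratic_discriminant +
  assumes fund: "v > 0 \<Longrightarrow> \<Delta> = v^2 * d \<Longrightarrow> d mod 4 = 0 \<or> d mod 4 = 1 \<Longrightarrow> v = (1::int)"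
begin

text \<open>Let \<open>t\<close> and \<open>n\<close> be trace and norm of \<open>x + y \<surd>\<Delta>\<close>, and let \<open>v\<close> be the denominator of \<open>2 y\<close>. From
  \<open>t\<^sup>2 - 4 n = (2 y)\<^sup>2 \<Delta>\<close> it follows that \<open>v\<^sup>2\<close> divides \<open>\<Delta>\<close> with a quotient congruent to 0 or 1 modulo 4, so
  \<open>v = 1\<close> because \<open>\<Delta>\<close> is fundamental.\<close>

lemma algebraic_int_in_order:
  assumes z: "z \<in> quad_field \<Delta>" and ai: "algebraic_int z"
  shows "z \<in> quad_order \<Delta>"
proof -
  obtain x y where ze: "z = K_elt x y" using z by (auto simp: quad_field_eq)
  obtain t where t: "2 * x = of_int t" using algebraic_int_trace_norm(1)[of x y] ai ze by (auto elim: Ints_cases)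
  obtain n where n: "x^2 - of_int \<Delta> * y^2 = of_int n" using algebraic_int_trace_norm(2)[of x y] ai ze by (auto elim: Ints_cases)
  obtain u v where uv: "quotient_of (2 * y) = (u, v)" by (cases "quotient_of (2 * y)")
  have v: "v > 0" "coprime u v" "2 * y = of_int u / of_int v"
    using uv quotient_of_denom_pos quotient_of_coprime quotient_of_div by auto
  have "of_int \<Delta> * (2 * y)^2 = (2 * x)^2 - 4 * (x^2 - of_int \<Delta> * y^2)" by (simp add: power2_eq_square algebra_simps)
  then have "of_int \<Delta> * (of_int u / of_int v)^2 = (of_int (t^2 - 4 * n) :: rat)" unfolding t n v(3) by simp
  then have "(of_int (\<Delta> * u^2) :: rat) = of_int ((t^2 - 4 * n) * v^2)" using v(1) by (simp add: power_divide field_simps)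
  then have e: "\<Delta> * u^2 = (t^2 - 4 * n) * v^2" by (simp only: of_int_eq_iff)
  have "v^2 dvd \<Delta> * u^2" unfolding e by simp
  moreover have "coprime (v^2) (u^2)" using v(2) by (simp add: coprime_commute)
  ultimately have "v^2 dvd \<Delta>" by (simp add: coprime_dvd_mult_left_iff)
  then obtain d where d: "\<Delta> = v^2 * d" by (elim dvdE)
  have "v^2 * (d * u^2) = v^2 * (t^2 - 4 * n)" using e unfolding d by (simp add: mult_ac)
  then have du: "d * u^2 = t^2 - 4 * n" using v(1) by simp
  have "d mod 4 = 0 \<or> d mod 4 = 1"
  proof (cases "even v")
    case False
    then have "v^2 mod 4 = 1" using square_mod_4[of v] by simp
    then have "\<Delta> mod 4 = d mod 4" unfolding d by (metis mod_mult_left_eq mult_1)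
    then show ?thesis using mod4 by simp
  next
    case True
    then have "odd u" using v(2) by (metis coprime_common_divisor odd_one)
    then have "u^2 mod 4 = 1" using square_mod_4[of u] by simp
    then have "d mod 4 = (d * u^2) mod 4" by (metis mod_mult_right_eq mult.right_neutral)
    also have "\<dots> = t^2 mod 4"
    proof -
      have "t^2 - 4 * n = t^2 + 4 * (- n)" by simp
      then show ?thesis unfolding du by (simp only: mod_mult_self2)
    qed
    finally show ?thesis using square_mod_4[of t] by (auto split: if_splits)
  qed
  then have v1: "v = 1" by (rule fund[OF v(1) d])
  have y: "y = of_int u / 2" using v(3) unfolding v1 by simp
  have dD: "d = \<Delta>" using d unfolding v1 power_one mult_1 by (rule sym)
  have "x = of_int t / 2" using t by linarith
  then have zh: "z = half_int t u" unfolding ze half_int_K K_elt_eq_iff using y by blast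
  have S: "s = \<Delta> - 4 * D" using disc_eq(1) by linarith
  have su: "s * u^2 = \<Delta> * u^2 - 4 * (D * u^2)" using arg_cong[OF S, of "\<lambda>q. q * u^2"] by (simp add: left_diff_distrib)
  have "t^2 - s * u^2 = 2 * (2 * (n + D * u^2))" using du unfolding su dD by simp
  then have "even (t^2 - s * u^2)" by simp
  then have "even (t - s * u)" by simp
  then show ?thesis unfolding zh half_int_in_order .
qed

lemma max_order_eq: "{z \<in> quad_field \<Delta>. algebraic_int z} = quad_order \<Delta>"
  using algebraic_int_in_order order_algebraic_int order_in_K by blast

end

section \<open>Conductor and inertia degrees\<close>

lemma sqrtD_square_mult:
  assumes "n > 0"
  shows "sqrtD (n^2 * e) = of_int n * sqrtD e"
  unfolding sqrtD_def
proof (rule csqrt_unique)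
  show "(of_int n * csqrt (of_int e))^2 = (of_int (n^2 * e) :: complex)" by (simp add: power_mult_distrib)
  have pos: "0 < Re (of_int n * z) \<or> Re (of_int n * z) = 0 \<and> 0 \<le> Im (of_int n * z)"
    if "0 < Re z \<or> Re z = 0 \<and> 0 \<le> Im z" for z :: complex
    using that assms by auto
  show "0 < Re (of_int n * csqrt (of_int e)) \<or> Re (of_int n * csqrt (of_int e)) = 0 \<and> 0 \<le> Im (of_int n * csqrt (of_int e))"
    by (rule pos[OF csqrt_principal])
qed

lemma quad_field_square_mult:
  assumes "n > 0"
  shows "quad_field (n^2 * e) = quad_field e"
proof -
  have "of_rat x + of_rat y * sqrtD (n^2 * e) = of_rat x + of_rat (y * of_int n) * sqrtD e" for x y
    using assms by (simp add: sqrtD_square_mult of_rat_mult)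
  moreover have "of_rat x + of_rat y * sqrtD e = of_rat x + of_rat (y / of_int n) * sqrtD (n^2 * e)" for x y
    using assms by (simp add: sqrtD_square_mult of_rat_divide)
  ultimately show ?thesis unfolding quad_field_def by blast
qed

lemma quad_conj_square_mult:
  assumes "n > 0"
  shows "quad_conj (n^2 * e) u = quad_conj e u"
proof -
  have "(\<exists>x y. u = of_rat x + of_rat y * sqrtD (n^2 * e) \<and> v = of_rat x - of_rat y * sqrtD (n^2 * e)) \<longleftrightarrow>
        (\<exists>x y. u = of_rat x + of_rat y * sqrtD e \<and> v = of_rat x - of_rat y * sqrtD e)" for v
  proof
    assume "\<exists>x y. u = of_rat x + of_rat y * sqrtD (n^2 * e) \<and> v = of_rat x - of_rat y * sqrtD (n^2 * e)"
    then obtain x y where "u = of_rat x + of_rat y * sqrtD (n^2 * e)" "v = of_rat x - of_rat y * sqrtD (n^2 * e)" by blast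
    then show "\<exists>x y. u = of_rat x + of_rat y * sqrtD e \<and> v = of_rat x - of_rat y * sqrtD e"
      using assms by (intro exI[of _ x] exI[of _ "y * of_int n"]) (simp add: sqrtD_square_mult of_rat_mult)
  next
    assume "\<exists>x y. u = of_rat x + of_rat y * sqrtD e \<and> v = of_rat x - of_rat y * sqrtD e"
    then obtain x y where "u = of_rat x + of_rat y * sqrtD e" "v = of_rat x - of_rat y * sqrtD e" by blast
    then show "\<exists>x y. u = of_rat x + of_rat y * sqrtD (n^2 * e) \<and> v = of_rat x - of_rat y * sqrtD (n^2 * e)"
      using assms by (intro exI[of _ x] exI[of _ "y / of_int n"]) (simp add: sqrtD_square_mult of_rat_divide)
  qed
  then show ?thesis unfolding quad_conj_def by simp
qed

context fundamental_discriminant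
begin

lemma quad_conj_half_int: "quad_conj \<Delta> (half_int u v) = half_int u (- v)"
  unfolding quad_conj_def
proof (rule the_equality)
  have "half_int u (- v) = of_rat (of_int u / 2) - of_rat (of_int v / 2) * r"
    by (simp add: half_int_K K_elt_def of_rat_minus of_rat_divide)
  then show "\<exists>x y. half_int u v = of_rat x + of_rat y * r \<and> half_int u (- v) = of_rat x - of_rat y * r"
    unfolding half_int_K[of u v] K_elt_def by blast
  fix z assume "\<exists>x y. half_int u v = of_rat x + of_rat y * r \<and> z = of_rat x - of_rat y * r"
  then obtain x y where "half_int u v = K_elt x y" "z = K_elt x (- y)" by (auto simp: K_elt_def of_rat_minus)
  then show "z = half_int u (- v)" unfolding half_int_K K_elt_eq_iff by simp
qed

lemma basis_discriminant:
  "(half_int u1 v1 * quad_conj \<Delta> (half_int u2 v2) - half_int u2 v2 * quad_conj \<Delta> (half_int u1 v1))^2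
     = of_int ((u2 * v1 - u1 * v2)^2 * \<Delta>) / 4"
proof -
  have e: "half_int u1 v1 * quad_conj \<Delta> (half_int u2 v2) - half_int u2 v2 * quad_conj \<Delta> (half_int u1 v1)
      = of_int (u2 * v1 - u1 * v2) * r / 2"
    unfolding quad_conj_half_int unfolding half_int_def by (simp add: field_simps)
  show ?thesis unfolding e by (simp add: power_divide power_mult_distrib power2_eq_square[of r] r_square)
qed

text \<open>Two integral bases differ by a matrix of determinant \<open>\<plusminus>1\<close>, so the squared determinant of the conjugates is the
  same for all of them; for the basis \<open>1\<close>, \<open>(s + \<surd>\<Delta>) / 2\<close> it is \<open>\<Delta>\<close>. The lemma is applied to the discriminants
  \<open>E = n\<^sup>2 \<Delta>\<close>, which generate the same field.\<close>

lemma field_disc_eq: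
  assumes mo: "max_order E = quad_order \<Delta>" and cj: "\<And>u. quad_conj E u = quad_conj \<Delta> u"
  shows "field_disc E = \<Delta>"
  unfolding field_disc_def
proof (rule the_equality)
  have "bij_betw (\<lambda>(u::int, v::int). of_int u * half_int 2 0 + of_int v * half_int s 1) UNIV (quad_order \<Delta>)"
  proof -
    have e: "of_int u * half_int 2 0 + of_int v * half_int s 1 = half_int (2 * 1 * u + s * v) v" for u v
      unfolding half_int_scale half_int_add by (simp add: mult.commute)
    show ?thesis unfolding e quad_order_eq lattice_def
      by (auto simp: bij_betw_def inj_on_def half_int_eq_iff)
  qed
  moreover have "of_int \<Delta> = (half_int 2 0 * quad_conj \<Delta> (half_int s 1) - half_int s 1 * quad_conj \<Delta> (half_int 2 0))^2"
    unfolding basis_discriminant by simp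
  ultimately show "\<exists>w1 w2. is_integral_basis E w1 w2 \<and> of_int \<Delta> = (w1 * quad_conj E w2 - w2 * quad_conj E w1)^2"
    unfolding is_integral_basis_def mo cj by blast
  fix d assume "\<exists>w1 w2. is_integral_basis E w1 w2 \<and> of_int d = (w1 * quad_conj E w2 - w2 * quad_conj E w1)^2"
  then obtain w1 w2 where b: "bij_betw (\<lambda>(u::int, v::int). of_int u * w1 + of_int v * w2) UNIV (quad_order \<Delta>)"
    and d: "of_int d = (w1 * quad_conj \<Delta> w2 - w2 * quad_conj \<Delta> w1)^2"
    unfolding is_integral_basis_def mo cj by blast
  have img: "(\<lambda>(u::int, v::int). of_int u * w1 + of_int v * w2) ` UNIV = quad_order \<Delta>" using b by (simp add: bij_betw_def)
  have "(\<lambda>(u::int, v::int). of_int u * w1 + of_int v * w2) (1, 0) \<in> quad_order \<Delta>"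
    "(\<lambda>(u::int, v::int). of_int u * w1 + of_int v * w2) (0, 1) \<in> quad_order \<Delta>" unfolding img[symmetric] by blast+
  then have "w1 \<in> quad_order \<Delta>" "w2 \<in> quad_order \<Delta>" by simp_all
  then obtain x1 y1 x2 y2 where w1: "w1 = half_int (2 * x1 + s * y1) y1" and w2: "w2 = half_int (2 * x2 + s * y2) y2"
    by (auto simp: quad_order_eq lattice_def)
  have onto: "\<exists>u v. u * x1 + v * x2 = x \<and> u * y1 + v * y2 = y" for x y
  proof -
    have "half_int (2 * x + s * y) y \<in> quad_order \<Delta>" by (simp add: half_int_in_order)
    then obtain u v where "half_int (2 * x + s * y) y = of_int u * w1 + of_int v * w2" unfolding img[symmetric] by auto
    then have "half_int (2 * x + s * y) y = half_int (u * (2 * x1 + s * y1) + v * (2 * x2 + s * y2)) (u * y1 + v * y2)"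
      unfolding w1 w2 half_int_scale half_int_add .
    then have y: "y = u * y1 + v * y2" and x: "2 * x + s * y = u * (2 * x1 + s * y1) + v * (2 * x2 + s * y2)"
      unfolding half_int_eq_iff by blast+
    have "2 * x = 2 * (u * x1 + v * x2)" using x unfolding y by (simp add: algebra_simps)
    moreover have "A = B" if "2 * A = 2 * B" for A B :: int using that by simp
    ultimately have "x = u * x1 + v * x2" by blast
    then show ?thesis using y by auto
  qed
  obtain u v where uv: "u * x1 + v * x2 = 1" "u * y1 + v * y2 = 0" using onto by blast
  obtain u' v' where uv': "u' * x1 + v' * x2 = 0" "u' * y1 + v' * y2 = 1" using onto by blast
  have "(u * v' - u' * v) * (x1 * y2 - x2 * y1) = (u * x1 + v * x2) * (u' * y1 + v' * y2) - (u' * x1 + v' * x2) * (u * y1 + v * y2)"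
    by (simp add: algebra_simps)
  then have "(u * v' - u' * v) * (x1 * y2 - x2 * y1) = 1" unfolding uv uv' by simp
  then have "x1 * y2 - x2 * y1 = 1 \<or> x1 * y2 - x2 * y1 = - 1" by (auto simp: zmult_eq_1_iff)
  then have sq: "(x1 * y2 - x2 * y1)^2 = 1" by auto
  have "(2 * x2 + s * y2) * y1 - (2 * x1 + s * y1) * y2 = - 2 * (x1 * y2 - x2 * y1)" by (simp add: algebra_simps)
  then have "((2 * x2 + s * y2) * y1 - (2 * x1 + s * y1) * y2)^2 = (- 2)^2 * (x1 * y2 - x2 * y1)^2"
    by (simp only: power_mult_distrib)
  then have four: "((2 * x2 + s * y2) * y1 - (2 * x1 + s * y1) * y2)^2 = 4" unfolding sq by simp
  then have "(of_int d :: complex) = of_int \<Delta>" unfolding d w1 w2 basis_discriminant four by simp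
  then show "d = \<Delta>" by (simp only: of_int_eq_iff)
qed

end

context quadratic_discriminant
begin

lemma fundamental_part_exists:
  obtains e n where "fundamental_discriminant e" "n > 0" "\<Delta> = n^2 * e"
proof -
  define S where "S = {n. n > 0 \<and> (\<exists>e. \<Delta> = n^2 * e \<and> (e mod 4 = 0 \<or> e mod 4 = 1))}"
  have bound: "n \<le> \<bar>\<Delta>\<bar>" if n: "n \<in> S" for n
  proof -
    have "n > 0" "n dvd \<Delta>" using n by (auto simp: S_def power2_eq_square)
    then show ?thesis using dvd_imp_le_int[OF disc_nonzero, of n] by simp
  qed
  have "S \<subseteq> {1..\<bar>\<Delta>\<bar>}" using bound by (auto simp: S_def)
  then have fin: "finite S" by (rule finite_subset) simp
  have "1 \<in> S" using mod4 by (simp add: S_def)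
  define n where "n = Max S"
  have nS: "n \<in> S" unfolding n_def using fin \<open>1 \<in> S\<close> by (intro Max_in) auto
  then obtain e where e: "n > 0" "\<Delta> = n^2 * e" "e mod 4 = 0 \<or> e mod 4 = 1" by (auto simp: S_def)
  have "fundamental_discriminant e"
  proof
    show "\<nexists>k. e = k^2"
    proof
      assume "\<exists>k. e = k^2"
      then obtain k where "e = k^2" by blast
      then have "\<Delta> = (n * k)^2" using e(2) by (simp add: power_mult_distrib)
      then show False using nonsquare by blast
    qed
    show "e mod 4 = 0 \<or> e mod 4 = 1" by (rule e(3))
    fix v d :: int assume v: "v > 0" and ed: "e = v^2 * d" and d: "d mod 4 = 0 \<or> d mod 4 = 1"
    have "\<Delta> = (n * v)^2 * d" unfolding e(2) ed by (simp add: power_mult_distrib)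
    then have "n * v \<in> S" using e(1) v d by (auto simp: S_def)
    then have "n * v \<le> n" unfolding n_def using fin by (simp add: Max_ge)
    then have "n * v \<le> n * 1" by simp
    then have "v \<le> 1" unfolding mult_le_cancel_left_pos[OF e(1)] .
    then show "v = 1" using v by simp
  qed
  then show thesis using that e by blast
qed

text \<open>Let \<open>\<Delta> = n\<^sup>2 e\<close> with \<open>n\<close> maximal, so \<open>e\<close> is the discriminant of the field and \<open>\<Delta> = e m\<^sup>2\<close>. A square
  \<open>p\<^sup>2\<close> that could be split off from \<open>\<Delta>\<close> with \<open>p\<close> not dividing \<open>m\<close> could be split off from \<open>e\<close>, against the
  choice of \<open>e\<close>. For the same \<open>p\<close>, squares modulo \<open>4 p\<close> can be multiplied and divided by \<open>m\<^sup>2\<close>, which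
  transfers the criterion for the inertia degree from \<open>e\<close> to \<open>\<Delta>\<close>.\<close>

lemma conductor_consequences:
  assumes conductor: "\<Delta> = field_disc \<Delta> * (int m)^2"
  shows "fundamental_outside \<Delta> m"
    and "p \<in> primes_not_dvd m \<Longrightarrow> inertia_degree \<Delta> p = (if \<exists>b. 4 * int p dvd b^2 - \<Delta> then 1 else 2)"
proof -
  obtain e n where fd: "fundamental_discriminant e" and n: "n > 0" "\<Delta> = n^2 * e" by (rule fundamental_part_exists)
  interpret F: fundamental_discriminant e by (rule fd)
  have mo: "max_order \<Delta> = quad_order e"
    unfolding max_order_def n(2) quad_field_square_mult[OF n(1)] by (rule F.max_order_eq)
  have fde: "field_disc \<Delta> = e"
    by (rule F.field_disc_eq[OF mo]) (simp add: n(2) quad_conj_square_mult[OF n(1)])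
  have De: "\<Delta> = e * (int m)^2" using conductor unfolding fde .
  have m0: "m > 0" using De disc_nonzero by (cases "m = 0") auto
  have sq4: "(int m)^2 mod 4 = 1" if "odd m" using square_mod_4[of "int m"] that by simp
  show "fundamental_outside \<Delta> m"
  proof
    fix p d assume p: "p \<in> primes_not_dvd m" and d: "\<Delta> = (int p)^2 * d"
    have pp: "Factorial_Ring.prime p" and ndvd: "\<not> p dvd m" using p by (auto simp: primes_not_dvd_def)
    have "coprime p m" using prime_imp_coprime[OF pp ndvd] .
    then have "coprime ((int p)^2) ((int m)^2)" by simp
    moreover have "(int p)^2 dvd e * (int m)^2" using d De by (metis dvd_triv_left)
    ultimately have "(int p)^2 dvd e" by (simp add: coprime_dvd_mult_left_iff)
    then obtain e' where e': "e = (int p)^2 * e'" by (elim dvdE)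
    have nz: "(int p)^2 \<noteq> 0" using prime_gt_0_nat[OF pp] by simp
    have "(int p)^2 * d = e * (int m)^2" by (rule trans[OF d[symmetric] De])
    then have "(int p)^2 * d = (int p)^2 * (e' * (int m)^2)" unfolding e' by (simp only: mult.assoc)
    then have de: "d = e' * (int m)^2" unfolding mult_left_cancel[OF nz] .
    have "\<not> (d mod 4 = 0 \<or> d mod 4 = 1)"
    proof
      assume d4: "d mod 4 = 0 \<or> d mod 4 = 1"
      have "e' mod 4 = 0 \<or> e' mod 4 = 1"
      proof (cases "even p")
        case True
        have "odd m"
        proof
          assume "even m"
          then have "is_unit (2::nat)" using coprime_common_divisor[OF \<open>coprime p m\<close> True] by blast
          then show False by simp
        qed
        then have "(e' * ((int m)^2 mod 4)) mod 4 = e' mod 4" using sq4 by simp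
        then have "d mod 4 = e' mod 4" unfolding de mod_mult_right_eq .
        then show ?thesis using d4 by simp
      next
        case False
        then have "(int p)^2 mod 4 = 1" using square_mod_4[of "int p"] by simp
        then have "(((int p)^2 mod 4) * e') mod 4 = e' mod 4" by simp
        then have "e mod 4 = e' mod 4" unfolding e' mod_mult_left_eq .
        then show ?thesis using F.mod4 by simp
      qed
      then have "int p = 1" using F.fund[OF _ e'] pp by (simp add: prime_gt_0_nat)
      then show False using prime_ge_2_nat[OF pp] by simp
    qed
    then show "d mod 4 \<noteq> 0 \<and> d mod 4 \<noteq> 1" by simp
  qed
  assume p: "p \<in> primes_not_dvd m"
  have pp: "Factorial_Ring.prime p" and ndvd: "\<not> int p dvd int m" using p by (auto simp: primes_not_dvd_def)
  have "(\<exists>b. 4 * int p dvd b^2 - e) \<longleftrightarrow> (\<exists>b. 4 * int p dvd b^2 - \<Delta>)"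
  proof
    assume "\<exists>b. 4 * int p dvd b^2 - e"
    then obtain b where "4 * int p dvd b^2 - e" by blast
    then have "4 * int p dvd (b^2 - e) * (int m)^2" by (rule dvd_mult2)
    moreover have "(b^2 - e) * (int m)^2 = (b * int m)^2 - \<Delta>" unfolding De by (simp add: algebra_simps power_mult_distrib)
    ultimately show "\<exists>b. 4 * int p dvd b^2 - \<Delta>" by (intro exI[of _ "b * int m"]) simp
  next
    assume "\<exists>b. 4 * int p dvd b^2 - \<Delta>"
    then obtain b where "4 * int p dvd b^2 - e * (int m)^2" unfolding De by blast
    then show "\<exists>b. 4 * int p dvd b^2 - e" by (rule F.root_of_norm_dvd[OF pp _ ndvd])
  qed
  then show "inertia_degree \<Delta> p = (if \<exists>b. 4 * int p dvd b^2 - \<Delta> then 1 else 2)"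
    unfolding inertia_degree_def mo F.residue_degree_eq[OF pp] by simp
qed

end

section \<open>Swapping equivalent letters between the blocks of a factorization\<close>

text \<open>A factorization is a multiset of blocks, each block a multiset of letters. One step changes two blocks without
  changing their labels or their joint content.\<close>

definition swap_step ::
  "('p \<Rightarrow> 'g) \<Rightarrow> 'p multiset multiset \<Rightarrow> 'p multiset multiset \<Rightarrow> bool" where
  "swap_step \<phi> Y Y' \<longleftrightarrow> (\<exists>U V U' V' W. Y = {#U, V#} + W \<and> Y' = {#U', V'#} + W \<and> U + V = U' + V' \<and>
      image_mset \<phi> U = image_mset \<phi> U' \<and> image_mset \<phi> V = image_mset \<phi> V')"

lemma swap_step_invariants:
  assumes "swap_step \<phi> Y Y'"
  shows "\<Sum>\<^sub># Y = \<Sum>\<^sub># Y'" "image_mset (image_mset \<phi>) Y = image_mset (image_mset \<phi>) Y'"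
  using assms unfolding swap_step_def by (auto simp flip: add.assoc)

lemma swap_steps_invariants:
  assumes "(swap_step \<phi>)\<^sup>*\<^sup>* Y Y'"
  shows "\<Sum>\<^sub># Y = \<Sum>\<^sub># Y'" "image_mset (image_mset \<phi>) Y = image_mset (image_mset \<phi>) Y'"
  using assms by (induction rule: rtranclp_induct) (auto dest: swap_step_invariants)

lemma swap_steps_add:
  assumes "(swap_step \<phi>)\<^sup>*\<^sup>* Y Y'"
  shows "(swap_step \<phi>)\<^sup>*\<^sup>* (add_mset U Y) (add_mset U Y')"
  using assms
proof (induction rule: rtranclp_induct)
  case (step Y' Y'')
  have "swap_step \<phi> (add_mset U Y') (add_mset U Y'')"
    using step(2) unfolding swap_step_def
    by (elim exE conjE, intro exI conjI) (assumption | simp add: add_mset_commute[of U])+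
  then show ?case using step(3) by auto
qed auto

text \<open>Induction on the number of letters of \<open>U'\<close> missing in \<open>U\<close>. A missing letter \<open>q'\<close> occurs in some other block,
  and \<open>U\<close> has a surplus letter \<open>q\<close> with the same label because \<open>U\<close> and \<open>U'\<close> have the same labels;
  exchanging \<open>q\<close> and \<open>q'\<close> is a step.\<close>

lemma swap_block_into_place:
  assumes "image_mset \<phi> U = image_mset \<phi> U'" "U' \<subseteq># U + \<Sum>\<^sub># W"
  shows "\<exists>W'. (swap_step \<phi>)\<^sup>*\<^sup>* (add_mset U W) (add_mset U' W')"
  using assms
proof (induction "size (U' - U)" arbitrary: U W rule: less_induct)
  case less
  have sz: "size U = size U'" using less.prems(1) by (metis size_image_mset)
  show ?case
  proof (cases "U' - U = {#}")
    case True
    then have "U' \<subseteq># U" by (simp add: Diff_eq_empty_iff_mset)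
    then have "U' = U" using sz by (metis mset_subset_size subset_mset.le_imp_less_or_eq less_irrefl)
    then show ?thesis by blast
  next
    case False
    then obtain q' where q': "q' \<in># U' - U" by auto
    have i: "image_mset \<phi> (U' - U) = image_mset \<phi> (U - U')"
    proof -
      have "U' = (U' - U) + (U' \<inter># U)" "U = (U - U') + (U' \<inter># U)"
        by (auto simp: multiset_eq_iff)
      then have "image_mset \<phi> (U' - U) + image_mset \<phi> (U' \<inter># U) = image_mset \<phi> (U - U') + image_mset \<phi> (U' \<inter># U)"
        using less.prems(1) by (metis image_mset_union)
      then show ?thesis by simp
    qed
    have "\<phi> q' \<in># image_mset \<phi> (U - U')" using q' i by (metis in_image_mset image_eqI)
    then obtain q where q: "q \<in># U - U'" "\<phi> q = \<phi> q'" by auto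
    have cq': "count U q' < count U' q'" and cq: "count U' q < count U q"
      using q' q(1) by (simp_all add: in_diff_count)
    have "count U' q' \<le> count U q' + count (\<Sum>\<^sub># W) q'"
      using less.prems(2) by (metis mset_subset_eq_count count_union)
    then have "q' \<in># \<Sum>\<^sub># W" using cq' by (metis add_0_right count_inI leD)
    then obtain V where V: "V \<in># W" "q' \<in># V" by auto
    then obtain W1 where W: "W = add_mset V W1" by (meson mset_add)
    have qU: "q \<in># U" using cq by (metis count_inI not_less_zero)
    obtain U0 where U0: "U = add_mset q U0" using qU by (meson mset_add)
    obtain V0 where V0: "V = add_mset q' V0" using V(2) by (meson mset_add)
    define U1 where "U1 = add_mset q' U0"
    define V1 where "V1 = add_mset q V0"
    have st: "swap_step \<phi> (add_mset U W) (add_mset U1 (add_mset V1 W1))"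
      unfolding swap_step_def
      by (rule exI[of _ U], rule exI[of _ V], rule exI[of _ U1], rule exI[of _ V1], rule exI[of _ W1])
        (use q(2) in \<open>auto simp: W U0 V0 U1_def V1_def\<close>)
    have neq: "q \<noteq> q'" using cq cq' by auto
    have "U' - U = add_mset q' (U' - U1)"
      by (rule multiset_eqI) (use cq cq' neq in \<open>auto simp: U1_def U0\<close>)
    then have "size (U' - U1) < size (U' - U)" by simp
    moreover have "image_mset \<phi> U1 = image_mset \<phi> U'"
      using less.prems(1) q(2) by (simp add: U1_def U0)
    moreover have "U' \<subseteq># U1 + \<Sum>\<^sub># (add_mset V1 W1)"
      using less.prems(2) swap_step_invariants(1)[OF st] by simp
    ultimately obtain W' where "(swap_step \<phi>)\<^sup>*\<^sup>* (add_mset U1 (add_mset V1 W1)) (add_mset U' W')"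
      using less.hyps by blast
    then show ?thesis using st by (meson converse_rtranclp_into_rtranclp)
  qed
qed

text \<open>Two factorizations of the same element with the same image are connected: fix a block \<open>U'\<close> of
  the second, choose a block of the first with the same image, move the missing letters into it one
  at a time, and continue with the remaining blocks.\<close>

lemma swap_connected:
  assumes "\<Sum>\<^sub># Z = \<Sum>\<^sub># Z'" "image_mset (image_mset \<phi>) Z = image_mset (image_mset \<phi>) Z'"
  shows "(swap_step \<phi>)\<^sup>*\<^sup>* Z Z'"
  using assms
proof (induction "size Z'" arbitrary: Z Z')
  case 0
  then show ?case by simp
next
  case (Suc n)
  then obtain U' N' where Z': "Z' = add_mset U' N'" by (metis size_eq_Suc_imp_eq_union)
  have "image_mset \<phi> U' \<in># image_mset (image_mset \<phi>) Z" unfolding Suc.prems(2) Z' by simp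
  then obtain U where U: "U \<in># Z" "image_mset \<phi> U = image_mset \<phi> U'" by auto
  then obtain W where Z: "Z = add_mset U W" by (meson mset_add)
  have "U' \<subseteq># U + \<Sum>\<^sub># W" using Suc.prems(1) by (simp add: Z Z' flip: Suc.prems(1))
  then obtain W' where W': "(swap_step \<phi>)\<^sup>*\<^sup>* Z (add_mset U' W')"
    using swap_block_into_place[OF U(2)] unfolding Z by blast
  note inv = swap_steps_invariants[OF W']
  have "\<Sum>\<^sub># W' = \<Sum>\<^sub># N'" "image_mset (image_mset \<phi>) W' = image_mset (image_mset \<phi>) N'"
    using inv Suc.prems unfolding Z' by simp_all
  moreover have "n = size N'" using Suc.hyps(2) Z' by simp
  ultimately have "(swap_step \<phi>)\<^sup>*\<^sup>* W' N'" using Suc.hyps(1) by blast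
  then have "(swap_step \<phi>)\<^sup>*\<^sup>* (add_mset U' W') Z'" unfolding Z' by (rule swap_steps_add)
  then show ?case using W' by (rule rtranclp_trans[rotated])
qed

lemma fact_dist_common_part:
  "fact_dist (N + W) (N' + W) \<le> max (size N) (size N')"
proof -
  have "size (A - A \<inter># B) \<le> size Y" if "A = Y + W" "W \<subseteq># B" for A B Y :: "'a multiset"
  proof -
    have "W \<subseteq># A \<inter># B" using that by simp
    then have "A - A \<inter># B \<subseteq># A - W" by (auto simp: subseteq_mset_def intro: diff_le_mono2)
    then have "size (A - A \<inter># B) \<le> size (A - W)" by (rule size_mset_mono)
    then show ?thesis using that(1) by simp
  qed
  from this[of "N + W" N "N' + W"] this[of "N' + W" N' "N + W"] show ?thesis
    unfolding fact_dist_def by (simp add: max_def subset_mset.inf_commute)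
qed

lemma (in comm_monoid) finprod_multiset_add:
  assumes "set_mset (add_mset u z) \<subseteq> carrier G"
  shows "(\<Otimes>U\<in>set_mset (add_mset u z). U [^] count (add_mset u z) U) =
     u \<otimes> (\<Otimes>U\<in>set_mset z. U [^] count z U)"
proof -
  have c: "u \<in> carrier G" "set_mset z \<subseteq> carrier G" using assms by auto
  define A where "A = set_mset z - {u}"
  define Q where "Q = (\<Otimes>U\<in>A. U [^] count z U)"
  have A: "finite A" "u \<notin> A" "A \<subseteq> carrier G" using c by (auto simp: A_def)
  have Qc: "Q \<in> carrier G" unfolding Q_def using A by (intro finprod_closed) auto
  have "(\<Otimes>U\<in>set_mset (add_mset u z). U [^] count (add_mset u z) U) =
        (\<Otimes>U\<in>insert u A. U [^] count (add_mset u z) U)"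
    by (simp add: A_def)
  also have "\<dots> = u [^] count (add_mset u z) u \<otimes> (\<Otimes>U\<in>A. U [^] count (add_mset u z) U)"
    using A c by (intro finprod_insert) auto
  also have "(\<Otimes>U\<in>A. U [^] count (add_mset u z) U) = Q"
    unfolding Q_def using A by (intro finprod_cong') auto
  also have "u [^] count (add_mset u z) u \<otimes> Q = u \<otimes> (u [^] count z u \<otimes> Q)"
    using c Qc by (simp add: m_assoc[symmetric] m_comm[of _ u])
  also have "u [^] count z u \<otimes> Q = (\<Otimes>U\<in>insert u A. U [^] count z U)"
    unfolding Q_def using A c by (intro finprod_insert[symmetric]) auto
  also have "\<dots> = (\<Otimes>U\<in>set_mset z. U [^] count z U)"
  proof (cases "u \<in># z")
    case True
    then have "insert u A = set_mset z" by (auto simp: A_def)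
    then show ?thesis by simp
  next
    case False
    then have "count z u = 0" "A = set_mset z" by (auto simp: A_def count_eq_zero_iff)
    then show ?thesis using A c Qc by (subst finprod_insert) (auto simp: Q_def)
  qed
  finally show ?thesis .
qed

section \<open>Transfer homomorphisms that relabel letters\<close>

text \<open>\<open>H\<close> is the monoid of all multisets over \<open>P\<close> that \<open>\<phi>\<close> maps into \<open>B\<close>, transported along \<open>val\<close>, and \<open>\<theta>\<close>
  applies \<open>\<phi>\<close> to every letter.\<close>

locale relabelling =
  fixes P :: "'p set" and \<phi> :: "'p \<Rightarrow> 'g" and val :: "'p multiset \<Rightarrow> 'h"
    and H :: "'h monoid" and B :: "'g multiset monoid" and \<theta> :: "'h \<Rightarrow> 'g multiset"
  assumes B_mult: "mult B = (+)" and B_one: "one B = {#}"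
    and B_zero: "{#} \<in> carrier B"
    and B_add: "b \<in> carrier B \<Longrightarrow> c \<in> carrier B \<Longrightarrow> b + c \<in> carrier B"
    and B_letters: "b \<in> carrier B \<Longrightarrow> set_mset b \<subseteq> \<phi> ` P"
    and H_carrier: "carrier H = val ` {N. set_mset N \<subseteq> P \<and> image_mset \<phi> N \<in> carrier B}"
    and H_mult: "set_mset N \<subseteq> P \<Longrightarrow> set_mset Y \<subseteq> P \<Longrightarrow> val N \<otimes>\<^bsub>H\<^esub> val Y = val (N + Y)"
    and H_one: "one H = val {#}"
    and val_inj: "inj_on val {N. set_mset N \<subseteq> P}"
    and \<theta>_val: "set_mset N \<subseteq> P \<Longrightarrow> image_mset \<phi> N \<in> carrier B \<Longrightarrow> \<theta> (val N) = image_mset \<phi> N"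
begin

definition M where "M = {N. set_mset N \<subseteq> P \<and> image_mset \<phi> N \<in> carrier B}"

lemma M_simps: "{#} \<in> M" "N \<in> M \<Longrightarrow> Y \<in> M \<Longrightarrow> N + Y \<in> M"
  using B_zero B_add by (auto simp: M_def)

lemma carrier_H: "carrier H = val ` M"
  using H_carrier by (simp add: M_def)

lemma mult_val: "N \<in> M \<Longrightarrow> Y \<in> M \<Longrightarrow> val N \<otimes>\<^bsub>H\<^esub> val Y = val (N + Y)"
  by (auto simp: M_def intro: H_mult)

lemma val_eq: "N \<in> M \<Longrightarrow> Y \<in> M \<Longrightarrow> val N = val Y \<longleftrightarrow> N = Y"
  using val_inj by (auto simp: M_def inj_on_def)

lemma theta_val: "N \<in> M \<Longrightarrow> \<theta> (val N) = image_mset \<phi> N"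
  by (auto simp: M_def intro: \<theta>_val)

lemma image_in_B: "N \<in> M \<Longrightarrow> image_mset \<phi> N \<in> carrier B"
  by (simp add: M_def)

lemma cancel_B: "comm_monoid_cancel B"
  by unfold_locales (auto simp: B_mult B_one B_zero B_add)

lemma cancel_H: "comm_monoid_cancel H"
proof unfold_locales
  fix x y assume "x \<in> carrier H" "y \<in> carrier H"
  then show "x \<otimes>\<^bsub>H\<^esub> y \<in> carrier H" by (auto simp: carrier_H mult_val M_simps)
next
  show "\<one>\<^bsub>H\<^esub> \<in> carrier H" by (auto simp: carrier_H H_one M_simps)
qed (auto simp: carrier_H H_one mult_val M_simps add_ac val_eq)

lemma Units_B: "Units B = {{#}}"
  by (auto simp: Units_def B_mult B_one B_zero)

lemma Units_H: "Units H = {val {#}}"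
proof -
  have "N = {#}" if "N \<in> M" "Y \<in> M" "val Y \<otimes>\<^bsub>H\<^esub> val N = \<one>\<^bsub>H\<^esub>" for N Y
    using that by (simp add: mult_val H_one val_eq M_simps)
  moreover have "val {#} \<otimes>\<^bsub>H\<^esub> val {#} = \<one>\<^bsub>H\<^esub>" by (simp add: mult_val M_simps H_one)
  ultimately show ?thesis unfolding Units_def carrier_H using M_simps(1) by auto
qed

lemma lift_image:
  assumes "b \<in> carrier B"
  shows "\<exists>N\<in>M. image_mset \<phi> N = b"
proof -
  have "set_mset b \<subseteq> \<phi> ` P \<Longrightarrow> \<exists>N. set_mset N \<subseteq> P \<and> image_mset \<phi> N = b" for b
  proof (induction b)
    case (add g b)
    then obtain N p where "set_mset N \<subseteq> P" "image_mset \<phi> N = b" "p \<in> P" "\<phi> p = g" by auto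
    then show ?case by (intro exI[of _ "add_mset p N"]) auto
  qed auto
  then show ?thesis using assms B_letters unfolding M_def by blast
qed

lemma split_along_image:
  assumes "N \<in> M" "image_mset \<phi> N = b + c" "b \<in> carrier B" "c \<in> carrier B"
  shows "\<exists>Y\<in>M. \<exists>Z\<in>M. N = Y + Z \<and> image_mset \<phi> Y = b \<and> image_mset \<phi> Z = c"
proof -
  obtain Y Z where "N = Y + Z" "b = image_mset \<phi> Y" "c = image_mset \<phi> Z"
    using image_mset_eq_plusD[OF assms(2)] by blast
  then show ?thesis using assms unfolding M_def by auto
qed

theorem transfer: "transfer_hom H B \<theta>"
  unfolding transfer_hom_def
proof (intro conjI cancel_H cancel_B ballI impI)
  show "\<theta> \<in> hom H B"
    by (rule homI) (auto simp: carrier_H theta_val mult_val M_simps image_in_B B_mult)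
  show "\<theta> \<one>\<^bsub>H\<^esub> = \<one>\<^bsub>B\<^esub>" by (simp add: H_one B_one theta_val M_simps)
  have "\<theta> ` carrier H = carrier B"
    unfolding carrier_H using lift_image image_in_B by (force simp: theta_val image_iff)
  then show "carrier B = \<theta> ` carrier H <#>\<^bsub>B\<^esub> Units B"
    by (simp add: Units_B set_mult_def B_mult)
  show "{u \<in> carrier H. \<theta> u \<in> Units B} = Units H"
    unfolding Units_B Units_H carrier_H using M_simps(1) by (auto simp: theta_val)
next
  fix u b c assume u: "u \<in> carrier H" and b: "b \<in> carrier B" and c: "c \<in> carrier B" and e: "\<theta> u = b \<otimes>\<^bsub>B\<^esub> c"
  then obtain N where N: "N \<in> M" "u = val N" by (auto simp: carrier_H)
  then have "image_mset \<phi> N = b + c" using e by (simp add: theta_val B_mult)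
  then obtain Y Z where "Y \<in> M" "Z \<in> M" "N = Y + Z" "image_mset \<phi> Y = b" "image_mset \<phi> Z = c"
    using split_along_image[OF N(1) _ b c] by blast
  then show "\<exists>v\<in>carrier H. \<exists>w\<in>carrier H. u = v \<otimes>\<^bsub>H\<^esub> w \<and> \<theta> v \<in> b <#\<^bsub>B\<^esub> Units B \<and> \<theta> w \<in> c <#\<^bsub>B\<^esub> Units B"
    using N(2) by (intro bexI[of _ "val Y"] bexI[of _ "val Z"])
      (auto simp: carrier_H mult_val theta_val Units_B l_coset_def B_mult)
qed

lemma reduced_carrier: "carrier (reduced_monoid H) = (\<lambda>N. {val N}) ` M"
proof -
  have "val N <#\<^bsub>H\<^esub> Units H = {val N}" if "N \<in> M" for N
    using that by (simp add: Units_H l_coset_def mult_val M_simps)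
  then show ?thesis by (force simp: reduced_monoid_def carrier_H)
qed

lemma coset_val: "N \<in> M \<Longrightarrow> val N <#\<^bsub>H\<^esub> Units H = {val N}"
  by (simp add: Units_H l_coset_def mult_val M_simps)

lemma reduced_mult: "N \<in> M \<Longrightarrow> Y \<in> M \<Longrightarrow> {val N} \<otimes>\<^bsub>reduced_monoid H\<^esub> {val Y} = {val (N + Y)}"
  by (simp add: reduced_monoid_def set_mult_def mult_val)

lemma reduced_one: "\<one>\<^bsub>reduced_monoid H\<^esub> = {val {#}}"
  by (simp add: reduced_monoid_def Units_H)

lemma reduced_comm_monoid: "comm_monoid (reduced_monoid H)"
  by unfold_locales (auto simp: reduced_carrier reduced_mult reduced_one M_simps add_ac)

lemma reduced_Units: "Units (reduced_monoid H) = {{val {#}}}"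
proof -
  have "N = {#}" if "N \<in> M" "Y \<in> M" "{val Y} \<otimes>\<^bsub>reduced_monoid H\<^esub> {val N} = \<one>\<^bsub>reduced_monoid H\<^esub>" for N Y
    using that by (simp add: reduced_mult reduced_one val_eq M_simps)
  moreover have "{val {#}} \<otimes>\<^bsub>reduced_monoid H\<^esub> {val {#}} = \<one>\<^bsub>reduced_monoid H\<^esub>" by (simp add: reduced_mult M_simps reduced_one)
  ultimately show ?thesis unfolding Units_def reduced_carrier using M_simps(1) by auto
qed

text \<open>The atoms of \<open>B\<close>. Whether a multiset is an atom of \<open>H\<close> depends only on its image, which is why exchanging letters
  with the same label turns factorizations into factorizations.\<close>

definition unsplittable :: "'g multiset \<Rightarrow> bool" where
  "unsplittable b \<longleftrightarrow> b \<noteq> {#} \<and> (\<forall>c\<in>carrier B. \<forall>d\<in>carrier B. b = c + d \<longrightarrow> c = {#} \<or> d = {#})"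

lemma reduced_divides: "N \<in> M \<Longrightarrow> Y \<in> M \<Longrightarrow> {val N} divides\<^bsub>reduced_monoid H\<^esub> {val Y} \<longleftrightarrow> (\<exists>Z\<in>M. Y = N + Z)"
  by (auto simp: factor_def reduced_carrier reduced_mult val_eq M_simps)

lemma atoms_reduced: "atoms (reduced_monoid H) = (\<lambda>N. {val N}) ` {N \<in> M. unsplittable (image_mset \<phi> N)}"
proof -
  have "Divisibility.irreducible (reduced_monoid H) {val N} \<longleftrightarrow> unsplittable (image_mset \<phi> N)" if N: "N \<in> M" for N
  proof
    assume irr: "Divisibility.irreducible (reduced_monoid H) {val N}"
    have ne: "N \<noteq> {#}" using irr by (auto simp: Divisibility.irreducible_def reduced_Units)
    show "unsplittable (image_mset \<phi> N)" unfolding unsplittable_def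
    proof (intro conjI ballI impI)
      show "image_mset \<phi> N \<noteq> {#}" using ne by simp
      fix c d assume cd: "c \<in> carrier B" "d \<in> carrier B" "image_mset \<phi> N = c + d"
      then obtain Y Z where YZ: "Y \<in> M" "Z \<in> M" "N = Y + Z" "image_mset \<phi> Y = c" "image_mset \<phi> Z = d"
        using split_along_image[OF N cd(3)] by blast
      show "c = {#} \<or> d = {#}"
      proof (cases "Z = {#}")
        case False
        have "properfactor (reduced_monoid H) {val Y} {val N}"
          unfolding properfactor_def using YZ N False by (auto simp: reduced_divides)
        then have "{val Y} \<in> Units (reduced_monoid H)"
          using irr YZ(1) unfolding Divisibility.irreducible_def reduced_carrier by auto
        then have "Y = {#}" using YZ(1) val_eq M_simps(1) by (auto simp: reduced_Units)
        then show ?thesis using YZ(4) by simp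
      qed (use YZ in auto)
    qed
  next
    assume u: "unsplittable (image_mset \<phi> N)"
    show "Divisibility.irreducible (reduced_monoid H) {val N}"
      unfolding Divisibility.irreducible_def
    proof (intro conjI ballI impI)
      show "{val N} \<notin> Units (reduced_monoid H)"
        using u N val_eq M_simps(1) by (auto simp: reduced_Units unsplittable_def)
      fix b assume "b \<in> carrier (reduced_monoid H)" and pf: "properfactor (reduced_monoid H) b {val N}"
      then obtain Y where Y: "Y \<in> M" "b = {val Y}" by (auto simp: reduced_carrier)
      obtain Z where Z: "Z \<in> M" "N = Y + Z" using pf Y N by (auto simp: properfactor_def reduced_divides)
      have "Z \<noteq> {#}" using pf Y N Z by (auto simp: properfactor_def reduced_divides)
      then have "Y = {#}" using u Y Z image_in_B unfolding unsplittable_def by fastforce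
      then show "b \<in> Units (reduced_monoid H)" using Y by (simp add: reduced_Units)
    qed
  qed
  then show ?thesis unfolding atoms_def reduced_carrier by auto
qed

lemma factorization_prod_val:
  assumes "set_mset Z \<subseteq> M"
  shows "\<Sum>\<^sub># Z \<in> M \<and> factorization_prod H (image_mset (\<lambda>N. {val N}) Z) = {val (\<Sum>\<^sub># Z)}"
  using assms
proof (induction Z)
  case empty
  interpret comm_monoid "reduced_monoid H" by (rule reduced_comm_monoid)
  show ?case by (simp add: factorization_prod_def M_simps reduced_one)
next
  case (add N Z)
  have "factorization_prod H (add_mset {val N} (image_mset (\<lambda>N. {val N}) Z)) =
    {val N} \<otimes>\<^bsub>reduced_monoid H\<^esub> factorization_prod H (image_mset (\<lambda>N. {val N}) Z)"
    unfolding factorization_prod_def using add.prems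
    by (intro comm_monoid.finprod_multiset_add[OF reduced_comm_monoid]) (auto simp: reduced_carrier)
  then show ?case using add by (simp add: reduced_mult M_simps)
qed

lemma factorizations_val:
  assumes N: "N \<in> M"
  shows "factorizations H (val N) = image_mset (\<lambda>N. {val N}) `
     {Z. (\<forall>U\<in>#Z. U \<in> M \<and> unsplittable (image_mset \<phi> U)) \<and> \<Sum>\<^sub># Z = N}"
proof -
  have lift: "\<exists>Z. (\<forall>U\<in>#Z. U \<in> M \<and> unsplittable (image_mset \<phi> U)) \<and> z = image_mset (\<lambda>N. {val N}) Z"
    if "z \<in> factorization_monoid H" for z
    using that
  proof (induction z)
    case (add u z)
    then obtain Z where Z: "\<forall>U\<in>#Z. U \<in> M \<and> unsplittable (image_mset \<phi> U)" "z = image_mset (\<lambda>N. {val N}) Z"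
      by (auto simp: factorization_monoid_def)
    obtain U where "u = {val U}" "U \<in> M" "unsplittable (image_mset \<phi> U)"
      using add.prems by (auto simp: factorization_monoid_def atoms_reduced)
    then show ?case using Z by (intro exI[of _ "add_mset U Z"]) auto
  qed auto
  show ?thesis
  proof (intro equalityI subsetI)
    fix z assume z: "z \<in> factorizations H (val N)"
    then obtain Z where Z: "\<forall>U\<in>#Z. U \<in> M \<and> unsplittable (image_mset \<phi> U)" "z = image_mset (\<lambda>N. {val N}) Z"
      using lift by (auto simp: factorizations_def)
    then have "\<Sum>\<^sub># Z \<in> M \<and> factorization_prod H z = {val (\<Sum>\<^sub># Z)}"
      using factorization_prod_val by auto
    then have "\<Sum>\<^sub># Z = N" using z N by (auto simp: factorizations_def coset_val val_eq)
    then show "z \<in> image_mset (\<lambda>N. {val N}) ` {Z. (\<forall>U\<in>#Z. U \<in> M \<and> unsplittable (image_mset \<phi> U)) \<and> \<Sum>\<^sub># Z = N}"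
      using Z by blast
  next
    fix z assume "z \<in> image_mset (\<lambda>N. {val N}) ` {Z. (\<forall>U\<in>#Z. U \<in> M \<and> unsplittable (image_mset \<phi> U)) \<and> \<Sum>\<^sub># Z = N}"
    then obtain Z where Z: "\<forall>U\<in>#Z. U \<in> M \<and> unsplittable (image_mset \<phi> U)" "\<Sum>\<^sub># Z = N" "z = image_mset (\<lambda>N. {val N}) Z"
      by blast
    then show "z \<in> factorizations H (val N)"
      using factorization_prod_val[of Z] N
      by (auto simp: factorizations_def factorization_monoid_def atoms_reduced coset_val)
  qed
qed

lemma theta_bar_val:
  assumes "\<forall>U\<in>#Z. U \<in> M"
  shows "theta_bar B \<theta> (image_mset (\<lambda>N. {val N}) Z) = image_mset (\<lambda>b. {b}) (image_mset (image_mset \<phi>) Z)"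
  unfolding theta_bar_def multiset.map_comp
  using assms by (intro image_mset_cong) (auto simp: theta_val set_mult_def Units_B B_mult)

text \<open>A chain of exchanges between two factorizations stays within the fibre, and each exchange alters two atoms.\<close>

theorem catenary: "cat_fibre H B \<theta> \<le> 2"
  unfolding cat_fibre_def
proof (rule SUP_least)
  fix a assume "a \<in> carrier H"
  then obtain N where N: "N \<in> M" "a = val N" by (auto simp: carrier_H)
  define lift where "lift = image_mset (\<lambda>N. {val N})"
  define good where "good = (\<lambda>Z. (\<forall>U\<in>#Z. U \<in> M \<and> unsplittable (image_mset \<phi> U)) \<and> \<Sum>\<^sub># Z = N)"
  have fac: "factorizations H a = lift ` {Z. good Z}"
    unfolding N(2) factorizations_val[OF N(1)] lift_def good_def ..
  show "cat_fibre_elem H B \<theta> a \<le> 2" unfolding cat_fibre_elem_def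
  proof (rule Least_le, intro ballI impI)
    fix z z' assume "z \<in> factorizations H a" "z' \<in> factorizations H a" and tb: "theta_bar B \<theta> z = theta_bar B \<theta> z'"
    then obtain Z Z' where Z: "good Z" "z = lift Z" and Z': "good Z'" "z' = lift Z'" unfolding fac by blast
    have tbl: "theta_bar B \<theta> (lift Y) = image_mset (\<lambda>b. {b}) (image_mset (image_mset \<phi>) Y)" if "good Y" for Y
      using that theta_bar_val unfolding good_def lift_def by blast
    have inj: "inj (image_mset (\<lambda>b. {b}))" by (rule multiset.inj_map) (simp add: inj_def)
    have im: "image_mset (image_mset \<phi>) Z = image_mset (image_mset \<phi>) Z'"
      using tb unfolding Z Z' tbl[OF Z(1)] tbl[OF Z'(1)] by (rule injD[OF inj])
    have "(swap_step \<phi>)\<^sup>*\<^sup>* Z Z'" using Z(1) Z'(1) im by (intro swap_connected) (auto simp: good_def)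
    then obtain k f where f: "f 0 = Z" "f k = Z'" "\<And>i. i < k \<Longrightarrow> swap_step \<phi> (f i) (f (Suc i))"
      by (auto simp: rtranclp_power relpowp_fun_conv)
    have good: "good (f i) \<and> image_mset (image_mset \<phi>) (f i) = image_mset (image_mset \<phi>) Z" if "i \<le> k" for i
      using that
    proof (induction i)
      case 0 then show ?case using Z f by simp
    next
      case (Suc i)
      then have gi: "good (f i)" and ii: "image_mset (image_mset \<phi>) (f i) = image_mset (image_mset \<phi>) Z" by auto
      note inv = swap_step_invariants[OF f(3)[of i]]
      have im: "image_mset (image_mset \<phi>) (f (Suc i)) = image_mset (image_mset \<phi>) (f i)" using inv(2) Suc.prems by simp
      have sm: "\<Sum>\<^sub># (f (Suc i)) = N" using inv(1) Suc.prems gi by (simp add: good_def)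
      have "U \<in> M \<and> unsplittable (image_mset \<phi> U)" if U: "U \<in># f (Suc i)" for U
      proof -
        have "image_mset \<phi> U \<in># image_mset (image_mset \<phi>) (f i)" using U im by (metis in_image_mset image_eqI)
        then obtain V where V: "V \<in># f i" "image_mset \<phi> V = image_mset \<phi> U" by auto
        have "set_mset U \<subseteq> set_mset N" using U unfolding sm[symmetric] by auto
        then have "set_mset U \<subseteq> P" using N(1) unfolding M_def by blast
        then show ?thesis using V gi unfolding good_def M_def by auto
      qed
      then show ?case using sm im ii by (simp add: good_def)
    qed
    have dist: "fact_dist (lift (f i)) (lift (f (Suc i))) \<le> 2" if i: "i < k" for i
    proof -
      obtain U V U' V' W where "f i = {#U, V#} + W" "f (Suc i) = {#U', V'#} + W"
        using f(3)[OF i] unfolding swap_step_def by blast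
      then have "lift (f i) = lift {#U, V#} + lift W" "lift (f (Suc i)) = lift {#U', V'#} + lift W"
        unfolding lift_def by simp_all
      then have "fact_dist (lift (f i)) (lift (f (Suc i))) \<le> max (size (lift {#U, V#})) (size (lift {#U', V'#}))"
        by (simp only: fact_dist_common_part)
      then show ?thesis by (simp add: lift_def)
    qed
    show "\<exists>k. \<exists>y :: nat \<Rightarrow> 'h set multiset. y 0 = z \<and> y k = z' \<and> (\<forall>i\<le>k. y i \<in> factorizations H a \<and> theta_bar B \<theta> (y i) = theta_bar B \<theta> z) \<and>
        (\<forall>i\<in>{1..k}. enat (fact_dist (y (i - 1)) (y i)) \<le> 2)"
    proof (rule exI[where x = k], rule exI[where x = "\<lambda>i. lift (f i)"], intro conjI allI impI ballI)
      fix i assume i: "i \<le> k"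
      show "lift (f i) \<in> factorizations H a" unfolding fac using good[OF i] by blast
      show "theta_bar B \<theta> (lift (f i)) = theta_bar B \<theta> z"
        unfolding Z(2) using good[OF i] Z(1) by (simp add: tbl)
    next
      fix i assume "i \<in> {1..k}"
      then have "i - 1 < k" "Suc (i - 1) = i" by auto
      then have "fact_dist (lift (f (i - 1))) (lift (f i)) \<le> 2" using dist[of "i - 1"] by simp
      then show "enat (fact_dist (lift (f (i - 1))) (lift (f i))) \<le> 2" by (simp add: numeral_eq_enat)
    qed (use f Z Z' in auto)
  qed
qed

end

section \<open>Represented numbers as products of primes\<close>

lemma image_mset_eq_sum_replicate:
  "image_mset f M = (\<Sum>p\<in>set_mset M. replicate_mset (count M p) (f p))"
proof (induction M)
  case (add x M)
  have r: "replicate_mset (count (add_mset x M) p) (f p) = replicate_mset (count M p) (f p) + (if p = x then {#f x#} else {#})" for p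
    by simp
  have e: "(\<Sum>p\<in>insert x (set_mset M). replicate_mset (count M p) (f p)) = (\<Sum>p\<in>set_mset M. replicate_mset (count M p) (f p))"
    by (cases "x \<in># M") (auto simp: insert_absorb count_eq_zero_iff)
  show ?case unfolding r set_mset_add_mset_insert sum.distrib e add[symmetric] by (simp add: sum.delta')
qed simp

text \<open>The inertia degrees are given through \<open>\<Delta>\<close> instead of the discriminant of the field; then degree one means that
  \<open>p\<close> is the leading coefficient of a form of discriminant \<open>\<Delta>\<close>.\<close>

locale form_primes = fundamental_outside +
  fixes \<pp> :: "nat \<Rightarrow> complex set"
  assumes inertia: "p \<in> primes_not_dvd m \<Longrightarrow> inertia_degree \<Delta> p = (if split_prime p then 1 else 2)"
    and prime_choice: "prime_ideal_choice m \<Delta> \<pp>"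
begin

abbreviation "\<P> \<equiv> primes_not_dvd m"

definition form_class where "form_class p = prime_form_class \<Delta> \<pp> p"

definition deg :: "nat \<Rightarrow> nat" where "deg p = (if split_prime p then 1 else 2)"

lemma prime_above: "p \<in> \<P> \<Longrightarrow> primeideal (\<pp> p) \<O> \<and> lies_above (\<pp> p) p"
  using prime_choice unfolding prime_ideal_choice_def by blast

lemma prime_P: "p \<in> \<P> \<Longrightarrow> Factorial_Ring.prime p"
  by (simp add: primes_not_dvd_def)

lemma form_class_unique:
  assumes "F \<in> carrier G" "\<Phi> \<Delta> F = narrow_class \<Delta> (\<pp> p)"
  shows "form_class p = F"
  unfolding form_class_def prime_form_class_def assms(2)[symmetric] by (rule inv_into_f_f[OF \<Phi>_inj assms(1)])

lemma form_class_split: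
  assumes p: "p \<in> \<P>" and sp: "split_prime p"
  obtains b c where "(int p, b, c) \<in> forms" "form_class p = bqf_class (int p, b, c)"
proof -
  obtain b0 where "4 * int p dvd b0^2 - \<Delta>" using sp by (auto simp: split_prime_def)
  then obtain b where b: "4 * int p dvd b^2 - \<Delta>" "\<pp> p = lattice (int p) b"
    using prime_ideal_split prime_above[OF p] by blast
  obtain c where "b^2 - \<Delta> = 4 * int p * c" using b(1) by (elim dvdE)
  then have d: "b^2 - 4 * int p * c = \<Delta>" by simp
  have f: "(int p, b, c) \<in> forms" by (rule prime_form_primitive[OF p d])
  have "\<Phi> \<Delta> (bqf_class (int p, b, c)) = narrow_class \<Delta> (lattice (int p) b)"
    using \<Phi>_eq[OF class_in_carrier[OF f] in_bqf_class_self] prime_gt_0_nat[OF prime_P[OF p]] by simp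
  then have "form_class p = bqf_class (int p, b, c)"
    using form_class_unique[OF class_in_carrier[OF f]] b(2) by simp
  then show thesis using that f by blast
qed

text \<open>The ideal generated by \<open>p\<close> is principal with the totally positive generator \<open>p\<close>.\<close>

lemma form_class_inert:
  assumes p: "p \<in> \<P>" and ns: "\<not> split_prime p"
  shows "form_class p = \<one>\<^bsub>G\<^esub>"
proof (rule form_class_unique)
  show "\<one>\<^bsub>G\<^esub> \<in> carrier G" by simp
  have ppO: "\<pp> p = (*) (of_int (int p)) ` lattice 1 s"
    using prime_ideal_inert[OF prime_P[OF p]] prime_above[OF p] ns
    unfolding split_prime_def quad_order_eq[symmetric] by simp
  have d: "s^2 - 4 * 1 * (- D) = \<Delta>" using principal_form by (simp add: bqf_forms_iff)
  have mod1: "order_module (lattice 1 s)" by (rule lattice_order_module[OF d])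
  have modp: "order_module (\<pp> p)"
  proof -
    have "ideal (\<pp> p) \<O>" using prime_above[OF p] primeideal.axioms(1) by blast
    then show ?thesis
      using ideal_add ideal.I_l_closed[of "\<pp> p"] additive_subgroup.zero_closed[OF ideal.axioms(1)]
      unfolding order_module_def by fastforce
  qed
  have "int p > 0" using prime_gt_0_nat[OF prime_P[OF p]] by simp
  moreover have "(of_int (int p) :: complex) \<in> quad_field \<Delta>" unfolding K_elt_of_int(1) by simp
  ultimately have "narrow_class \<Delta> (\<pp> p) = narrow_class \<Delta> (lattice 1 s)"
    unfolding narrow_class_eq_iff[OF modp mod1]
    using totally_positive_of_int[of "int p"] ppO by (intro exI[of _ "of_int (int p)"]) simp
  moreover have "\<Phi> \<Delta> \<one>\<^bsub>G\<^esub> = narrow_class \<Delta> (lattice 1 s)"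
    by (rule \<Phi>_eq[OF G.one_closed, of 1 s "- D"]) (simp_all add: one_eq in_bqf_class_self)
  ultimately show "\<Phi> \<Delta> \<one>\<^bsub>G\<^esub> = narrow_class \<Delta> (\<pp> p)" by simp
qed

lemma form_class_closed: "p \<in> \<P> \<Longrightarrow> form_class p \<in> carrier G"
  using form_class_split form_class_inert class_in_carrier by (metis G.one_closed)

lemma form_class_surj: "form_class ` \<P> = carrier G"
proof
  show "form_class ` \<P> \<subseteq> carrier G" using form_class_closed by blast
  show "carrier G \<subseteq> form_class ` \<P>"
  proof
    fix F assume F: "F \<in> carrier G"
    then have "\<Phi> \<Delta> F \<in> carrier (narrow_class_group \<Delta>)" by (rule \<Phi>_in_carrier)
    then obtain p where "p \<in> \<P>" "\<Phi> \<Delta> F = narrow_class \<Delta> (\<pp> p)"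
      using prime_choice unfolding prime_ideal_choice_def by blast
    then show "F \<in> form_class ` \<P>" using form_class_unique[OF F] by blast
  qed
qed

definition prime_product :: "nat multiset \<Rightarrow> nat" where "prime_product M = (\<Prod>p\<in>#M. p ^ deg p)"

lemma prime_product_simps: "prime_product {#} = 1" "prime_product (add_mset p M) = p ^ deg p * prime_product M" "prime_product (M + N) = prime_product M * prime_product N"
  by (simp_all add: prime_product_def)

lemma deg_pos: "deg p > 0"
  by (simp add: deg_def)

lemma prime_product_pos: "set_mset M \<subseteq> \<P> \<Longrightarrow> prime_product M > 0"
  by (induction M) (auto simp: prime_product_simps prime_gt_0_nat prime_P)

lemma prime_product_coprime: "set_mset M \<subseteq> \<P> \<Longrightarrow> coprime (prime_product M) m"
proof (induction M)
  case (add p M)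
  then have "Factorial_Ring.prime p" "\<not> p dvd m" by (auto simp: primes_not_dvd_def)
  then have "coprime p m" by (rule prime_imp_coprime)
  then show ?case using add by (simp add: prime_product_simps)
qed (simp add: prime_product_simps)

lemma multiplicity_prime_product: "set_mset M \<subseteq> \<P> \<Longrightarrow> Factorial_Ring.prime p \<Longrightarrow> multiplicity p (prime_product M) = count M p * deg p"
proof (induction M)
  case empty
  then show ?case by (simp add: prime_product_simps)
next
  case (add q M)
  have q: "Factorial_Ring.prime q" "q > 0" using add.prems prime_P prime_gt_0_nat by auto
  have "multiplicity p (prime_product (add_mset q M)) = multiplicity p (q ^ deg q) + multiplicity p (prime_product M)"
    unfolding prime_product_simps using q prime_product_pos[of M] add.prems
    by (intro prime_elem_multiplicity_mult_distrib) auto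
  moreover have "multiplicity p (q ^ deg q) = (if p = q then deg q else 0)"
    using add.prems(2) q(1) by (auto simp: multiplicity_distinct_prime_power)
  moreover have "multiplicity p (prime_product M) = count M p * deg p" using add by simp
  ultimately show ?case by simp
qed

lemma prime_product_inj: "inj_on prime_product {M. set_mset M \<subseteq> \<P>}"
proof (rule inj_onI)
  fix M N assume M: "M \<in> {M. set_mset M \<subseteq> \<P>}" and N: "N \<in> {M. set_mset M \<subseteq> \<P>}" and e: "prime_product M = prime_product N"
  show "M = N"
  proof (rule multiset_eqI)
    fix p
    show "count M p = count N p"
    proof (cases "Factorial_Ring.prime p")
      case True
      have "set_mset M \<subseteq> \<P>" "set_mset N \<subseteq> \<P>" using M N by simp_all
      then have "count M p * deg p = count N p * deg p"
        using multiplicity_prime_product[of M p] multiplicity_prime_product[of N p] True unfolding e by metis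
      then show ?thesis using deg_pos[of p] by simp
    next
      case False
      then have "p \<notin># M" "p \<notin># N" using M N prime_P by auto
      then show ?thesis by (simp add: not_in_iff)
    qed
  qed
qed

lemma vartheta_prime_product:
  assumes M: "set_mset M \<subseteq> \<P>"
  shows "vartheta m \<Delta> \<pp> (prime_product M) = image_mset form_class M"
proof -
  have "{p \<in> \<P>. p dvd prime_product M} = set_mset M"
  proof (intro equalityI subsetI)
    fix p assume "p \<in> {p \<in> \<P>. p dvd prime_product M}"
    then have p: "Factorial_Ring.prime p" "p dvd prime_product M" using prime_P by auto
    then have "multiplicity p (prime_product M) > 0"
      using prime_product_pos[OF M] by (simp add: prime_multiplicity_gt_zero_iff)
    then show "p \<in># M" unfolding multiplicity_prime_product[OF M p(1)] by (simp add: count_greater_zero_iff)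
  next
    fix p assume p: "p \<in># M"
    then obtain N where "M = add_mset p N" by (meson mset_add)
    then have "p dvd prime_product M" using deg_pos[of p] by (simp add: prime_product_simps dvd_mult2 dvd_power)
    then show "p \<in> {p \<in> \<P>. p dvd prime_product M}" using p M by auto
  qed
  moreover have "multiplicity p (prime_product M) div inertia_degree \<Delta> p = count M p" if "p \<in># M" for p
  proof -
    have "p \<in> \<P>" using that M by auto
    then have "inertia_degree \<Delta> p = deg p" using inertia by (simp add: deg_def)
    then show ?thesis using multiplicity_prime_product[OF M prime_P[OF \<open>p \<in> \<P>\<close>]] deg_pos[of p] by simp
  qed
  ultimately show ?thesis
    unfolding vartheta_def form_class_def[symmetric] image_mset_eq_sum_replicate by (intro sum.cong) auto
qed

text \<open>The classes that represent a product of primes are the signed products of the classes of these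
  primes: multiplication of representations gives one direction, descent along a prime the other.\<close>

lemma represents_prime_product_iff:
  assumes "set_mset M \<subseteq> \<P>" "F \<in> carrier G"
  shows "represents F (int (prime_product M)) \<longleftrightarrow> signed_product G (image_mset form_class M) F"
  using assms
proof (induction M arbitrary: F)
  case empty
  have "signed_product G {#} F \<longleftrightarrow> F = \<one>\<^bsub>G\<^esub>"
    by (auto intro: signed_product.empty elim: signed_product.cases)
  then show ?case using represents_1_iff[OF empty.prems(2)] by (simp add: prime_product_simps)
next
  case (add p M)
  have p: "p \<in> \<P>" and M: "set_mset M \<subseteq> \<P>" using add.prems by auto
  have F: "F \<in> carrier G" by (rule add.prems(2))
  have Q: "form_class p \<in> carrier G" by (rule form_class_closed[OF p])
  have vM: "int (prime_product M) > 0" using prime_product_pos[OF M] by simp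
  have step: "represents F (int (p ^ deg p) * int (prime_product M)) \<longleftrightarrow>
      represents (F \<otimes>\<^bsub>G\<^esub> form_class p) (int (prime_product M)) \<or> represents (F \<otimes>\<^bsub>G\<^esub> inv\<^bsub>G\<^esub> (form_class p)) (int (prime_product M))"
  proof (cases "split_prime p")
    case True
    then have dp: "int (p ^ deg p) = int p" by (simp add: deg_def)
    obtain b c where f: "(int p, b, c) \<in> forms" and Qe: "form_class p = bqf_class (int p, b, c)"
      using form_class_split[OF p True] by blast
    have "int p = bqf_eval (int p, b, c) 1 0" by simp
    then have rQ: "represents (form_class p) (int p)" unfolding Qe represents_class_iff by blast
    have rQ': "represents (inv\<^bsub>G\<^esub> (form_class p)) (int p)" by (rule represents_inv[OF Q rQ])
    show ?thesis unfolding dp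
    proof
      assume "represents F (int p * int (prime_product M))"
      then show "represents (F \<otimes>\<^bsub>G\<^esub> form_class p) (int (prime_product M)) \<or> represents (F \<otimes>\<^bsub>G\<^esub> inv\<^bsub>G\<^esub> (form_class p)) (int (prime_product M))"
        using descent_split[OF p f vM F] unfolding Qe by blast
    next
      assume "represents (F \<otimes>\<^bsub>G\<^esub> form_class p) (int (prime_product M)) \<or> represents (F \<otimes>\<^bsub>G\<^esub> inv\<^bsub>G\<^esub> (form_class p)) (int (prime_product M))"
      then show "represents F (int p * int (prime_product M))"
      proof
        assume "represents (F \<otimes>\<^bsub>G\<^esub> form_class p) (int (prime_product M))"
        then have "represents ((F \<otimes>\<^bsub>G\<^esub> form_class p) \<otimes>\<^bsub>G\<^esub> inv\<^bsub>G\<^esub> (form_class p)) (int (prime_product M) * int p)"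
          by (rule represents_mult[OF G.m_closed[OF F Q] G.inv_closed[OF Q] _ rQ'])
        then show ?thesis using F Q by (simp add: G.m_assoc mult.commute)
      next
        assume "represents (F \<otimes>\<^bsub>G\<^esub> inv\<^bsub>G\<^esub> (form_class p)) (int (prime_product M))"
        then have "represents ((F \<otimes>\<^bsub>G\<^esub> inv\<^bsub>G\<^esub> (form_class p)) \<otimes>\<^bsub>G\<^esub> form_class p) (int (prime_product M) * int p)"
          by (rule represents_mult[OF G.m_closed[OF F G.inv_closed[OF Q]] Q _ rQ])
        then show ?thesis using F Q by (simp add: G.m_assoc mult.commute)
      qed
    qed
  next
    case False
    then have dp: "int (p ^ deg p) = (int p)^2" by (simp add: deg_def)
    have Q1: "form_class p = \<one>\<^bsub>G\<^esub>" by (rule form_class_inert[OF p False])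
    have p0: "(int p)^2 > 0" using prime_gt_0_nat[OF prime_P[OF p]] by simp
    have "represents F ((int p)^2 * int (prime_product M)) \<longleftrightarrow> represents F (int (prime_product M))"
    proof
      assume r: "represents F ((int p)^2 * int (prime_product M))"
      have nz: "(int p)^2 * int (prime_product M) \<noteq> 0" using p0 vM by simp
      have "int p dvd (int p)^2 * int (prime_product M)" by (simp add: power2_eq_square)
      then obtain k where "(int p)^2 * int (prime_product M) = (int p)^2 * k" "represents F k"
        using descent_inert[OF p False nz F r] by blast
      then show "represents F (int (prime_product M))" using p0 by simp
    qed (rule represents_square_mult)
    then show ?thesis unfolding dp Q1 using F by simp
  qed
  have "represents F (int (prime_product (add_mset p M))) \<longleftrightarrow>
      signed_product G (image_mset form_class M) (F \<otimes>\<^bsub>G\<^esub> form_class p) \<or>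
      signed_product G (image_mset form_class M) (F \<otimes>\<^bsub>G\<^esub> inv\<^bsub>G\<^esub> (form_class p))"
    unfolding prime_product_simps of_nat_mult step using add.IH[OF M] F Q by simp
  also have "\<dots> \<longleftrightarrow> signed_product G (add_mset (form_class p) (image_mset form_class M)) F"
    by (rule G.signed_product_add_mset_iff[symmetric, OF Q F])
  finally show ?case by simp
qed

text \<open>Descent along a prime divisor leaves a smaller number represented by some class.\<close>

lemma represented_is_prime_product:
  assumes "n > 0" "coprime n m" "F \<in> carrier G" "represents F (int n)"
  shows "\<exists>M. set_mset M \<subseteq> \<P> \<and> n = prime_product M"
  using assms
proof (induction n arbitrary: F rule: less_induct)
  case (less n)
  show ?case
  proof (cases "n = 1")
    case True
    then show ?thesis by (intro exI[of _ "{#}"]) (simp add: prime_product_simps)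
  next
    case False
    then obtain p where pp: "Factorial_Ring.prime p" and pn: "p dvd n" using prime_factor_nat by blast
    have "\<not> p dvd m"
    proof
      assume "p dvd m"
      then have "is_unit p" using coprime_common_divisor[OF less.prems(2) pn] by blast
      then show False using pp not_prime_unit by blast
    qed
    then have p: "p \<in> \<P>" using pp by (simp add: primes_not_dvd_def)
    have p2: "p \<ge> 2" by (rule prime_ge_2_nat[OF pp])
    have ex: "\<exists>k E. n = p ^ deg p * k \<and> E \<in> carrier G \<and> represents E (int k)"
    proof (cases "split_prime p")
      case True
      obtain b c where f: "(int p, b, c) \<in> forms" and Qe: "form_class p = bqf_class (int p, b, c)"
        using form_class_split[OF p True] by blast
      obtain k where k: "n = p * k" using pn by (elim dvdE)
      have "int k > 0" using less.prems(1) k by (cases k) auto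
      have "represents F (int p * int k)" using less.prems(4) k by simp
      then have "represents (F \<otimes>\<^bsub>G\<^esub> bqf_class (int p, b, c)) (int k) \<or> represents (F \<otimes>\<^bsub>G\<^esub> inv\<^bsub>G\<^esub> (bqf_class (int p, b, c))) (int k)"
        by (rule descent_split[OF p f \<open>int k > 0\<close> less.prems(3)])
      moreover have "n = p ^ deg p * k" using True k by (simp add: deg_def)
      ultimately show ?thesis using less.prems(3) class_in_carrier[OF f] by (metis G.m_closed G.inv_closed)
    next
      case False
      have "int n \<noteq> 0" "int p dvd int n" using less.prems(1) pn by auto
      then obtain j where j: "int n = (int p)^2 * j" "represents F j"
        using descent_inert[OF p False _ less.prems(3,4)] by blast
      have "j > 0" using j(1) less.prems(1) p2 by (metis of_nat_0_less_iff zero_less_mult_pos zero_less_power2 of_nat_0_eq_iff not_numeral_le_zero)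
      then obtain k where k: "j = int k" by (metis nonneg_int_cases less_imp_le)
      have "int n = int (p^2 * k)" using j(1) k by simp
      then have "n = p ^ deg p * k" using False by (simp only: of_nat_eq_iff) (simp add: deg_def)
      then show ?thesis using j(2) k less.prems(3) by blast
    qed
    then obtain k E where k: "n = p ^ deg p * k" "E \<in> carrier G" "represents E (int k)" by blast
    have k0: "k > 0" using k(1) less.prems(1) by (cases k) auto
    have "1 < p ^ deg p" using p2 deg_pos[of p] by (intro one_less_power) auto
    then have "k < n" unfolding k(1) using k0 by simp
    moreover have "coprime k m" using less.prems(2) unfolding k(1) by simp
    ultimately obtain M where M: "set_mset M \<subseteq> \<P>" "k = prime_product M"
      using less.IH[OF _ k0 _ k(2,3)] by blast
    then show ?thesis using p k(1) by (intro exI[of _ "add_mset p M"]) (simp add: prime_product_simps)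
  qed
qed

lemma prime_product_represented:
  "set_mset M \<subseteq> \<P> \<Longrightarrow> \<exists>F\<in>carrier G. signed_product G (image_mset form_class M) F"
proof (induction M)
  case empty
  show ?case using signed_product.empty[of G] G.one_closed by auto
next
  case (add p M)
  then obtain F where "F \<in> carrier G" "signed_product G (image_mset form_class M) F" by auto
  moreover have "form_class p \<in> carrier G" using add.prems form_class_closed by simp
  ultimately show ?case using signed_product.plus[of G _ F "form_class p"] by (auto intro!: bexI[of _ "F \<otimes>\<^bsub>G\<^esub> form_class p"])
qed

lemma R_set_eq: "R_set m \<Delta> = prime_product ` {M. set_mset M \<subseteq> \<P>}"
proof (intro equalityI subsetI)
  fix n assume "n \<in> R_set m \<Delta>"
  then show "n \<in> prime_product ` {M. set_mset M \<subseteq> \<P>}" using represented_is_prime_product unfolding R_set_def by blast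
next
  fix n assume "n \<in> prime_product ` {M. set_mset M \<subseteq> \<P>}"
  then obtain M where M: "set_mset M \<subseteq> \<P>" "n = prime_product M" by blast
  then show "n \<in> R_set m \<Delta>"
    using prime_product_represented[OF M(1)] represents_prime_product_iff[OF M(1)] prime_product_pos[OF M(1)] prime_product_coprime[OF M(1)]
    unfolding R_set_def by auto
qed

lemma R0_iff:
  assumes "n \<in> R_set m \<Delta>"
  shows "n \<in> R0_set m \<Delta> \<longleftrightarrow> vartheta m \<Delta> \<pp> n \<in> carrier (pm_zero_sum_monoid G)"
proof -
  obtain M where M: "set_mset M \<subseteq> \<P>" "n = prime_product M" using assms R_set_eq by auto
  show ?thesis using assms represents_prime_product_iff[OF M(1) G.one_closed] vartheta_prime_product[OF M(1)] M(2)
    by (simp add: R0_set_def G.pm_zero_sum_iff)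
qed

lemma relabelling_R0:
  "relabelling \<P> form_class prime_product (R0_monoid m \<Delta>) (pm_zero_sum_monoid G) (restrict (vartheta m \<Delta> \<pp>) (R0_set m \<Delta>))"
proof
  let ?B = "pm_zero_sum_monoid G"
  have R0: "R0_set m \<Delta> = prime_product ` {M. set_mset M \<subseteq> \<P> \<and> image_mset form_class M \<in> carrier ?B}"
  proof (intro equalityI subsetI)
    fix n assume n: "n \<in> R0_set m \<Delta>"
    then have nR: "n \<in> R_set m \<Delta>" by (simp add: R0_set_def)
    then obtain M where M: "set_mset M \<subseteq> \<P>" "n = prime_product M" using R_set_eq by auto
    have "image_mset form_class M \<in> carrier ?B" using n R0_iff[OF nR] vartheta_prime_product[OF M(1)] M(2) by simp
    then show "n \<in> prime_product ` {M. set_mset M \<subseteq> \<P> \<and> image_mset form_class M \<in> carrier ?B}" using M by blast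
  next
    fix n assume "n \<in> prime_product ` {M. set_mset M \<subseteq> \<P> \<and> image_mset form_class M \<in> carrier ?B}"
    then obtain M where M: "set_mset M \<subseteq> \<P>" "image_mset form_class M \<in> carrier ?B" "n = prime_product M" by blast
    then have nR: "n \<in> R_set m \<Delta>" using R_set_eq by blast
    show "n \<in> R0_set m \<Delta>" using R0_iff[OF nR] vartheta_prime_product[OF M(1)] M(2,3) by simp
  qed
  show "mult ?B = (+)" "one ?B = {#}" by (simp_all add: pm_zero_sum_monoid_def)
  show "{#} \<in> carrier ?B" unfolding G.pm_zero_sum_iff by (rule signed_product.empty)
  show "b + c \<in> carrier ?B" if "b \<in> carrier ?B" "c \<in> carrier ?B" for b c
    using that G.signed_product_add[of c "\<one>\<^bsub>G\<^esub>" b "\<one>\<^bsub>G\<^esub>"] unfolding G.pm_zero_sum_iff by simp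
  show "set_mset b \<subseteq> form_class ` \<P>" if "b \<in> carrier ?B" for b
    using that G.signed_product_closed[of b "\<one>\<^bsub>G\<^esub>"] unfolding G.pm_zero_sum_iff form_class_surj by simp
  show "carrier (R0_monoid m \<Delta>) = prime_product ` {M. set_mset M \<subseteq> \<P> \<and> image_mset form_class M \<in> carrier ?B}"
    using R0 by (simp add: R0_monoid_def nat_mult_monoid_def)
  show "prime_product M \<otimes>\<^bsub>R0_monoid m \<Delta>\<^esub> prime_product N = prime_product (M + N)" for M N
    by (simp add: R0_monoid_def nat_mult_monoid_def prime_product_simps)
  show "\<one>\<^bsub>R0_monoid m \<Delta>\<^esub> = prime_product {#}"
    by (simp add: R0_monoid_def nat_mult_monoid_def prime_product_simps)
  show "inj_on prime_product {M. set_mset M \<subseteq> \<P>}" by (rule prime_product_inj)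
  show "restrict (vartheta m \<Delta> \<pp>) (R0_set m \<Delta>) (prime_product M) = image_mset form_class M"
    if "set_mset M \<subseteq> \<P>" "image_mset form_class M \<in> carrier ?B" for M
    using that R0 vartheta_prime_product[OF that(1)] by auto
qed

end

theorem theorem3p5:
  fixes \<Delta> :: int and m :: nat and \<pp> :: "nat \<Rightarrow> complex set"
  assumes nonsquare: "\<nexists>k :: int. \<Delta> = k^2"
    and mod4: "\<Delta> mod 4 = 0 \<or> \<Delta> mod 4 = 1"
    and conductor: "\<Delta> = field_disc \<Delta> * (int m)^2"
    and choice: "prime_ideal_choice m \<Delta> \<pp>"
  shows "(\<forall>n \<in> R_set m \<Delta>. n \<in> R0_set m \<Delta> \<longleftrightarrow>
            vartheta m \<Delta> \<pp> n \<in> carrier (pm_zero_sum_monoid (form_class_group \<Delta>)))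
    \<and> transfer_hom (R0_monoid m \<Delta>) (pm_zero_sum_monoid (form_class_group \<Delta>))
        (restrict (vartheta m \<Delta> \<pp>) (R0_set m \<Delta>))
    \<and> cat_fibre (R0_monoid m \<Delta>) (pm_zero_sum_monoid (form_class_group \<Delta>))
        (restrict (vartheta m \<Delta> \<pp>) (R0_set m \<Delta>)) \<le> 2"
proof -
  interpret quadratic_discriminant \<Delta> by unfold_locales (fact nonsquare mod4)+
  interpret fundamental_outside \<Delta> m by (rule conductor_consequences(1)[OF conductor])
  interpret form_primes \<Delta> m \<pp>
    by unfold_locales (use conductor_consequences(2)[OF conductor] choice in \<open>simp_all add: split_prime_def\<close>)
  interpret relabelling "primes_not_dvd m" form_class "prime_product" "R0_monoid m \<Delta>"
    "pm_zero_sum_monoid (form_class_group \<Delta>)" "restrict (vartheta m \<Delta> \<pp>) (R0_set m \<Delta>)"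
    by (rule relabelling_R0)
  show ?thesis using R0_iff transfer catenary by blast
qed

end
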